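(* There exists a unique pair $(R_1,R_2)$ of formal power series in $t$ with coefficients in $\mathbb{Q}[z_1,z_2,\ldots]$ such that $$R_1=\frac t2\sum_{i\ge1}z_i[u^{i-1}]R^{-1/2}\quad\text{and}\quad R_2=t-3R_1^2+\frac t2\sum_{i\ge1}z_i[u^i]R^{-1/2},$$ where $R=1-4uR_1-4u^2R_2$. Let $G(t;\mathbf z)$ be the generating function of rooted planar maps counted by the number of edges ($t$) and the number of faces of degree $i$ ($z_i$, $i\ge1$). Then $$t^2\,(tG(t;\mathbf z))'=(R_2+R_1^2)(R_2+9R_1^2),$$ where the derivative is taken with respect to $t$, and $$tG(t;\mathbf z)=\frac1t(R_2+R_1^2)(3R_2+15R_1^2-2t)+R_1[u]\frac{\beta}{\sqrt R}-\frac12[u^2]\frac{\beta}{\sqrt R},\qquad\text{where }\beta=\sum_{i\ge1}z_iu^{-i}.$$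
   Context: A planar map is a connected graph (loops and multiple edges allowed) embedded in the oriented sphere up to orientation-preserving homeomorphism; rooted means one edge is distinguished and oriented; the degree of a face is its number of edge incidences; all faces (including the root-face) are counted. $R^{-1/2}$ is expanded as a power series in $u$, and $[u^j]$ denotes coefficient extraction in $u$ (for $\beta/\sqrt R$, $[u^j]\beta R^{-1/2}=\sum_{i\ge1}z_i[u^{i+j}]R^{-1/2}$). *)

theory Defs
  imports
    "HOL-Computational_Algebra.Formal_Laurent_Series"
    "HOL-Combinatorics.Orbits"
    "HOL-Library.Poly_Mapping"
begin

section \<open>Rooted planar maps\<close>

text \<open>
  Maps are taken up to orientation-preserving homeomorphism of the sphere and are encoded by
  their rotation systems. The elements of \<open>D\<close> are the darts (oriented edges). The permutation
  \<open>\<alpha>\<close> reverses a dart, and \<open>\<sigma>\<close> sends a dart to the next one, in counterclockwise order,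
  around its origin. Vertices, edges and faces are the cycles of \<open>\<sigma>\<close>, \<open>\<alpha>\<close> and \<open>\<sigma> \<circ> \<alpha>\<close>. Each
  edge has two sides, one per dart, so the length of a cycle of \<open>\<sigma> \<circ> \<alpha>\<close> is the number of edge
  incidences of the face. The underlying surface of a connected map is the sphere iff
  its Euler characteristic is 2.
\<close>

definition map_vertices :: "'a set \<Rightarrow> ('a \<Rightarrow> 'a) \<Rightarrow> 'a set set" where
  "map_vertices D \<sigma> = orbit \<sigma> ` D"

definition map_edges :: "'a set \<Rightarrow> ('a \<Rightarrow> 'a) \<Rightarrow> 'a set set" where
  "map_edges D \<alpha> = orbit \<alpha> ` D"

definition map_faces :: "'a set \<Rightarrow> ('a \<Rightarrow> 'a) \<Rightarrow> ('a \<Rightarrow> 'a) \<Rightarrow> 'a set set" where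
  "map_faces D \<sigma> \<alpha> = orbit (\<sigma> \<circ> \<alpha>) ` D"

definition map_connected :: "'a set \<Rightarrow> ('a \<Rightarrow> 'a) \<Rightarrow> ('a \<Rightarrow> 'a) \<Rightarrow> bool" where
  "map_connected D \<sigma> \<alpha> \<longleftrightarrow> (\<forall>d\<in>D. \<forall>e\<in>D. (d, e) \<in> {(x, y). y = \<sigma> x \<or> y = \<alpha> x}\<^sup>*)"

definition planar_map :: "'a set \<Rightarrow> ('a \<Rightarrow> 'a) \<Rightarrow> ('a \<Rightarrow> 'a) \<Rightarrow> bool" where
  "planar_map D \<sigma> \<alpha> \<longleftrightarrow>
     finite D \<and> \<sigma> permutes D \<and> \<alpha> permutes D \<and> (\<forall>d\<in>D. \<alpha> d \<noteq> d \<and> \<alpha> (\<alpha> d) = d) \<and>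
     map_connected D \<sigma> \<alpha> \<and>
     card (map_vertices D \<sigma>) + card (map_faces D \<sigma> \<alpha>) = card (map_edges D \<alpha>) + 2"

text \<open>
  The root is a dart, that is, an edge with an orientation. A map with \<open>n \<ge> 1\<close> edges has \<open>2 * n\<close>
  darts, which may be labelled by \<open>{..<2 * n}\<close>; relabellings of the darts that
  preserve the rotations and the root are the rooted-map isomorphisms.
\<close>

type_synonym rooted_map = "(nat \<Rightarrow> nat) \<times> (nat \<Rightarrow> nat) \<times> nat"

definition labelled_rooted_maps :: "nat \<Rightarrow> rooted_map set" where
  "labelled_rooted_maps n = {(\<sigma>, \<alpha>, r). planar_map {..<2 * n} \<sigma> \<alpha> \<and> r \<in> {..<2 * n}}"

definition rooted_map_iso :: "nat \<Rightarrow> (rooted_map \<times> rooted_map) set" where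
  "rooted_map_iso n = {((\<sigma>, \<alpha>, r), (\<sigma>', \<alpha>', r')).
     (\<sigma>, \<alpha>, r) \<in> labelled_rooted_maps n \<and> (\<sigma>', \<alpha>', r') \<in> labelled_rooted_maps n \<and>
     (\<exists>\<pi>. \<pi> permutes {..<2 * n} \<and> \<pi> \<circ> \<sigma> = \<sigma>' \<circ> \<pi> \<and> \<pi> \<circ> \<alpha> = \<alpha>' \<circ> \<pi> \<and> \<pi> r = r')}"

definition rooted_planar_maps :: "nat \<Rightarrow> rooted_map set set" where
  "rooted_planar_maps n = labelled_rooted_maps n // rooted_map_iso n"


section \<open>The generating function\<close>

text \<open>
  The ring $\mathbb{Q}[z_1,z_2,\ldots]$. Since the variables of the paper are indexed from 1
  while the generators of \<^typ>\<open>(nat \<Rightarrow>\<^sub>0 nat) \<Rightarrow>\<^sub>0 rat\<close> are indexed from 0, generator \<open>i - 1\<close>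
  is \<open>z\<^sub>i\<close>; only \<open>zvar i\<close> with \<open>i \<ge> 1\<close> is meaningful.
\<close>

type_synonym zpoly = "(nat \<Rightarrow>\<^sub>0 nat) \<Rightarrow>\<^sub>0 rat"

definition zconst :: "rat \<Rightarrow> zpoly" where
  "zconst q = Poly_Mapping.single 0 q"

definition zvar :: "nat \<Rightarrow> zpoly" where
  "zvar i = Poly_Mapping.single (Poly_Mapping.single (i - 1) 1) 1"

definition face_weight :: "nat \<Rightarrow> rooted_map \<Rightarrow> zpoly" where
  "face_weight n = (\<lambda>(\<sigma>, \<alpha>, r). \<Prod>f\<in>map_faces {..<2 * n} \<sigma> \<alpha>. zvar (card f))"

text \<open>
  The summand 1 is the atomic map (one vertex, no edge), which has no dart: its only face has
  degree 0 and so carries no \<open>z\<close>. The other sum has no term for \<open>n = 0\<close>. All elements of an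
  isomorphism class have the same weight (see \<open>face_weight_iso\<close> below).
\<close>

definition map_gf :: "zpoly fps" where
  "map_gf = 1 + Abs_fps (\<lambda>n. \<Sum>M\<in>rooted_planar_maps n. the_elem (face_weight n ` M))"


section \<open>The system defining the series \<open>R\<^sub>1\<close> and \<open>R\<^sub>2\<close>\<close>

text \<open>
  \<open>(\<cdot>)\<^sup>-\<^sup>1\<^sup>/\<^sup>2\<close> for series in \<open>u\<close> with constant term 1, by the binomial series in \<open>S - 1\<close>.
  In \<^typ>\<open>zpoly fps fps\<close> the outer variable is \<open>u\<close> and the inner one is \<open>t\<close>.
\<close>

definition inv_sqrt_fps :: "zpoly fps fps \<Rightarrow> zpoly fps fps" where
  "inv_sqrt_fps S = Abs_fps (\<lambda>k. fps_const (zconst ((- 1 / 2) gchoose k))) oo (S - 1)"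

definition R_series :: "zpoly fps \<Rightarrow> zpoly fps \<Rightarrow> zpoly fps fps" where
  "R_series R1 R2 = 1 - 4 * fps_X * fps_const R1 - 4 * fps_X ^ 2 * fps_const R2"

text \<open>
  \<open>\<Sum>\<^sub>i\<^sub>\<ge>\<^sub>1 z\<^sub>i a\<^sub>i\<close>, converging in the \<open>t\<close>-adic topology.
\<close>

definition zsummable :: "(nat \<Rightarrow> zpoly fps) \<Rightarrow> bool" where
  "zsummable a \<longleftrightarrow> summable (\<lambda>k. fps_const (zvar (Suc k)) * a (Suc k))"

definition zsum :: "(nat \<Rightarrow> zpoly fps) \<Rightarrow> zpoly fps" where
  "zsum a = suminf (\<lambda>k. fps_const (zvar (Suc k)) * a (Suc k))"

definition half_t :: "zpoly fps" where
  "half_t = fps_const (zconst (1 / 2)) * fps_X"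

definition R_system :: "zpoly fps \<Rightarrow> zpoly fps \<Rightarrow> bool" where
  "R_system R1 R2 \<longleftrightarrow>
     (let S = inv_sqrt_fps (R_series R1 R2) in
        zsummable (\<lambda>i. fps_nth S (i - 1)) \<and> zsummable (\<lambda>i. fps_nth S i) \<and>
        R1 = half_t * zsum (\<lambda>i. fps_nth S (i - 1)) \<and>
        R2 = fps_X - 3 * R1 ^ 2 + half_t * zsum (\<lambda>i. fps_nth S i))"

text \<open>
  \<open>[u\<^sup>j] \<beta> R\<^sup>-\<^sup>1\<^sup>/\<^sup>2\<close> for \<open>\<beta> = \<Sum>\<^sub>i\<^sub>\<ge>\<^sub>1 z\<^sub>i u\<^sup>-\<^sup>i\<close> and \<open>j \<ge> 0\<close>.
\<close>

definition beta_coeff :: "nat \<Rightarrow> zpoly fps \<Rightarrow> zpoly fps \<Rightarrow> zpoly fps" where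
  "beta_coeff j R1 R2 = zsum (\<lambda>i. fps_nth (inv_sqrt_fps (R_series R1 R2)) (i + j))"


section \<open>Well-definedness\<close>

lemma zconst_simps: "zconst 0 = 0" "zconst 1 = 1" "zconst (a + b) = zconst a + zconst b"
  "zconst (a * b) = zconst a * zconst b"
  by (simp_all add: zconst_def single_add mult_single)

lemma zconst_sum: "zconst (\<Sum>i\<in>A. f i) = (\<Sum>i\<in>A. zconst (f i))"
  by (induction A rule: infinite_finite_induct) (simp_all add: zconst_simps)

lemma inv_sqrt_fps_square:
  assumes "fps_nth S 0 = 1"
  shows "inv_sqrt_fps S ^ 2 * S = 1" "fps_nth (inv_sqrt_fps S) 0 = 1"
proof -
  define h :: "rat \<Rightarrow> zpoly fps" where "h q = fps_const (zconst q)" for q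
  have h: "h 0 = 0" "h 1 = 1" "\<And>a b. h (a + b) = h a + h b" "\<And>a b. h (a * b) = h a * h b"
    by (simp_all add: h_def zconst_simps)
  have hs: "h (\<Sum>i\<in>A. f i) = (\<Sum>i\<in>A. h (f i))" for A :: "nat set" and f
    by (induction A rule: infinite_finite_induct) (simp_all add: h)
  define b :: "rat fps" where "b = fps_binomial (- 1 / 2)"
  define H :: "rat fps \<Rightarrow> zpoly fps fps" where "H f = Abs_fps (\<lambda>k. h (fps_nth f k))" for f
  have H: "H (f * g) = H f * H g" for f g
    by (rule fps_ext) (simp add: H_def fps_mult_nth hs h)
  have H1: "H 1 = 1" by (rule fps_ext) (simp add: H_def h)
  have HX: "H (1 + fps_X) = 1 + fps_X" by (rule fps_ext) (simp add: H_def h)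
  have "b * b = inverse (1 + fps_X)"
    by (simp add: b_def fps_binomial_minus_one flip: fps_binomial_add_mult)
  hence "b * b * (1 + fps_X) = 1"
    by (simp add: inverse_mult_eq_1)
  hence "H b * H b * (1 + fps_X) = 1"
    by (metis H H1 HX)
  moreover have c: "fps_nth (S - 1) 0 = 0" using assms by simp
  ultimately have "(H b oo (S - 1)) * (H b oo (S - 1)) * ((1 + fps_X) oo (S - 1)) = 1"
    by (metis fps_compose_mult_distrib[OF c] fps_compose_1)
  moreover have "(1 + fps_X) oo (S - 1) = S"
    using c by (simp add: fps_compose_add_distrib)
  moreover have "inv_sqrt_fps S = H b oo (S - 1)"
    by (simp add: inv_sqrt_fps_def H_def h_def b_def)
  ultimately show "inv_sqrt_fps S ^ 2 * S = 1"
    by (simp add: power2_eq_square)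
  show "fps_nth (inv_sqrt_fps S) 0 = 1"
    by (simp add: inv_sqrt_fps_def zconst_simps)
qed

lemma zsummableI:
  assumes "\<And>n m. m > N n \<Longrightarrow> fps_nth (a m) n = 0"
  shows "zsummable a"
proof -
  let ?f = "\<lambda>k. fps_const (zvar (Suc k)) * a (Suc k)"
  define L where "L = Abs_fps (\<lambda>n. fps_nth (\<Sum>k<N n. ?f k) n)"
  have "(\<lambda>K. \<Sum>k<K. ?f k) \<longlonglongrightarrow> L"
  proof (rule tendsto_fpsI)
    fix n
    have "fps_nth (\<Sum>k<K. ?f k) n = fps_nth L n" if "K \<ge> N n" for K
    proof -
      have "(\<Sum>k<K. fps_nth (?f k) n) = (\<Sum>k<N n. fps_nth (?f k) n)"
        using that by (intro sum.mono_neutral_right) (auto simp: assms)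
      thus ?thesis by (simp add: L_def fps_sum_nth)
    qed
    thus "\<forall>\<^sub>F K in sequentially. fps_nth (\<Sum>k<K. ?f k) n = fps_nth L n"
      by (auto simp: eventually_sequentially)
  qed
  thus ?thesis
    unfolding zsummable_def summable_def sums_def by blast
qed

lemma inv_sqrt_R_series_nth_eq_0:
  assumes "fps_nth R1 0 = 0" "fps_nth R2 0 = 0" "m > 2 * n"
  shows "fps_nth (fps_nth (inv_sqrt_fps (R_series R1 R2)) m) n = 0"
proof -
  define E :: "zpoly fps fps" where
    "E = - 4 * fps_X * fps_const (fps_shift 1 R1) - 4 * fps_X ^ 2 * fps_const (fps_shift 1 R2)"
  have R: "R1 = fps_X * fps_shift 1 R1" "R2 = fps_X * fps_shift 1 R2"
    using assms by (auto simp: fps_eq_iff)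
  have "R_series R1 R2 - 1 = fps_const fps_X * E"
    by (subst (1) R(1), subst (1) R(2))
       (simp add: R_series_def E_def algebra_simps flip: fps_const_mult)
  hence pow: "(R_series R1 R2 - 1) ^ k = fps_const (fps_X ^ k) * E ^ k" for k
    by (simp add: power_mult_distrib fps_const_power)
  have E0: "fps_nth E i = 0" if "i > 2" for i
    using that by (simp add: E_def mult.assoc numeral_fps_const fps_X_power_mult_nth)
  have Ek: "fps_nth (E ^ k) i = 0" if "i > 2 * k" for k i
    using that
  proof (induction k arbitrary: i)
    case (Suc k)
    have *: "fps_nth E j * fps_nth (E ^ k) (i - j) = 0" for j
      using E0[of j] Suc.IH[of "i - j"] Suc.prems by (cases "j > 2") auto
    show ?case unfolding power_Suc fps_mult_nth by (intro sum.neutral ballI *)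
  qed simp
  have "fps_nth (c * fps_nth ((R_series R1 R2 - 1) ^ k) m) n = 0" for c k
  proof (cases "k \<le> n")
    case True
    thus ?thesis using assms(3) Ek[of k m] by (simp add: pow)
  next
    case False
    have eq: "c * fps_nth ((R_series R1 R2 - 1) ^ k) m = fps_X ^ k * (c * fps_nth (E ^ k) m)"
      by (simp add: pow mult_ac)
    show ?thesis using False unfolding eq by (simp add: fps_X_power_mult_nth)
  qed
  thus ?thesis
    by (simp add: inv_sqrt_fps_def fps_compose_nth fps_sum_nth)
qed

lemma zsummable_inv_sqrt:
  assumes "fps_nth R1 0 = 0" "fps_nth R2 0 = 0"
  shows "zsummable (\<lambda>i. fps_nth (inv_sqrt_fps (R_series R1 R2)) (i - 1))"
    and "zsummable (\<lambda>i. fps_nth (inv_sqrt_fps (R_series R1 R2)) (i + j))"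
  by (rule zsummableI[where N = "\<lambda>n. 2 * n + 1"], rule inv_sqrt_R_series_nth_eq_0, use assms in simp_all)+

lemma rooted_map_iso_equiv: "equiv (labelled_rooted_maps n) (rooted_map_iso n)"
proof (rule equivI)
  show "rooted_map_iso n \<subseteq> labelled_rooted_maps n \<times> labelled_rooted_maps n"
    by (auto simp: rooted_map_iso_def)
  show "refl_on (labelled_rooted_maps n) (rooted_map_iso n)"
    by (auto simp: refl_on_def rooted_map_iso_def intro!: exI[of _ id] permutes_id)
  show "sym (rooted_map_iso n)"
  proof (rule symI, clarsimp simp: rooted_map_iso_def)
    fix \<sigma> \<alpha> \<sigma>' \<alpha>' \<pi> :: "nat \<Rightarrow> nat" and r
    assume \<pi>: "\<pi> permutes {..<2 * n}" and c: "\<pi> \<circ> \<sigma> = \<sigma>' \<circ> \<pi>" "\<pi> \<circ> \<alpha> = \<alpha>' \<circ> \<pi>"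
    have b: "bij \<pi>" using \<pi> by (rule permutes_bij)
    have conj: "inv \<pi> \<circ> g = f \<circ> inv \<pi>" if "\<pi> \<circ> f = g \<circ> \<pi>" for f g
      using that b by (metis (no_types, lifting) bij_is_inj bij_is_surj comp_assoc comp_id id_comp inv_o_cancel surj_iff)
    show "\<exists>\<pi>'. \<pi>' permutes {..<2 * n} \<and> \<pi>' \<circ> \<sigma>' = \<sigma> \<circ> \<pi>' \<and> \<pi>' \<circ> \<alpha>' = \<alpha> \<circ> \<pi>' \<and> \<pi>' (\<pi> r) = r"
      using conj[OF c(1)] conj[OF c(2)] permutes_inv[OF \<pi>] b
      by (intro exI[of _ "inv \<pi>"]) (simp add: bij_is_inj)
  qed
  show "trans (rooted_map_iso n)"
  proof (rule transI, clarsimp simp: rooted_map_iso_def)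
    fix \<sigma> \<alpha> \<sigma>' \<alpha>' \<sigma>'' \<alpha>'' \<pi> \<pi>' :: "nat \<Rightarrow> nat" and r
    assume *: "\<pi> permutes {..<2 * n}" "\<pi> \<circ> \<sigma> = \<sigma>' \<circ> \<pi>" "\<pi> \<circ> \<alpha> = \<alpha>' \<circ> \<pi>"
      "\<pi>' permutes {..<2 * n}" "\<pi>' \<circ> \<sigma>' = \<sigma>'' \<circ> \<pi>'" "\<pi>' \<circ> \<alpha>' = \<alpha>'' \<circ> \<pi>'"
    show "\<exists>\<rho>. \<rho> permutes {..<2 * n} \<and> \<rho> \<circ> \<sigma> = \<sigma>'' \<circ> \<rho> \<and> \<rho> \<circ> \<alpha> = \<alpha>'' \<circ> \<rho> \<and> \<rho> r = \<pi>' (\<pi> r)"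
      using * by (intro exI[of _ "\<pi>' \<circ> \<pi>"]) (auto simp: permutes_compose fun_eq_iff)
  qed
qed

lemma orbit_conj:
  assumes "\<pi> \<circ> f = g \<circ> \<pi>"
  shows "orbit g (\<pi> x) = \<pi> ` orbit f x"
proof -
  have "(g ^^ n) (\<pi> x) = \<pi> ((f ^^ n) x)" for n
    using assms by (induction n) (auto simp: fun_eq_iff)
  thus ?thesis by (auto simp: orbit_altdef)
qed

lemma face_weight_iso:
  assumes "(M, M') \<in> rooted_map_iso n"
  shows "face_weight n M = face_weight n M'"
proof -
  obtain \<sigma> \<alpha> r \<sigma>' \<alpha>' r' \<pi> where M: "M = (\<sigma>, \<alpha>, r)" "M' = (\<sigma>', \<alpha>', r')"
    and \<pi>: "\<pi> permutes {..<2 * n}" and c: "\<pi> \<circ> \<sigma> = \<sigma>' \<circ> \<pi>" "\<pi> \<circ> \<alpha> = \<alpha>' \<circ> \<pi>"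
    using assms by (auto simp: rooted_map_iso_def)
  have conj: "\<pi> \<circ> (\<sigma> \<circ> \<alpha>) = (\<sigma>' \<circ> \<alpha>') \<circ> \<pi>"
    using c by (metis comp_assoc)
  have inj: "inj \<pi>" using \<pi> by (rule permutes_inj)
  have "map_faces {..<2 * n} \<sigma>' \<alpha>' = orbit (\<sigma>' \<circ> \<alpha>') ` \<pi> ` {..<2 * n}"
    using permutes_image[OF \<pi>] by (simp add: map_faces_def)
  also have "\<dots> = (`) \<pi> ` map_faces {..<2 * n} \<sigma> \<alpha>"
    by (simp add: map_faces_def image_image orbit_conj[OF conj])
  finally have f: "map_faces {..<2 * n} \<sigma>' \<alpha>' = (`) \<pi> ` map_faces {..<2 * n} \<sigma> \<alpha>" .
  have "inj_on ((`) \<pi>) A" for A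
    using inj by (auto intro!: inj_onI simp: inj_image_eq_iff)
  moreover have "card (\<pi> ` B) = card B" for B
    using inj by (intro card_image) (auto simp: inj_on_def)
  ultimately show ?thesis
    by (simp add: M face_weight_def f prod.reindex)
qed

end

theory Submission
  imports Defs
begin

text \<open>
  \<^bold>\<open>Combinatorics.\<close> Cutting the root edge of a rooted planar map into two legs (half-edges) either
  disconnects it, or merges the two faces along the edge. This is Tutte's recursion
  \[ W_k = t \sum_{i+j=k-2} W_i W_j + t \sum_{i \ge 1} z_i W_{k-2+i} \qquad (k \ge 1), \quad W_0 = 1 \]
  for the series of maps with root face of degree \<open>k\<close> (not weighted), which determines all \<open>W\<^sub>k\<close>; for
  \<open>k = 2\<close> it reads \<open>W\<^sub>2 = t G\<close>. Rooted maps are rigid, so they may be counted with labelled darts.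

  \<^bold>\<open>Algebra.\<close> With \<open>x = 1/u\<close>, \<open>V = x - t \<Sum> z\<^sub>i x\<^sup>i\<^sup>-\<^sup>1\<close> and \<open>Q = x R\<^sup>1\<^sup>/\<^sup>2\<close>, split
  \<open>V / Q = M + N\<close> into its parts with nonnegative and negative powers of \<open>x\<close>. The system for
  \<open>(R\<^sub>1, R\<^sub>2)\<close> says exactly that \<open>N = 2 t x\<^sup>-\<^sup>2 + O(x\<^sup>-\<^sup>3)\<close>. Since \<open>Q\<^sup>2\<close> is a polynomial in \<open>x\<close>,
  \<open>Y = N Q / 2\<close> satisfies \<open>Y\<^sup>2 - V Y = (M\<^sup>2 Q\<^sup>2 - V\<^sup>2) / 4\<close>, which has no negative powers of \<open>x\<close>. This is
  Tutte's recursion for the coefficients of \<open>Y\<close>, so \<open>Y = \<Sum> t W\<^sub>k x\<^sup>-\<^sup>k\<^sup>-\<^sup>1\<close>, and reading off \<open>W\<^sub>2\<close> gives the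
  second formula. Differentiating \<open>V - 2 Y = M Q\<close> in \<open>t\<close> shows that \<open>Q (x + 2 (t Y' - Y))\<close> has no negative
  powers of \<open>x\<close> either; two of its coefficients give the first formula.
\<close>

section \<open>Cycles of permutations and transpositions\<close>

text \<open>Cutting an edge leaves \<sigma> alone and multiplies both \<alpha> and \<sigma> \<circ>
  \<alpha> on the right by one transposition, so planarity is controlled by how a transposition
  splits or merges cycles. If the cut disconnects the map, Euler's relation only fixes the sum of
  the Euler characteristics of the two halves; that each half is planar needs the inequality
  \<open>genus_nonneg\<close>, proved by the same cutting. Labelled darts make each cut a bijection
  without a choice of representatives. A disconnecting cut distributes the labels between the
  halves, and division by (2n)! absorbs the resulting binomial coefficients.

  On the algebraic side, V - 2 Y = M Q is the one-cut form of the resolvent in matrix models: M has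
  no negative powers of x and Q is the square root of a quadratic. Since V is affine in t, V - t V'
  = x, so the z_i drop out of the differentiated identity; this is why the first formula is
  polynomial in R_1 and R_2 alone, while the second still contains \<beta>.\<close>

lemma orbit_subsetI:
  assumes "f x \<in> A" and "\<And>y. y \<in> A \<Longrightarrow> f y \<in> A"
  shows "orbit f x \<subseteq> A"
proof
  fix y assume "y \<in> orbit f x"
  thus "y \<in> A" by induction (auto intro: assms)
qed

lemma orbit_closed: "y \<in> orbit f x \<Longrightarrow> f y \<in> orbit f x"
  by (rule orbit.step)

lemma orbit_eq_of_mem:
  assumes "permutation f" "y \<in> orbit f x"
  shows "orbit f y = orbit f x"
  using orbit_cyclic_eq3[OF cyclic_on_orbit'[OF assms(1)] assms(2)] .

lemma orbit_disjoint:
  assumes "permutation f" "y \<notin> orbit f x"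
  shows "orbit f y \<inter> orbit f x = {}"
  using assms orbit_eq_of_mem permutation_self_in_orbit by (metis disjoint_iff)

lemma permutation_transpose_comp:
  "permutation f \<Longrightarrow> permutation (f \<circ> transpose a b)"
  by (simp add: permutation_compose permutation_swap_id)

lemma comp_transpose_twice: "f \<circ> transpose a b \<circ> transpose a b = f"
  by (simp add: comp_assoc)

text \<open>With g = f \<circ> (a b), the step from a goes to \<open>f b\<close>, after which g
  follows f around the cycle of b: that cycle avoids a, and b is its last element. Intersecting with
  \<open>orbit f b\<close> carries the avoidance of a through the induction.\<close>

lemma orbit_merge_subset:
  assumes f: "permutation f" and b: "b \<notin> orbit f a"
  shows "orbit f b \<subseteq> orbit (f \<circ> transpose a b) a"
proof -
  let ?g = "f \<circ> transpose a b"
  have ab: "a \<notin> orbit f b"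
    using b f orbit_eq_of_mem permutation_self_in_orbit by metis
  have "f b \<in> orbit ?g a" using orbit.base[of ?g a] by simp
  have "orbit f b \<subseteq> orbit ?g a \<inter> orbit f b"
  proof (rule orbit_subsetI)
    show *: "f b \<in> orbit ?g a \<inter> orbit f b"
      using \<open>f b \<in> orbit ?g a\<close> orbit.base[of f b] by simp
    fix y assume y: "y \<in> orbit ?g a \<inter> orbit f b"
    show "f y \<in> orbit ?g a \<inter> orbit f b"
    proof (cases "y = b")
      case False
      with y ab have "?g y = f y" by (auto simp: transpose_def)
      with y orbit_closed[of y ?g a] show ?thesis by (auto intro: orbit.step)
    qed (use * in simp)
  qed
  thus ?thesis by blast
qed

lemma orbit_merge:
  assumes f: "permutation f" and b: "b \<notin> orbit f a"
  shows "orbit (f \<circ> transpose a b) a = orbit f a \<union> orbit f b"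
    and "orbit (f \<circ> transpose a b) b = orbit f a \<union> orbit f b"
proof -
  let ?g = "f \<circ> transpose a b"
  have g: "permutation ?g" using f by (rule permutation_transpose_comp)
  have ab: "a \<notin> orbit f b"
    using b f orbit_eq_of_mem permutation_self_in_orbit by metis
  have self: "a \<in> orbit f a" "b \<in> orbit f b"
    using f by (simp_all add: permutation_self_in_orbit)
  have 1: "orbit f b \<subseteq> orbit ?g a" using f b by (rule orbit_merge_subset)
  hence eq: "orbit ?g b = orbit ?g a" using self(2) orbit_eq_of_mem[OF g, of b a] by blast
  have 2: "orbit f a \<subseteq> orbit ?g b"
    using orbit_merge_subset[OF f ab] by (simp add: transpose_commute)
  have "orbit ?g a \<subseteq> orbit f a \<union> orbit f b"
    using self orbit.base[of f] orbit.step[of _ f]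
    by (intro orbit_subsetI) (simp_all add: transpose_def, blast+)
  with 1 2 eq show "orbit ?g a = orbit f a \<union> orbit f b" by blast
  with eq show "orbit ?g b = orbit f a \<union> orbit f b" by blast
qed

lemma orbit_transpose_other:
  assumes "permutation f" "a \<notin> orbit f x" "b \<notin> orbit f x"
  shows "orbit (f \<circ> transpose a b) x = orbit f x"
proof -
  have x: "x \<in> orbit f x" using assms(1) by (rule permutation_self_in_orbit)
  have *: "(f \<circ> transpose a b) y = f y" if "y \<in> orbit f x" for y
    using that assms by (auto simp: transpose_def)
  show ?thesis
    using x * by (intro orbit_cong) auto
qed

text \<open>If b = f^j a with j > 0 minimal, the cycle of b under the product is f a, ..., f^j a =
  b. It misses a: a return to a at a time 0 < i < j would lead to b already at time j - i.\<close>

lemma orbit_split: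
  assumes f: "permutation f" and b: "b \<in> orbit f a" and ne: "a \<noteq> b"
  shows "b \<notin> orbit (f \<circ> transpose a b) a"
proof
  let ?g = "f \<circ> transpose a b"
  have g: "permutation ?g" using f by (rule permutation_transpose_comp)
  define j where "j = (LEAST j. 0 < j \<and> (f ^^ j) a = b)"
  have "\<exists>j>0. (f ^^ j) a = b" using b by (auto simp: orbit_altdef)
  hence j: "0 < j" "(f ^^ j) a = b" unfolding j_def by (metis (mono_tags, lifting) LeastI)+
  have min: "(f ^^ i) a \<noteq> b" if "0 < i" "i < j" for i
    using that not_less_Least unfolding j_def by blast
  define A where "A = (\<lambda>i. (f ^^ i) a) ` {1..j}"
  have "a \<notin> A"
  proof
    assume "a \<in> A"
    then obtain i where i: "1 \<le> i" "i \<le> j" "(f ^^ i) a = a" by (auto simp: A_def)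
    with j ne have "i < j" by (cases "i = j") auto
    have "(f ^^ (j - i)) a = (f ^^ (j - i)) ((f ^^ i) a)" using i by simp
    also have "\<dots> = (f ^^ j) a"
      using \<open>i < j\<close> by (metis funpow_add le_add_diff_inverse2 less_imp_le comp_apply)
    finally show False using min[of "j - i"] j i \<open>i < j\<close> by simp
  qed
  have "f a \<in> A" using j by (force simp: A_def)
  have "orbit ?g b \<subseteq> A"
  proof (rule orbit_subsetI)
    show "?g b \<in> A" using \<open>f a \<in> A\<close> by simp
    fix y assume "y \<in> A"
    then obtain i where i: "1 \<le> i" "i \<le> j" "y = (f ^^ i) a" by (auto simp: A_def)
    show "?g y \<in> A"
    proof (cases "i = j")
      case True
      with i j \<open>f a \<in> A\<close> show ?thesis by simp
    next
      case False
      with i min have "y \<noteq> b" by auto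
      moreover have "y \<noteq> a" using \<open>y \<in> A\<close> \<open>a \<notin> A\<close> by blast
      ultimately have "?g y = (f ^^ Suc i) a" using i by (simp add: transpose_def)
      moreover have "Suc i \<in> {1..j}" using i False by simp
      ultimately show ?thesis unfolding A_def by blast
    qed
  qed
  moreover assume "b \<in> orbit ?g a"
  hence "a \<in> orbit ?g b" using g orbit_eq_of_mem permutation_self_in_orbit by metis
  ultimately show False using \<open>a \<notin> A\<close> by blast
qed

section \<open>Numbers of cycles\<close>

definition cyc :: "'a set \<Rightarrow> ('a \<Rightarrow> 'a) \<Rightarrow> nat" where
  "cyc D f = card (orbit f ` D)"

text \<open>The cycles through neither a nor b form the same family \<open>Os\<close> for f and for
  g. The non-membership claims ensure that every inserted cycle counts.\<close>

lemma orbits_merge: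
  assumes f: "permutation f" and b: "b \<notin> orbit f a" and D: "a \<in> D" "b \<in> D"
  defines "g \<equiv> f \<circ> transpose a b"
  defines "U \<equiv> orbit f a \<union> orbit f b"
  defines "Os \<equiv> orbit f ` (D - U)"
  shows "orbit f ` D = insert (orbit f a) (insert (orbit f b) Os)"
    and "orbit g ` D = insert U Os"
    and "orbit f a \<notin> Os" "orbit f b \<notin> Os" "U \<notin> Os" "orbit f a \<noteq> orbit f b"
proof -
  note mem = orbit_eq_of_mem[OF f] and self = permutation_self_in_orbit[OF f]
  have g: "permutation g" unfolding g_def using f by (rule permutation_transpose_comp)
  have U: "orbit g a = U" "orbit g b = U" using orbit_merge[OF f b] by (simp_all add: U_def g_def)
  show "orbit f ` D = insert (orbit f a) (insert (orbit f b) Os)"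
  proof -
    have "orbit f x \<in> insert (orbit f a) (insert (orbit f b) Os)" if "x \<in> D" for x
      using that mem[of x a] mem[of x b] by (auto simp: Os_def U_def)
    thus ?thesis using D by (auto simp: Os_def)
  qed
  have out: "orbit g x = orbit f x" if "x \<notin> U" for x
    unfolding g_def
    by (rule orbit_transpose_other[OF f]) (use that mem self in \<open>auto simp: U_def\<close>)
  have in': "orbit g x = U" if "x \<in> U" for x
    using orbit_eq_of_mem[OF g, of x a] that U by simp
  show "orbit g ` D = insert U Os"
  proof -
    have "orbit g x \<in> insert U Os" if "x \<in> D" for x
      using that in'[of x] out[of x] by (cases "x \<in> U") (auto simp: Os_def)
    moreover have "U \<in> orbit g ` D" using U D by blast
    moreover have "Os \<subseteq> orbit g ` D" using out by (auto simp: Os_def image_iff)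
    ultimately show ?thesis by blast
  qed
  have "orbit f x \<noteq> orbit f a" "orbit f x \<noteq> orbit f b" "orbit f x \<noteq> U" if "x \<notin> U" for x
    using that self[of x] by (auto simp: U_def)
  thus "orbit f a \<notin> Os" "orbit f b \<notin> Os" "U \<notin> Os" by (auto simp: Os_def)
  show "orbit f a \<noteq> orbit f b" using b self[of b] by blast
qed

lemma cyc_merge:
  assumes "permutation f" "b \<notin> orbit f a" "a \<in> D" "b \<in> D" "finite D"
  shows "cyc D f = Suc (cyc D (f \<circ> transpose a b))"
proof -
  define U where "U = orbit f a \<union> orbit f b"
  define Os where "Os = orbit f ` (D - U)"
  note m = orbits_merge[OF assms(1-4), folded U_def, folded Os_def]
  have "finite Os" using assms(5) by (simp add: Os_def)
  with m(3-6) show ?thesis unfolding cyc_def m(1,2) by (simp del: Un_iff)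
qed

text \<open>Splitting is merging read backwards: a second multiplication by the transposition
  restores f.\<close>

lemma cyc_split:
  assumes "permutation f" "b \<in> orbit f a" "a \<noteq> b" "a \<in> D" "b \<in> D" "finite D"
  shows "cyc D (f \<circ> transpose a b) = Suc (cyc D f)"
  using cyc_merge[OF permutation_transpose_comp[OF assms(1)] orbit_split[OF assms(1-3)] assms(4-6)]
  unfolding comp_transpose_twice .

lemma cyc_disjoint_Un:
  assumes "finite D" "D = D1 \<union> D2" "D1 \<inter> D2 = {}" "permutation f" "f ` D1 \<subseteq> D1"
  shows "cyc D f = cyc D1 f + cyc D2 f"
proof -
  have "orbit f ` D1 \<inter> orbit f ` D2 = {}"
  proof -
    have "orbit f x \<noteq> orbit f y" if "x \<in> D1" "y \<in> D2" for x y
    proof -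
      have "orbit f x \<subseteq> D1" using that assms(5) by (intro orbit_subsetI) auto
      moreover have "y \<in> orbit f y" "y \<notin> D1"
        using permutation_self_in_orbit[OF assms(4)] that assms(3) by auto
      ultimately show ?thesis by blast
    qed
    thus ?thesis by blast
  qed
  thus ?thesis using assms(1,2) unfolding cyc_def by (simp add: image_Un card_Un_disjoint)
qed

section \<open>Connectivity through invariant sets\<close>

text \<open>On a finite set, a subset closed under permutations is a union of components, so this is
  connectedness without paths; cutting and gluing then only require closure checks.\<close>

definition conn :: "'a set \<Rightarrow> ('a \<Rightarrow> 'a) \<Rightarrow> ('a \<Rightarrow> 'a) \<Rightarrow> bool" where
  "conn D \<sigma> \<alpha> \<longleftrightarrow> (\<forall>A. A \<subseteq> D \<longrightarrow> A \<noteq> {} \<longrightarrow> \<sigma> ` A \<subseteq> A \<longrightarrow> \<alpha> ` A \<subseteq> A \<longrightarrow> A = D)"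

lemma connD: "conn D \<sigma> \<alpha> \<Longrightarrow> A \<subseteq> D \<Longrightarrow> x \<in> A \<Longrightarrow> (\<And>y. y \<in> A \<Longrightarrow> \<sigma> y \<in> A) \<Longrightarrow>
  (\<And>y. y \<in> A \<Longrightarrow> \<alpha> y \<in> A) \<Longrightarrow> A = D"
  unfolding conn_def by blast

lemma map_connected_iff_conn:
  assumes "\<sigma> ` D \<subseteq> D" "\<alpha> ` D \<subseteq> D"
  shows "map_connected D \<sigma> \<alpha> \<longleftrightarrow> conn D \<sigma> \<alpha>"
proof
  let ?r = "{(x, y). y = \<sigma> x \<or> y = \<alpha> x}"
  assume c: "map_connected D \<sigma> \<alpha>"
  show "conn D \<sigma> \<alpha>" unfolding conn_def
  proof (intro allI impI)
    fix A assume A: "A \<subseteq> D" "A \<noteq> {}" "\<sigma> ` A \<subseteq> A" "\<alpha> ` A \<subseteq> A"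
    obtain d where d: "d \<in> A" using A by blast
    have "e \<in> A" if "(d, e) \<in> ?r\<^sup>*" for e
      using that by (induction rule: rtrancl_induct) (use A d in auto)
    moreover have "(d, e) \<in> ?r\<^sup>*" if "e \<in> D" for e
      using c that d A(1) unfolding map_connected_def by blast
    ultimately show "A = D" using A(1) by blast
  qed
next
  let ?r = "{(x, y). y = \<sigma> x \<or> y = \<alpha> x}"
  assume c: "conn D \<sigma> \<alpha>"
  show "map_connected D \<sigma> \<alpha>" unfolding map_connected_def
  proof (intro ballI)
    fix d e assume de: "d \<in> D" "e \<in> D"
    have "{e \<in> D. (d, e) \<in> ?r\<^sup>*} = D"
      by (rule connD[OF c, of _ d])
         (use assms de in \<open>auto intro: rtrancl.rtrancl_into_rtrancl\<close>)
    thus "(d, e) \<in> ?r\<^sup>*" using de by blast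
  qed
qed

lemma orbit_in_closed:
  assumes "f ` A \<subseteq> A" "x \<in> A" shows "orbit f x \<subseteq> A"
  using assms by (intro orbit_subsetI) auto

text \<open>A bijection maps a finite closed set onto itself, so nothing from outside can enter
  it.\<close>

lemma closed_complement:
  assumes "finite D" "bij f" "f ` D \<subseteq> D" "A \<subseteq> D" "f ` A \<subseteq> A"
  shows "f ` (D - A) \<subseteq> D - A"
proof -
  have "f ` A = A"
    using assms by (intro card_subset_eq card_image) (auto intro: finite_subset bij_is_inj inj_on_subset)
  thus ?thesis using assms bij_is_inj[of f] by (auto simp: image_set_diff dest: injD)
qed

section \<open>Cutting an edge\<close>

lemma conn_closed:
  "conn D \<sigma> \<alpha> \<Longrightarrow> A \<subseteq> D \<Longrightarrow> A \<noteq> {} \<Longrightarrow> \<sigma> ` A \<subseteq> A \<Longrightarrow> \<alpha> ` A \<subseteq> A \<Longrightarrow> A = D"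
  unfolding conn_def by blast

text \<open>Conjugation by \<alpha> moves the transposition. This converts the insertion of a leg r
  behind \<open>\<alpha> x\<close> at a vertex into its insertion behind x on a face.\<close>

lemma transpose_conj_involution:
  assumes "\<alpha> \<circ> \<alpha> = id" "\<alpha> r = r"
  shows "transpose (\<alpha> x) r \<circ> \<alpha> = \<alpha> \<circ> transpose x r"
proof
  fix y
  have inv: "\<alpha> (\<alpha> z) = z" for z using assms(1) by (metis comp_apply id_apply)
  have "\<alpha> y = r \<longleftrightarrow> y = r" "\<alpha> y = \<alpha> x \<longleftrightarrow> y = x" using assms(2) inv by metis+
  thus "(transpose (\<alpha> x) r \<circ> \<alpha>) y = (\<alpha> \<circ> transpose x r) y"
    using assms(2) by (auto simp: transpose_def)
qed

text \<open>The involution may have fixed points (legs), so cuts can be iterated. D is only required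
  to be closed, so the same \<sigma> and \<open>cut\<close> serve on both halves when the map falls
  apart.\<close>

locale edge_cut =
  fixes D :: "'a set" and \<sigma> \<alpha> :: "'a \<Rightarrow> 'a" and s s' :: 'a
  assumes fin: "finite D" and perm: "permutation \<sigma>" "permutation \<alpha>"
    and closed: "\<And>y. y \<in> D \<Longrightarrow> \<sigma> y \<in> D" "\<And>y. y \<in> D \<Longrightarrow> \<alpha> y \<in> D"
    and invol: "\<alpha> \<circ> \<alpha> = id" and s: "s \<in> D" "\<alpha> s = s'" "s \<noteq> s'"
begin

definition cut :: "'a \<Rightarrow> 'a" where "cut = \<alpha> \<circ> transpose s s'"

lemma invol': "\<alpha> (\<alpha> y) = y"
  using invol by (metis comp_apply id_apply)

lemma s'_D: "s' \<in> D" and \<alpha>_s': "\<alpha> s' = s"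
  using closed s invol' by auto

lemma cut_simps: "cut s = s" "cut s' = s'" "y \<noteq> s \<Longrightarrow> y \<noteq> s' \<Longrightarrow> cut y = \<alpha> y"
  using s \<alpha>_s' by (auto simp: cut_def transpose_def)

lemma glue_cut: "cut \<circ> transpose s s' = \<alpha>"
  by (simp add: cut_def comp_transpose_twice)

lemma perm_cut: "permutation cut"
  unfolding cut_def using perm(2) by (rule permutation_transpose_comp)

lemma cut_closed: "y \<in> D \<Longrightarrow> cut y \<in> D"
  using s s'_D closed(2) cut_simps by metis

lemma cut_invol: "cut \<circ> cut = id"
proof
  fix y
  have "\<alpha> y \<noteq> s" "\<alpha> y \<noteq> s'" if "y \<noteq> s" "y \<noteq> s'"
    using that invol' s(2) by metis+
  thus "(cut \<circ> cut) y = id y" using cut_simps invol' by (cases "y = s \<or> y = s'") auto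
qed

lemma cut_faces: "\<sigma> \<circ> cut = \<sigma> \<circ> \<alpha> \<circ> transpose s s'"
  by (simp add: cut_def comp_assoc)

lemma perm_faces: "permutation (\<sigma> \<circ> \<alpha>)" "permutation (\<sigma> \<circ> cut)"
  using perm perm_cut by (simp_all add: permutation_compose)

lemma cyc_cut: "cyc D cut = Suc (cyc D \<alpha>)"
  unfolding cut_def using orbit.base[of \<alpha> s] s s'_D by (intro cyc_split perm fin) auto

text \<open>The face permutation changes by the transposition of s and s'. An edge with one face on
  both sides leaves a separate face cycle for each leg; an edge between two faces
  (\<open>cyc_faces_diff\<close>) leaves a common one.\<close>

lemma cyc_faces_same:
  assumes "s' \<in> orbit (\<sigma> \<circ> \<alpha>) s"
  shows "cyc D (\<sigma> \<circ> cut) = Suc (cyc D (\<sigma> \<circ> \<alpha>))" "s' \<notin> orbit (\<sigma> \<circ> cut) s"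
  unfolding cut_faces
  using cyc_split[OF perm_faces(1) assms s(3,1) s'_D fin] orbit_split[OF perm_faces(1) assms s(3)]
  by simp_all

lemma cyc_faces_diff:
  assumes "s' \<notin> orbit (\<sigma> \<circ> \<alpha>) s"
  shows "cyc D (\<sigma> \<circ> \<alpha>) = Suc (cyc D (\<sigma> \<circ> cut))" "s' \<in> orbit (\<sigma> \<circ> cut) s"
  unfolding cut_faces
  using cyc_merge[OF perm_faces(1) assms s(1) s'_D fin] orbit_merge[OF perm_faces(1) assms]
    permutation_self_in_orbit[OF perm_faces(1), of s']
  by auto

lemma same_iff_cut: "s' \<in> orbit (\<sigma> \<circ> \<alpha>) s \<longleftrightarrow> s' \<notin> orbit (\<sigma> \<circ> cut) s"
  using cyc_faces_same(2) cyc_faces_diff(2) by blast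

lemma conn_cutD:
  assumes "conn D \<sigma> cut" shows "conn D \<sigma> \<alpha>"
  unfolding conn_def
proof (intro allI impI)
  fix A assume A: "A \<subseteq> D" "A \<noteq> {}" "\<sigma> ` A \<subseteq> A" "\<alpha> ` A \<subseteq> A"
  have "cut y \<in> A" if "y \<in> A" for y
    using that A(4) cut_simps by (cases "y = s \<or> y = s'") auto
  thus "A = D" using A by (intro conn_closed[OF assms]) (simp_all add: image_subset_iff)
qed

text \<open>Legs on a common face are joined by the walk along that face, so a set closed under
  \<sigma> and \<open>cut\<close> contains both or neither and therefore is closed under
  \<alpha>.\<close>

lemma conn_cut_iff:
  assumes "s' \<in> orbit (\<sigma> \<circ> cut) s"
  shows "conn D \<sigma> cut \<longleftrightarrow> conn D \<sigma> \<alpha>"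
proof
  assume c: "conn D \<sigma> \<alpha>"
  have s_in: "s \<in> orbit (\<sigma> \<circ> cut) s'"
    using assms orbit_eq_of_mem permutation_self_in_orbit perm_faces(2) by metis
  show "conn D \<sigma> cut" unfolding conn_def
  proof (intro allI impI)
    fix A assume A: "A \<subseteq> D" "A \<noteq> {}" "\<sigma> ` A \<subseteq> A" "cut ` A \<subseteq> A"
    have orb: "orbit (\<sigma> \<circ> cut) z \<subseteq> A" if "z \<in> A" for z
      using that A by (intro orbit_in_closed) (simp_all add: image_subset_iff)
    have "\<alpha> y \<in> A" if y: "y \<in> A" for y
    proof -
      consider "y = s" | "y = s'" | "y \<noteq> s" "y \<noteq> s'" by blast
      thus ?thesis
      proof cases
        case 1 thus ?thesis using orb[OF y] assms s by auto
      next
        case 2 thus ?thesis using orb[OF y] s_in \<alpha>_s' by auto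
      next
        case 3 thus ?thesis using A(4) y cut_simps(3) by force
      qed
    qed
    thus "A = D" using A by (intro conn_closed[OF c]) (simp_all add: image_subset_iff)
  qed
qed (rule conn_cutD)

lemma bij_\<sigma>_cut: "bij \<sigma>" "bij cut"
  using perm perm_cut by (simp_all add: permutation)

text \<open>A closed part of D1 must contain s, as otherwise it would be closed under \<alpha> as
  well; together with D2 it is then closed under \<alpha>, hence everything.\<close>

lemma conn_split_half:
  assumes c: "conn D \<sigma> \<alpha>" and D: "D = D1 \<union> D2" "D1 \<inter> D2 = {}" "s \<in> D1" "s' \<in> D2"
    and cl2: "\<sigma> ` D2 \<subseteq> D2" "cut ` D2 \<subseteq> D2"
  shows "conn D1 \<sigma> cut"
  unfolding conn_def
proof (intro allI impI)
  fix A assume A: "A \<subseteq> D1" "A \<noteq> {}" "\<sigma> ` A \<subseteq> A" "cut ` A \<subseteq> A"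
  have sA: "s \<in> A"
  proof (rule ccontr)
    assume "s \<notin> A"
    have "\<alpha> y \<in> A" if "y \<in> A" for y
    proof -
      have "y \<noteq> s" "y \<noteq> s'" using that \<open>s \<notin> A\<close> A(1) D by auto
      with cut_simps(3)[of y] that A(4) show ?thesis by auto
    qed
    moreover have "A \<subseteq> D" using A(1) D(1) by blast
    ultimately have "A = D" using A(2,3) by (intro conn_closed[OF c]) (simp_all add: image_subset_iff)
    thus False using \<open>s \<notin> A\<close> s by simp
  qed
  have "\<alpha> y \<in> A \<union> D2" if "y \<in> A \<union> D2" for y
  proof -
    consider "y = s" | "y = s'" | "y \<noteq> s" "y \<noteq> s'" by blast
    thus ?thesis
    proof cases
      case 3
      thus ?thesis using A(4) cl2 that cut_simps(3)[of y] by auto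
    qed (use D sA s \<alpha>_s' in auto)
  qed
  hence "\<alpha> ` (A \<union> D2) \<subseteq> A \<union> D2" by blast
  moreover have "\<sigma> ` (A \<union> D2) \<subseteq> A \<union> D2" using A(3) cl2 by blast
  moreover have "A \<union> D2 \<subseteq> D" using A(1) D(1) by blast
  ultimately have "A \<union> D2 = D" using A(2) by (intro conn_closed[OF c]) simp_all
  thus "A = D1" using A(1) D by blast
qed

lemma swap: "edge_cut D \<sigma> \<alpha> s' s"
  by unfold_locales (use fin perm closed invol s'_D \<alpha>_s' s in auto)

lemma cut_swap: "edge_cut.cut \<alpha> s' s = cut"
  by (simp add: edge_cut.cut_def[OF swap] cut_def transpose_commute)

text \<open>A proper closed set for \<open>cut\<close> contains exactly one of s and s', since
  otherwise it would be closed under \<alpha>. It and its complement are the two halves, named so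
  that s lies in D1.\<close>

lemma conn_split:
  assumes c: "conn D \<sigma> \<alpha>" and nc: "\<not> conn D \<sigma> cut"
  obtains D1 D2 where "D = D1 \<union> D2" "D1 \<inter> D2 = {}" "s \<in> D1" "s' \<in> D2"
    "\<sigma> ` D1 \<subseteq> D1" "\<sigma> ` D2 \<subseteq> D2" "cut ` D1 \<subseteq> D1" "cut ` D2 \<subseteq> D2"
    "conn D1 \<sigma> cut" "conn D2 \<sigma> cut"
proof -
  obtain A where A: "A \<subseteq> D" "A \<noteq> {}" "\<sigma> ` A \<subseteq> A" "cut ` A \<subseteq> A" "A \<noteq> D"
    using nc unfolding conn_def by blast
  have A': "D - A \<subseteq> D" "\<sigma> ` (D - A) \<subseteq> D - A" "cut ` (D - A) \<subseteq> D - A"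
    using closed_complement[OF fin bij_\<sigma>_cut(1)] closed_complement[OF fin bij_\<sigma>_cut(2)]
      A closed cut_closed by (simp_all add: image_subset_iff)
  have iff: "s \<in> A \<longleftrightarrow> s' \<notin> A"
  proof (rule ccontr)
    assume n: "\<not> ?thesis"
    have "\<alpha> y \<in> A" if "y \<in> A" for y
    proof (cases "y = s \<or> y = s'")
      case True thus ?thesis using n that s \<alpha>_s' by auto
    next
      case False thus ?thesis using cut_simps(3)[of y] A(4) that by auto
    qed
    hence "A = D" using A(1-3) by (intro conn_closed[OF c]) (simp_all add: image_subset_iff)
    thus False using A(5) by simp
  qed
  define D1 where "D1 = (if s \<in> A then A else D - A)"
  define D2 where "D2 = D - D1"
  have D: "D = D1 \<union> D2" "D1 \<inter> D2 = {}" "s \<in> D1" "s' \<in> D2"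
    using A(1) iff s s'_D by (auto simp: D1_def D2_def)
  have "D2 = (if s \<in> A then D - A else A)" using A(1) by (auto simp: D1_def D2_def)
  hence cl: "\<sigma> ` D1 \<subseteq> D1" "\<sigma> ` D2 \<subseteq> D2" "cut ` D1 \<subseteq> D1" "cut ` D2 \<subseteq> D2"
    using A A' by (simp_all add: D1_def)
  have 1: "conn D1 \<sigma> cut" using conn_split_half[OF c D cl(2,4)] .
  have "D = D2 \<union> D1" "D2 \<inter> D1 = {}" using D by auto
  from edge_cut.conn_split_half[OF swap c this D(4,3)] cl
  have 2: "conn D2 \<sigma> cut" unfolding cut_swap by simp
  show thesis by (rule that[OF D cl 1 2])
qed

text \<open>A set closed under \<sigma> and \<alpha> contains each half that it meets, and the edge
  from s to s' takes it from one half to the other.\<close>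

lemma conn_join:
  assumes D: "D = D1 \<union> D2" "D1 \<inter> D2 = {}" "s \<in> D1" "s' \<in> D2"
    and cl: "cut ` D1 \<subseteq> D1" "cut ` D2 \<subseteq> D2" "\<sigma> ` D1 \<subseteq> D1" "\<sigma> ` D2 \<subseteq> D2"
    and c: "conn D1 \<sigma> cut" "conn D2 \<sigma> cut"
  shows "conn D \<sigma> \<alpha>"
  unfolding conn_def
proof (intro allI impI)
  fix A assume A: "A \<subseteq> D" "A \<noteq> {}" "\<sigma> ` A \<subseteq> A" "\<alpha> ` A \<subseteq> A"
  have cutA: "cut y \<in> A" if "y \<in> A" for y
    using that A(4) cut_simps by (cases "y = s \<or> y = s'") auto
  have half: "D' \<subseteq> A" if "D' \<inter> A \<noteq> {}" "cut ` D' \<subseteq> D'" "\<sigma> ` D' \<subseteq> D'" "conn D' \<sigma> cut" for D'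
  proof -
    have "\<sigma> ` (A \<inter> D') \<subseteq> A \<inter> D'" "cut ` (A \<inter> D') \<subseteq> A \<inter> D'" using that A(3) cutA by blast+
    moreover have "A \<inter> D' \<noteq> {}" using that(1) by blast
    ultimately have "A \<inter> D' = D'" by (intro conn_closed[OF that(4)]) simp_all
    thus ?thesis by blast
  qed
  have "D1 \<inter> A \<noteq> {} \<or> D2 \<inter> A \<noteq> {}" using A D by blast
  moreover have "D1 \<subseteq> A \<Longrightarrow> D2 \<inter> A \<noteq> {}" using D s A(4) by blast
  moreover have "D2 \<subseteq> A \<Longrightarrow> D1 \<inter> A \<noteq> {}" using D \<alpha>_s' A(4) by blast
  ultimately have "D1 \<subseteq> A" "D2 \<subseteq> A" using half[OF _ cl(1,3) c(1)] half[OF _ cl(2,4) c(2)] by blast+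
  thus "A = D" using A(1) D by blast
qed

lemma nonfix_cut: "{d \<in> D. cut d \<noteq> d} = {d \<in> D. \<alpha> d \<noteq> d} - {s, s'}"
proof -
  have "cut d \<noteq> d \<longleftrightarrow> \<alpha> d \<noteq> d \<and> d \<notin> {s, s'}" for d
    using cut_simps by (cases "d = s \<or> d = s'") auto
  thus ?thesis by blast
qed

lemma faces_disconnected:
  assumes D: "D1 \<inter> D2 = {}" "s \<in> D1" "s' \<in> D2" and "\<sigma> ` D1 \<subseteq> D1" "cut ` D1 \<subseteq> D1"
  shows "s' \<notin> orbit (\<sigma> \<circ> cut) s"
proof -
  have "orbit (\<sigma> \<circ> cut) s \<subseteq> D1"
    using assms by (intro orbit_in_closed) (simp_all add: image_subset_iff)
  thus ?thesis using D by blast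
qed

end

section \<open>Euler's relation and the genus inequality\<close>

text \<open>All three counts are added, \<alpha> included: for an involution with e edges and l
  legs, \<open>cyc D \<alpha>\<close> is e + l and \<open>card D\<close> is 2 e + l, so the excess
  over \<open>card D\<close> is vertices minus edges plus faces, without subtraction.\<close>

definition euler :: "'a set \<Rightarrow> ('a \<Rightarrow> 'a) \<Rightarrow> ('a \<Rightarrow> 'a) \<Rightarrow> nat" where
  "euler D \<sigma> \<alpha> = cyc D \<sigma> + cyc D \<alpha> + cyc D (\<sigma> \<circ> \<alpha>)"

lemma euler_disjoint_Un:
  assumes "finite D" "D = D1 \<union> D2" "D1 \<inter> D2 = {}" "permutation \<sigma>" "permutation \<alpha>"
    "\<sigma> ` D1 \<subseteq> D1" "\<alpha> ` D1 \<subseteq> D1"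
  shows "euler D \<sigma> \<alpha> = euler D1 \<sigma> \<alpha> + euler D2 \<sigma> \<alpha>"
proof -
  have "(\<sigma> \<circ> \<alpha>) ` D1 \<subseteq> D1" using assms(6,7) by auto
  thus ?thesis unfolding euler_def
    using assms cyc_disjoint_Un[OF assms(1-3), of \<sigma>] cyc_disjoint_Un[OF assms(1-3), of \<alpha>]
      cyc_disjoint_Un[OF assms(1-3), of "\<sigma> \<circ> \<alpha>"] by (simp add: permutation_compose)
qed

lemma cyc_cong:
  assumes "\<And>y. y \<in> D \<Longrightarrow> f y = g y" "\<And>y. y \<in> D \<Longrightarrow> f y \<in> D"
  shows "cyc D f = cyc D g" "x \<in> D \<Longrightarrow> orbit f x = orbit g x"
proof -
  have *: "orbit f x = orbit g x" if "x \<in> D" for x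
    using that assms by (intro orbit_cong0[of x D]) auto
  thus "x \<in> D \<Longrightarrow> orbit f x = orbit g x" .
  show "cyc D f = cyc D g" unfolding cyc_def using * by (metis (no_types, lifting) image_cong)
qed

text \<open>A connected map without edges is a star of legs: one vertex and one face.\<close>

lemma euler_no_edges:
  assumes "finite D" "D \<noteq> {}" "permutation \<sigma>" "\<And>y. y \<in> D \<Longrightarrow> \<sigma> y \<in> D"
    and fix_all: "\<And>d. d \<in> D \<Longrightarrow> \<alpha> d = d" and c: "conn D \<sigma> \<alpha>"
  shows "euler D \<sigma> \<alpha> = card D + 2"
proof -
  have "orbit \<alpha> ` D = (\<lambda>x. {x}) ` D"
    using fix_all orbit_eq_singleton_iff[of \<alpha>] by (intro image_cong) auto
  hence "cyc D \<alpha> = card D" unfolding cyc_def by (simp add: card_image)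
  moreover have "orbit \<sigma> x = D" if "x \<in> D" for x
  proof -
    have sub: "orbit \<sigma> x \<subseteq> D" using that assms(4) by (intro orbit_in_closed) auto
    show ?thesis
      by (rule connD[OF c sub permutation_self_in_orbit[OF assms(3)]])
         (use sub fix_all in \<open>auto intro: orbit.step\<close>)
  qed
  hence "orbit \<sigma> ` D = {D}" using assms(2) by auto
  hence "cyc D \<sigma> = 1" unfolding cyc_def by simp
  moreover have "cyc D (\<sigma> \<circ> \<alpha>) = cyc D \<sigma>"
    using fix_all assms(4) by (intro cyc_cong) auto
  ultimately show ?thesis unfolding euler_def by simp
qed

text \<open>Induction on the number of darts that belong to edges. If the cut map is connected, the
  cut adds one cycle to \<alpha> and changes the number of faces by one, so the sum does not
  decrease. If it falls apart, the legs lie on different faces, the cut adds exactly 2, and the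
  bounds for the two halves add up to \<open>card D + 4\<close>.\<close>

lemma genus_nonneg:
  assumes "finite D" "D \<noteq> {}" "permutation \<sigma>" "permutation \<alpha>"
    "\<And>y. y \<in> D \<Longrightarrow> \<sigma> y \<in> D" "\<And>y. y \<in> D \<Longrightarrow> \<alpha> y \<in> D" "\<alpha> \<circ> \<alpha> = id" "conn D \<sigma> \<alpha>"
  shows "euler D \<sigma> \<alpha> \<le> card D + 2"
  using assms
proof (induction "card {d \<in> D. \<alpha> d \<noteq> d}" arbitrary: D \<alpha> rule: less_induct)
  case less
  show ?case
  proof (cases "\<exists>s\<in>D. \<alpha> s \<noteq> s")
    case False
    thus ?thesis using euler_no_edges[of D \<sigma> \<alpha>] less.prems by auto
  next
    case True
    then obtain s where s: "s \<in> D" "\<alpha> s \<noteq> s" by blast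
    interpret edge_cut D \<sigma> \<alpha> s "\<alpha> s" by unfold_locales (use less.prems s in auto)
    let ?n = "{d \<in> D. \<alpha> d \<noteq> d}"
    have sn: "s \<in> ?n" "finite ?n" using s less.prems(1) by auto
    show ?thesis
    proof (cases "conn D \<sigma> cut")
      case True
      have "card {d \<in> D. cut d \<noteq> d} < card ?n"
        unfolding nonfix_cut using sn by (intro psubset_card_mono) auto
      hence "euler D \<sigma> cut \<le> card D + 2"
        by (rule less.hyps) (use less.prems perm_cut cut_closed cut_invol True in auto)
      moreover have "euler D \<sigma> \<alpha> \<le> euler D \<sigma> cut"
        unfolding euler_def using cyc_cut cyc_faces_same(1) cyc_faces_diff(1)
        by (cases "\<alpha> s \<in> orbit (\<sigma> \<circ> \<alpha>) s") auto
      ultimately show ?thesis by simp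
    next
      case False
      from conn_split[OF less.prems(8) False] obtain D1 D2 where D: "D = D1 \<union> D2" "D1 \<inter> D2 = {}" "s \<in> D1" "\<alpha> s \<in> D2"
        and cl: "\<sigma> ` D1 \<subseteq> D1" "\<sigma> ` D2 \<subseteq> D2" "cut ` D1 \<subseteq> D1" "cut ` D2 \<subseteq> D2"
        and c: "conn D1 \<sigma> cut" "conn D2 \<sigma> cut" .
      have IH: "euler D' \<sigma> cut \<le> card D' + 2"
        if "D' \<subseteq> D" "D' \<noteq> {}" "\<sigma> ` D' \<subseteq> D'" "cut ` D' \<subseteq> D'" "conn D' \<sigma> cut" for D'
      proof (rule less.hyps)
        have "{d \<in> D'. cut d \<noteq> d} \<subseteq> ?n - {s, \<alpha> s}" using that(1) unfolding nonfix_cut[symmetric] by blast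
        hence "{d \<in> D'. cut d \<noteq> d} \<subset> ?n" using sn by blast
        thus "card {d \<in> D'. cut d \<noteq> d} < card ?n" using sn by (intro psubset_card_mono)
        show "finite D'" using that(1) fin by (rule finite_subset)
      qed (use that less.prems(3) perm_cut cut_invol in auto)
      have "euler D1 \<sigma> cut \<le> card D1 + 2"
        by (rule IH) (use D cl c in blast)+
      moreover have "euler D2 \<sigma> cut \<le> card D2 + 2"
        by (rule IH) (use D cl c in blast)+
      moreover have "euler D \<sigma> cut = euler D1 \<sigma> cut + euler D2 \<sigma> cut"
        using fin D cl perm perm_cut by (intro euler_disjoint_Un) auto
      moreover have "card D = card D1 + card D2" using fin D by (simp add: card_Un_disjoint)
      moreover have "\<alpha> s \<notin> orbit (\<sigma> \<circ> cut) s"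
        using D cl by (intro faces_disconnected) auto
      hence "euler D \<sigma> cut = euler D \<sigma> \<alpha> + 2"
        using cyc_cut cyc_faces_same(1) same_iff_cut unfolding euler_def by simp
      ultimately show ?thesis by simp
    qed
  qed
qed

section \<open>Maps with legs\<close>

text \<open>
  The fixed points \<open>F\<close> of \<open>\<alpha>\<close> are legs: half-edges that belong to no edge. There are
  \<open>cyc D \<alpha> - card F\<close> edges and \<open>card D = 2 * cyc D \<alpha> - card F\<close>, so the last condition is Euler's
  relation (vertices minus edges plus faces is 2). Planted maps (one leg, at the root) stand for rooted maps; unlike these they
  include the atomic map, whose only dart is the leg.
\<close>

definition legged :: "'a set \<Rightarrow> 'a set \<Rightarrow> (('a \<Rightarrow> 'a) \<times> ('a \<Rightarrow> 'a)) set" where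
  "legged D F = {(\<sigma>, \<alpha>). \<sigma> permutes D \<and> \<alpha> permutes D \<and> \<alpha> \<circ> \<alpha> = id \<and>
     {d \<in> D. \<alpha> d = d} = F \<and> conn D \<sigma> \<alpha> \<and> euler D \<sigma> \<alpha> = card D + 2}"

lemma permutes_permutation: "finite D \<Longrightarrow> f permutes D \<Longrightarrow> permutation f"
  by (auto simp: permutation_permutes)

lemma conn_cong:
  assumes "\<And>y. y \<in> D \<Longrightarrow> \<sigma> y = \<sigma>' y" "\<And>y. y \<in> D \<Longrightarrow> \<alpha> y = \<alpha>' y"
  shows "conn D \<sigma> \<alpha> \<longleftrightarrow> conn D \<sigma>' \<alpha>'"
proof -
  have "\<sigma> ` A = \<sigma>' ` A" "\<alpha> ` A = \<alpha>' ` A" if "A \<subseteq> D" for A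
    using that assms by (auto intro!: image_cong)
  thus ?thesis unfolding conn_def by (metis (no_types, lifting))
qed

lemma euler_cong:
  assumes "\<And>y. y \<in> D \<Longrightarrow> \<sigma> y = \<sigma>' y" "\<And>y. y \<in> D \<Longrightarrow> \<alpha> y = \<alpha>' y"
    "\<And>y. y \<in> D \<Longrightarrow> \<sigma> y \<in> D" "\<And>y. y \<in> D \<Longrightarrow> \<alpha> y \<in> D"
  shows "euler D \<sigma> \<alpha> = euler D \<sigma>' \<alpha>'"
proof -
  have "cyc D \<sigma> = cyc D \<sigma>'" "cyc D \<alpha> = cyc D \<alpha>'" "cyc D (\<sigma> \<circ> \<alpha>) = cyc D (\<sigma>' \<circ> \<alpha>')"
    using assms by (auto intro!: cyc_cong(1))
  thus ?thesis by (simp add: euler_def)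
qed

section \<open>Insertion of a leg at a corner\<close>

locale leg_insert =
  fixes D :: "'a set" and \<sigma> \<alpha> :: "'a \<Rightarrow> 'a" and r x :: 'a
  assumes fin: "finite D" and perm: "\<sigma> permutes D" "\<alpha> permutes D"
    and invol: "\<alpha> \<circ> \<alpha> = id" and r: "r \<notin> D" and x: "x \<in> D"
begin

text \<open>The leg is placed between \<open>\<alpha> x\<close> and its successor around the vertex.
  On the face it then comes right after x (\<open>faces_ins\<close>), so a corner is named by the
  dart x that precedes it on its face.\<close>

definition ins :: "'a \<Rightarrow> 'a" where "ins = \<sigma> \<circ> transpose (\<alpha> x) r"

lemma fix_r: "\<sigma> r = r" "\<alpha> r = r"
  using perm r by (simp_all add: permutes_not_in)

lemma \<alpha>x: "\<alpha> x \<in> D" "\<alpha> x \<noteq> r" "x \<noteq> r"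
  using permutes_in_image[OF perm(2), of x] x r by auto

lemma permutations: "permutation \<sigma>" "permutation \<alpha>" "permutation (\<sigma> \<circ> \<alpha>)"
  using permutes_permutation[OF fin] perm permutes_compose by auto

lemma ins_simps: "ins (\<alpha> x) = r" "ins r = \<sigma> (\<alpha> x)" "y \<noteq> \<alpha> x \<Longrightarrow> y \<noteq> r \<Longrightarrow> ins y = \<sigma> y"
  by (auto simp: ins_def transpose_def fix_r)

lemma ins_permutes: "ins permutes insert r D"
proof -
  have "transpose (\<alpha> x) r permutes insert r D" using \<alpha>x by (intro permutes_swap_id) auto
  moreover have "\<sigma> permutes insert r D" using perm(1) by (rule permutes_subset) auto
  ultimately show ?thesis unfolding ins_def by (rule permutes_compose)
qed

lemma faces_ins: "ins \<circ> \<alpha> = \<sigma> \<circ> \<alpha> \<circ> transpose x r"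
  using transpose_conj_involution[OF invol fix_r(2), of x] by (simp add: ins_def comp_assoc)

lemma r_notin_orbit: "f permutes D \<Longrightarrow> y \<in> D \<Longrightarrow> r \<notin> orbit f y"
  using permutes_orbit_subset[of f D y] r by auto

lemma orbit_r: "f permutes D \<Longrightarrow> orbit f r = {r}"
  using orbit_eq_singleton_iff[of f r] r by (simp add: permutes_not_in)

lemma faces_permutes: "\<sigma> \<circ> \<alpha> permutes D"
  using permutes_compose[OF perm(2,1)] .

lemma root_orbit_ins: "orbit (ins \<circ> \<alpha>) x = insert r (orbit (\<sigma> \<circ> \<alpha>) x)"
    "orbit (ins \<circ> \<alpha>) r = insert r (orbit (\<sigma> \<circ> \<alpha>) x)"
  unfolding faces_ins
  using orbit_merge[OF permutations(3) r_notin_orbit[OF faces_permutes x]]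
    orbit_r[OF faces_permutes] by simp_all

lemma cyc_insert: "f permutes D \<Longrightarrow> cyc (insert r D) f = Suc (cyc D f)"
proof -
  assume f: "f permutes D"
  have "cyc (insert r D) f = cyc {r} f + cyc D f"
    by (rule cyc_disjoint_Un) (use fin r f permutes_permutation[OF fin f] in \<open>auto simp: permutes_not_in\<close>)
  thus ?thesis by (simp add: cyc_def)
qed

lemma cyc_ins: "cyc (insert r D) ins = cyc D \<sigma>"
  using cyc_merge[OF permutations(1) r_notin_orbit[OF perm(1) \<alpha>x(1)], of "insert r D"] fin \<alpha>x
    cyc_insert[OF perm(1)] by (simp add: ins_def)

lemma cyc_faces_ins: "cyc (insert r D) (ins \<circ> \<alpha>) = cyc D (\<sigma> \<circ> \<alpha>)"
  unfolding faces_ins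
  using cyc_merge[OF permutations(3) r_notin_orbit[OF faces_permutes x], of "insert r D"] fin x
    cyc_insert[OF faces_permutes] by simp

lemma euler_ins: "euler (insert r D) ins \<alpha> = Suc (euler D \<sigma> \<alpha>)"
  unfolding euler_def cyc_ins cyc_faces_ins cyc_insert[OF perm(2)] by simp

text \<open>Closed sets correspond: from one of the enlarged map r is removed, and to one of the
  original map r is added exactly when it contains \<open>\<alpha> x\<close>, behind which r
  sits.\<close>

lemma conn_ins_iff: "conn (insert r D) ins \<alpha> \<longleftrightarrow> conn D \<sigma> \<alpha>"
proof
  assume c: "conn D \<sigma> \<alpha>"
  show "conn (insert r D) ins \<alpha>" unfolding conn_def
  proof (intro allI impI)
    fix A assume A: "A \<subseteq> insert r D" "A \<noteq> {}" "ins ` A \<subseteq> A" "\<alpha> ` A \<subseteq> A"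
    have \<sigma>D: "\<sigma> y \<in> D" "\<alpha> y \<in> D" if "y \<in> D" for y using that perm permutes_in_image by metis+
    have ri: "r \<in> A \<Longrightarrow> \<sigma> (\<alpha> x) \<in> A - {r}"
      using A(3) ins_simps(2) \<sigma>D(1)[OF \<alpha>x(1)] r by auto
    have "A - {r} = D"
    proof (rule conn_closed[OF c])
      show "A - {r} \<noteq> {}" using ri A(2) by blast
      show "\<sigma> ` (A - {r}) \<subseteq> A - {r}"
      proof
        fix z assume "z \<in> \<sigma> ` (A - {r})"
        then obtain y where y: "y \<in> A" "y \<noteq> r" and z: "z = \<sigma> y" by blast
        have "\<sigma> y \<in> A"
        proof (cases "y = \<alpha> x")
          case True
          hence "r \<in> A" using y A(3) ins_simps(1) by force
          thus ?thesis using ri True by blast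
        next
          case False
          thus ?thesis using y A(3) ins_simps(3)[of y] by auto
        qed
        moreover have "\<sigma> y \<noteq> r" using \<sigma>D(1)[of y] y A(1) r by auto
        ultimately show "z \<in> A - {r}" using z by simp
      qed
      show "\<alpha> ` (A - {r}) \<subseteq> A - {r}"
        using A(1,4) \<sigma>D(2) r by auto
    qed (use A(1) in blast)
    moreover have "r \<in> A"
      using \<open>A - {r} = D\<close> \<alpha>x(1) A(3) ins_simps(1) by force
    ultimately show "A = insert r D" by blast
  qed
next
  assume c: "conn (insert r D) ins \<alpha>"
  show "conn D \<sigma> \<alpha>" unfolding conn_def
  proof (intro allI impI)
    fix B assume B: "B \<subseteq> D" "B \<noteq> {}" "\<sigma> ` B \<subseteq> B" "\<alpha> ` B \<subseteq> B"
    define A where "A = B \<union> (if \<alpha> x \<in> B then {r} else {})"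
    have "A = insert r D"
    proof (rule conn_closed[OF c])
      show "ins ` A \<subseteq> A"
      proof
        fix z assume "z \<in> ins ` A"
        then obtain y where y: "y \<in> A" "z = ins y" by blast
        consider "y = \<alpha> x" "y \<in> B" | "y = r" "\<alpha> x \<in> B" | "y \<in> B" "y \<noteq> \<alpha> x" "y \<noteq> r"
          using y(1) B(1) r unfolding A_def by (auto split: if_splits)
        thus "z \<in> A"
        proof cases
          case 1 thus ?thesis using y(2) ins_simps(1) by (simp add: A_def)
        next
          case 2 thus ?thesis using y(2) ins_simps(2) B(3) by (auto simp: A_def)
        next
          case 3 thus ?thesis using y(2) ins_simps(3)[of y] B(3) by (auto simp: A_def)
        qed
      qed
      show "\<alpha> ` A \<subseteq> A" using B(4) fix_r(2) by (auto simp: A_def)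
    qed (use B in \<open>auto simp: A_def\<close>)
    thus "B = D" using B(1) r unfolding A_def by (auto split: if_splits)
  qed
qed

end

lemma legged_insert_iff:
  assumes "finite D" "\<sigma> permutes D" "\<alpha> permutes D" "r \<notin> D" "r \<notin> F" "x \<in> D"
  shows "(\<sigma> \<circ> transpose (\<alpha> x) r, \<alpha>) \<in> legged (insert r D) (insert r F) \<longleftrightarrow> (\<sigma>, \<alpha>) \<in> legged D F"
proof (cases "\<alpha> \<circ> \<alpha> = id")
  case True
  interpret leg_insert D \<sigma> \<alpha> r x by unfold_locales (use assms True in auto)
  have "{d \<in> insert r D. \<alpha> d = d} = insert r {d \<in> D. \<alpha> d = d}" using fix_r by auto
  hence "{d \<in> insert r D. \<alpha> d = d} = insert r F \<longleftrightarrow> {d \<in> D. \<alpha> d = d} = F"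
    using assms(4,5) by (auto simp: insert_ident)
  moreover have "\<alpha> permutes insert r D" using perm(2) by (rule permutes_subset) auto
  ultimately show ?thesis
    using ins_permutes conn_ins_iff euler_ins assms(1-4) True
    unfolding legged_def ins_def[symmetric] by (simp add: card_insert_disjoint)
qed (simp add: legged_def)

text \<open>The corner is recovered from the dart y that precedes the leg at its vertex, as x =
  \<alpha> y, and \<sigma> by undoing the transposition.\<close>

lemma legged_insert_bij:
  assumes fin: "finite D" and r: "r \<notin> D" "r \<notin> F" and ne: "D \<noteq> {}"
  shows "bij_betw (\<lambda>((\<sigma>, \<alpha>), x). (\<sigma> \<circ> transpose (\<alpha> x) r, \<alpha>)) (legged D F \<times> D)
    (legged (insert r D) (insert r F))"
  unfolding bij_betw_def
proof
  show "inj_on (\<lambda>((\<sigma>, \<alpha>), x). (\<sigma> \<circ> transpose (\<alpha> x) r, \<alpha>)) (legged D F \<times> D)"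
  proof (rule inj_onI)
    fix p q assume pq: "p \<in> legged D F \<times> D" "q \<in> legged D F \<times> D"
      "(\<lambda>((\<sigma>, \<alpha>), x). (\<sigma> \<circ> transpose (\<alpha> x) r, \<alpha>)) p = (\<lambda>((\<sigma>, \<alpha>), x). (\<sigma> \<circ> transpose (\<alpha> x) r, \<alpha>)) q"
    obtain \<sigma> \<alpha> x where p: "p = ((\<sigma>, \<alpha>), x)" by (metis surj_pair)
    obtain \<sigma>' \<alpha>' x' where q: "q = ((\<sigma>', \<alpha>'), x')" by (metis surj_pair)
    have [simp]: "\<alpha>' = \<alpha>" using pq(3) by (simp add: p q)
    have L: "(\<sigma>, \<alpha>) \<in> legged D F" "(\<sigma>', \<alpha>) \<in> legged D F" and x: "x \<in> D" "x' \<in> D"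
      and eq: "\<sigma> \<circ> transpose (\<alpha> x) r = \<sigma>' \<circ> transpose (\<alpha> x') r"
      using pq by (simp_all add: p q)
    have fixr: "\<sigma> r = r" "\<sigma>' r = r" using L r by (auto simp: legged_def permutes_not_in)
    have inj: "inj \<sigma>'" "inj \<alpha>" using L by (auto simp: legged_def permutes_inj)
    have "(\<sigma>' \<circ> transpose (\<alpha> x') r) (\<alpha> x) = r"
      using fixr by (subst eq[symmetric]) simp
    hence "\<sigma>' (transpose (\<alpha> x') r (\<alpha> x)) = \<sigma>' r" using fixr by simp
    hence "transpose (\<alpha> x') r (\<alpha> x) = r" using inj by (simp add: inj_eq)
    hence "\<alpha> x = \<alpha> x'" by (metis transpose_apply_second transpose_involutory)
    hence "x = x'" using inj by (simp add: inj_eq)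
    moreover have "\<sigma> = \<sigma>'" using eq \<open>\<alpha> x = \<alpha> x'\<close> comp_transpose_twice by metis
    ultimately show "p = q" by (simp add: p q)
  qed
  show "(\<lambda>((\<sigma>, \<alpha>), x). (\<sigma> \<circ> transpose (\<alpha> x) r, \<alpha>)) ` (legged D F \<times> D) =
    legged (insert r D) (insert r F)" (is "?f ` _ = _")
  proof
    show "?f ` (legged D F \<times> D) \<subseteq> legged (insert r D) (insert r F)"
    proof clarify
      fix \<sigma> \<alpha> x assume "(\<sigma>, \<alpha>) \<in> legged D F" "x \<in> D"
      thus "(\<sigma> \<circ> transpose (\<alpha> x) r, \<alpha>) \<in> legged (insert r D) (insert r F)"
        using legged_insert_iff[OF fin, of \<sigma> \<alpha> r F x] r by (simp add: legged_def)
    qed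
    show "legged (insert r D) (insert r F) \<subseteq> ?f ` (legged D F \<times> D)"
    proof
      fix p assume p: "p \<in> legged (insert r D) (insert r F)"
      obtain \<tau> \<alpha> where [simp]: "p = (\<tau>, \<alpha>)" by (cases p)
      have P: "\<tau> permutes insert r D" "\<alpha> permutes insert r D" and inv: "\<alpha> \<circ> \<alpha> = id"
        and c: "conn (insert r D) \<tau> \<alpha>" and F: "{d \<in> insert r D. \<alpha> d = d} = insert r F"
        using p by (auto simp: legged_def)
      have \<alpha>r: "\<alpha> r = r" using F by blast
      \<comment> \<open>A leg alone at its vertex would be a component by itself, which the other
        darts exclude.\<close>
      have "\<tau> r \<noteq> r"
      proof
        assume "\<tau> r = r"
        hence "{r} = insert r D" using \<alpha>r by (intro conn_closed[OF c]) auto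
        thus False using ne r by blast
      qed
      define y where "y = inv \<tau> r"
      have \<tau>y: "\<tau> y = r" unfolding y_def using P(1) by (simp add: permutes_inverses)
      have y: "y \<noteq> r" "y \<in> D"
        using \<tau>y \<open>\<tau> r \<noteq> r\<close> permutes_in_image[OF P(1), of y] by auto
      define \<sigma> where "\<sigma> = \<tau> \<circ> transpose y r"
      have "transpose y r permutes insert r D" using y by (intro permutes_swap_id) auto
      hence "\<sigma> permutes insert r D" unfolding \<sigma>_def using P(1) by (intro permutes_compose)
      hence \<sigma>: "\<sigma> permutes D"
        by (rule permutes_superset) (use \<tau>y in \<open>auto simp: \<sigma>_def\<close>)
      have \<alpha>: "\<alpha> permutes D"
        using P(2) by (rule permutes_superset) (use \<alpha>r in auto)
      have x: "\<alpha> y \<in> D" using y \<alpha> permutes_in_image by metis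
      have "\<alpha> (\<alpha> y) = y" using inv by (metis comp_apply id_apply)
      hence "\<tau> = \<sigma> \<circ> transpose (\<alpha> (\<alpha> y)) r" by (simp add: \<sigma>_def comp_transpose_twice)
      hence eq: "p = ?f ((\<sigma>, \<alpha>), \<alpha> y)" by simp
      have "(\<sigma>, \<alpha>) \<in> legged D F"
        using legged_insert_iff[OF fin \<sigma> \<alpha> r x] p eq by simp
      thus "p \<in> ?f ` (legged D F \<times> D)" using eq x by blast
    qed
  qed
qed

section \<open>Gluing two legs of a common face\<close>

lemma glue_involution:
  assumes "\<alpha> \<circ> \<alpha> = id" "\<alpha> s = s" "\<alpha> s' = s'"
  shows "(\<alpha> \<circ> transpose s s') \<circ> (\<alpha> \<circ> transpose s s') = id"
proof
  fix y
  have "\<alpha> (\<alpha> y) = y" using assms(1) by (metis comp_apply id_apply)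
  moreover have "\<alpha> y \<noteq> s" "\<alpha> y \<noteq> s'" if "y \<noteq> s" "y \<noteq> s'" using that calculation assms by metis+
  ultimately show "((\<alpha> \<circ> transpose s s') \<circ> (\<alpha> \<circ> transpose s s')) y = id y"
    using assms by (auto simp: transpose_def)
qed

lemma edge_cut_glue:
  assumes "finite D" "\<sigma> permutes D" "\<alpha> permutes D" "\<alpha> \<circ> \<alpha> = id" "\<alpha> s = s" "\<alpha> s' = s'"
    "s \<in> D" "s' \<in> D" "s \<noteq> s'"
  shows "edge_cut D \<sigma> (\<alpha> \<circ> transpose s s') s s'" "edge_cut.cut (\<alpha> \<circ> transpose s s') s s' = \<alpha>"
proof -
  have P: "\<alpha> \<circ> transpose s s' permutes D"
    using assms by (intro permutes_compose permutes_swap_id)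
  show e: "edge_cut D \<sigma> (\<alpha> \<circ> transpose s s') s s'"
  proof
    show "\<And>y. y \<in> D \<Longrightarrow> \<sigma> y \<in> D" "\<And>y. y \<in> D \<Longrightarrow> (\<alpha> \<circ> transpose s s') y \<in> D"
      using permutes_in_image[OF assms(2)] permutes_in_image[OF P] by simp_all
    show "permutation \<sigma>" "permutation (\<alpha> \<circ> transpose s s')"
      using permutes_permutation[OF assms(1)] assms(2) P by simp_all
    show "(\<alpha> \<circ> transpose s s') \<circ> (\<alpha> \<circ> transpose s s') = id"
      by (rule glue_involution[OF assms(4-6)])
  qed (use assms in simp_all)
  show "edge_cut.cut (\<alpha> \<circ> transpose s s') s s' = \<alpha>"
    unfolding edge_cut.cut_def[OF e] by (rule comp_transpose_twice)
qed

lemma edge_cut_legged: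
  assumes "finite D" "(\<sigma>, \<alpha>) \<in> legged D F" "s \<in> D" "\<alpha> s = s'" "s \<noteq> s'"
  shows "edge_cut D \<sigma> \<alpha> s s'"
  by unfold_locales
    (use assms permutes_permutation[OF assms(1)] in \<open>auto simp: legged_def permutes_in_image\<close>)

text \<open>Gluing removes one cycle from \<alpha> and adds one face, so Euler's relation is kept,
  and \<open>conn_cut_iff\<close> keeps connectivity. Multiplication by the transposition is its own
  inverse, so the same map serves in both directions.\<close>

lemma glue_bij:
  assumes fin: "finite D" and s: "s \<in> D" "s' \<in> D" "s \<noteq> s'"
  shows "bij_betw (\<lambda>(\<sigma>, \<alpha>). (\<sigma>, \<alpha> \<circ> transpose s s'))
    {(\<sigma>, \<alpha>). (\<sigma>, \<alpha>) \<in> legged D {s, s'} \<and> s' \<in> orbit (\<sigma> \<circ> \<alpha>) s}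
    {(\<sigma>, \<alpha>). (\<sigma>, \<alpha>) \<in> legged D {} \<and> \<alpha> s = s' \<and> s' \<notin> orbit (\<sigma> \<circ> \<alpha>) s}"
    (is "bij_betw ?f ?A ?B")
proof (rule bij_betw_byWitness[where f' = ?f])
  show "\<forall>p\<in>?A. ?f (?f p) = p" "\<forall>p\<in>?B. ?f (?f p) = p" by (auto simp: comp_transpose_twice)
  show "?f ` ?A \<subseteq> ?B"
  proof clarify
    fix \<sigma> \<alpha> assume L: "(\<sigma>, \<alpha>) \<in> legged D {s, s'}" and o: "s' \<in> orbit (\<sigma> \<circ> \<alpha>) s"
    define \<beta> where "\<beta> = \<alpha> \<circ> transpose s s'"
    have L': "\<sigma> permutes D" "\<alpha> permutes D" "\<alpha> \<circ> \<alpha> = id" "conn D \<sigma> \<alpha>"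
      "euler D \<sigma> \<alpha> = card D + 2" "{d \<in> D. \<alpha> d = d} = {s, s'}" using L by (auto simp: legged_def)
    have fx: "\<alpha> s = s" "\<alpha> s' = s'" using L'(6) by blast+
    note e = edge_cut_glue[OF fin L'(1-3) fx s, folded \<beta>_def]
    interpret edge_cut D \<sigma> \<beta> s s' by (rule e)
    note e2 = e(2)
    have \<beta>s: "\<beta> s = s'" using fx by (simp add: \<beta>_def)
    have n: "s' \<notin> orbit (\<sigma> \<circ> \<beta>) s" using same_iff_cut e2 o by simp
    have "euler D \<sigma> \<beta> = card D + 2"
      using cyc_faces_diff(1)[OF n] cyc_cut L'(5) unfolding e2 euler_def by simp
    moreover have "conn D \<sigma> \<beta>" using conn_cut_iff o L'(4) e2 by simp
    moreover have "{d \<in> D. \<beta> d = d} = {}"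
    proof -
      have "{d \<in> D. \<alpha> d \<noteq> d} = {d \<in> D. \<beta> d \<noteq> d} - {s, s'}" using nonfix_cut e2 by simp
      moreover have "{d \<in> D. \<alpha> d \<noteq> d} = D - {s, s'}" using L'(6) by blast
      moreover have "\<beta> s \<noteq> s" "\<beta> s' \<noteq> s'" using \<beta>s \<alpha>_s' s by simp_all
      ultimately show ?thesis by blast
    qed
    moreover have "\<beta> permutes D"
      unfolding \<beta>_def using assms(2,3) L'(2) by (intro permutes_compose permutes_swap_id)
    ultimately show "(\<sigma>, \<alpha> \<circ> transpose s s') \<in> legged D {} \<and> (\<alpha> \<circ> transpose s s') s = s' \<and>
        s' \<notin> orbit (\<sigma> \<circ> (\<alpha> \<circ> transpose s s')) s"
      using L'(1) invol n \<beta>s unfolding \<beta>_def[symmetric] legged_def by simp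
  qed
  show "?f ` ?B \<subseteq> ?A"
  proof clarify
    fix \<sigma> \<alpha> assume L: "(\<sigma>, \<alpha>) \<in> legged D {}" and o: "\<alpha> s \<notin> orbit (\<sigma> \<circ> \<alpha>) s" and s': "s' = \<alpha> s"
    interpret edge_cut D \<sigma> \<alpha> s s' using fin L s s' by (intro edge_cut_legged) auto
    have L': "\<sigma> permutes D" "\<alpha> permutes D" "conn D \<sigma> \<alpha>"
      "euler D \<sigma> \<alpha> = card D + 2" "{d \<in> D. \<alpha> d = d} = {}" using L by (auto simp: legged_def)
    note f = cyc_faces_diff[OF o[folded s']]
    have "euler D \<sigma> cut = card D + 2"
      using f(1) cyc_cut L'(4) unfolding euler_def by simp
    moreover have "conn D \<sigma> cut" using conn_cut_iff f(2) L'(3) by simp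
    moreover have "{d \<in> D. cut d = d} = {s, s'}"
      using nonfix_cut cut_simps(1,2) s s'_D L'(5) by blast
    moreover have "cut permutes D"
      unfolding cut_def using s s'_D L'(2) by (intro permutes_compose permutes_swap_id)
    ultimately show "(\<sigma>, \<alpha> \<circ> transpose s (\<alpha> s)) \<in> legged D {s, \<alpha> s} \<and>
        \<alpha> s \<in> orbit (\<sigma> \<circ> (\<alpha> \<circ> transpose s (\<alpha> s))) s"
      using L'(1) cut_invol f(2) unfolding s'[symmetric] cut_def[symmetric] legged_def by simp
  qed
qed

section \<open>Joining two planted maps by an edge\<close>

lemma perm_restrict_permutes:
  assumes "finite D" "inj f" "f ` D \<subseteq> D"
  shows "perm_restrict f D permutes D"
proof (rule bij_imp_permutes)
  have "bij_betw f D D"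
    using assms inj_on_subset[OF assms(2), of D] by (simp add: bij_betw_def endo_inj_surj)
  thus "bij_betw (perm_restrict f D) D D"
    by (rule bij_betw_cong[THEN iffD1, rotated]) (simp add: perm_restrict_def)
qed (simp add: perm_restrict_def)

text \<open>Two maps on disjoint dart sets are put side by side by composing their permutations,
  since with disjoint supports the product acts as each factor on its own set.\<close>

lemma comp_permutes_disjoint:
  assumes "f permutes D1" "g permutes D2" "D1 \<inter> D2 = {}"
  shows "y \<in> D1 \<Longrightarrow> (f \<circ> g) y = f y" "y \<in> D2 \<Longrightarrow> (f \<circ> g) y = g y"
    "y \<in> D1 \<Longrightarrow> (f \<circ> g) y \<in> D1" "y \<in> D2 \<Longrightarrow> (f \<circ> g) y \<in> D2"
    "f \<circ> g permutes (D1 \<union> D2)"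
proof -
  have f: "f z = z" if "z \<notin> D1" for z using that assms(1) by (simp add: permutes_not_in)
  have g: "g z = z" if "z \<notin> D2" for z using that assms(2) by (simp add: permutes_not_in)
  have 1: "(f \<circ> g) y = f y" if "y \<in> D1" for y
  proof -
    have "y \<notin> D2" using that assms(3) by blast
    thus ?thesis using g[of y] by simp
  qed
  have 2: "(f \<circ> g) y = g y" if "y \<in> D2" for y
    using f[of "g y"] that assms(3) permutes_in_image[OF assms(2), of y] by auto
  show "y \<in> D1 \<Longrightarrow> (f \<circ> g) y = f y" "y \<in> D2 \<Longrightarrow> (f \<circ> g) y = g y" by (fact 1, fact 2)
  show "y \<in> D1 \<Longrightarrow> (f \<circ> g) y \<in> D1" using 1 permutes_in_image[OF assms(1)] by simp
  show "y \<in> D2 \<Longrightarrow> (f \<circ> g) y \<in> D2" using 2 permutes_in_image[OF assms(2)] by simp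
  show "f \<circ> g permutes (D1 \<union> D2)"
    using assms by (intro permutes_compose) (auto intro: permutes_subset)
qed

lemma perm_restrict_comp_disjoint:
  assumes "f permutes D1" "g permutes D2" "D1 \<inter> D2 = {}"
  shows "perm_restrict (f \<circ> g) D1 = f" "perm_restrict (f \<circ> g) D2 = g"
  using comp_permutes_disjoint(1,2)[OF assms] assms
  by (auto simp: perm_restrict_def fun_eq_iff permutes_not_in)

text \<open>D1 holds the darts on the side of s; the legs s and s' are the ends of the edge that
  joins the two planted maps.\<close>

definition split_pairs :: "'a set \<Rightarrow> 'a \<Rightarrow> 'a \<Rightarrow> ('a set \<times> (('a \<Rightarrow> 'a) \<times> ('a \<Rightarrow> 'a)) \<times> (('a \<Rightarrow> 'a) \<times> ('a \<Rightarrow> 'a))) set" where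
  "split_pairs D s s' = (SIGMA D1:{D1. D1 \<subseteq> D \<and> s \<in> D1 \<and> s' \<notin> D1}.
     legged D1 {s} \<times> legged (D - D1) {s'})"

text \<open>The disjoint union has \<open>euler\<close> equal to \<open>card D + 4\<close>. The
  joining edge merges two cycles of \<alpha> and, the legs lying on different faces, two face
  cycles, which lowers it to \<open>card D + 2\<close>.\<close>

lemma split_glue:
  assumes fin: "finite D" and s: "s \<in> D" "s' \<in> D" "s \<noteq> s'"
    and p: "(D1, (\<sigma>1, \<alpha>1), (\<sigma>2, \<alpha>2)) \<in> split_pairs D s s'"
  defines "\<sigma> \<equiv> \<sigma>1 \<circ> \<sigma>2" and "\<alpha> \<equiv> \<alpha>1 \<circ> \<alpha>2 \<circ> transpose s s'"
  shows "(\<sigma>, \<alpha>) \<in> legged D {}" "\<alpha> s = s'" "s' \<in> orbit (\<sigma> \<circ> \<alpha>) s"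
    "edge_cut D \<sigma> \<alpha> s s'" "edge_cut.cut \<alpha> s s' = \<alpha>1 \<circ> \<alpha>2"
    "s' \<notin> orbit (\<sigma> \<circ> (\<alpha>1 \<circ> \<alpha>2)) s"
proof -
  define D2 where "D2 = D - D1"
  have D: "D = D1 \<union> D2" "D1 \<inter> D2 = {}" "s \<in> D1" "s' \<in> D2" and
    L1: "(\<sigma>1, \<alpha>1) \<in> legged D1 {s}" and L2: "(\<sigma>2, \<alpha>2) \<in> legged D2 {s'}"
    using p s by (auto simp: split_pairs_def D2_def)
  have fin12: "finite D1" "finite D2" using fin D by auto
  define \<beta> where "\<beta> = \<alpha>1 \<circ> \<alpha>2"
  have P: "\<sigma>1 permutes D1" "\<alpha>1 permutes D1" "\<sigma>2 permutes D2" "\<alpha>2 permutes D2"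
    and I: "\<alpha>1 \<circ> \<alpha>1 = id" "\<alpha>2 \<circ> \<alpha>2 = id"
    and F: "{d \<in> D1. \<alpha>1 d = d} = {s}" "{d \<in> D2. \<alpha>2 d = d} = {s'}"
    and c: "conn D1 \<sigma>1 \<alpha>1" "conn D2 \<sigma>2 \<alpha>2"
    and e: "euler D1 \<sigma>1 \<alpha>1 = card D1 + 2" "euler D2 \<sigma>2 \<alpha>2 = card D2 + 2"
    using L1 L2 by (auto simp: legged_def)
  note s\<sigma> = comp_permutes_disjoint[OF P(1,3) D(2), folded \<sigma>_def]
  note s\<beta> = comp_permutes_disjoint[OF P(2,4) D(2), folded \<beta>_def]
  have \<beta>s: "\<beta> s = s" "\<beta> s' = s'" using s\<beta>(1,2) D F by auto
  have \<beta>\<beta>: "\<beta> \<circ> \<beta> = id"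
  proof
    fix y
    consider "y \<in> D1" | "y \<in> D2" | "y \<notin> D" using D by blast
    thus "(\<beta> \<circ> \<beta>) y = id y"
    proof cases
      case 1 thus ?thesis using s\<beta>(1,3)[of y] s\<beta>(1)[of "\<beta> y"] I(1) by (metis comp_apply)
    next
      case 2 thus ?thesis using s\<beta>(2,4)[of y] s\<beta>(2)[of "\<beta> y"] I(2) by (metis comp_apply)
    next
      case 3 thus ?thesis using s\<beta>(5) D by (simp add: permutes_not_in)
    qed
  qed
  have \<alpha>_eq: "\<alpha> = \<beta> \<circ> transpose s s'" by (simp add: \<alpha>_def \<beta>_def)
  have \<sigma>D: "\<sigma> permutes D" and \<beta>D: "\<beta> permutes D" using s\<sigma>(5) s\<beta>(5) D by simp_all
  note e' = edge_cut_glue[OF fin \<sigma>D \<beta>D \<beta>\<beta> \<beta>s s, folded \<alpha>_eq]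
  interpret edge_cut D \<sigma> \<alpha> s s' by (rule e')
  note cut = e'(2)
  show "edge_cut D \<sigma> \<alpha> s s'" "edge_cut.cut \<alpha> s s' = \<alpha>1 \<circ> \<alpha>2" using e' unfolding \<beta>_def by blast+
  have cl: "cut ` D1 \<subseteq> D1" "cut ` D2 \<subseteq> D2" "\<sigma> ` D1 \<subseteq> D1" "\<sigma> ` D2 \<subseteq> D2"
    unfolding cut using s\<sigma>(3,4) s\<beta>(3,4) by blast+
  have c': "conn D1 \<sigma> cut" "conn D2 \<sigma> cut"
    using c conn_cong[of D1 \<sigma> \<sigma>1 cut \<alpha>1] conn_cong[of D2 \<sigma> \<sigma>2 cut \<alpha>2]
      s\<sigma>(1,2) s\<beta>(1,2) unfolding cut by simp_all
  have conn: "conn D \<sigma> \<alpha>" using D cl c' by (rule conn_join)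
  have nin: "s' \<notin> orbit (\<sigma> \<circ> cut) s" using D(2-4) cl(3,1) by (rule faces_disconnected)
  thus "s' \<notin> orbit (\<sigma> \<circ> (\<alpha>1 \<circ> \<alpha>2)) s" unfolding cut \<beta>_def .
  show same: "s' \<in> orbit (\<sigma> \<circ> \<alpha>) s" using nin same_iff_cut by simp
  have "euler D \<sigma> cut = euler D1 \<sigma> cut + euler D2 \<sigma> cut"
    by (rule euler_disjoint_Un[OF fin D(1,2) perm(1) perm_cut cl(3,1)])
  also have "euler D1 \<sigma> cut = euler D1 \<sigma>1 \<alpha>1" unfolding cut
    using s\<sigma>(1,3) s\<beta>(1,3) by (intro euler_cong)
  also have "euler D2 \<sigma> cut = euler D2 \<sigma>2 \<alpha>2" unfolding cut
    using s\<sigma>(2,4) s\<beta>(2,4) by (intro euler_cong)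
  finally have "euler D \<sigma> cut = card D + 4"
    using e D fin12 by (simp add: card_Un_disjoint)
  hence eul: "euler D \<sigma> \<alpha> = card D + 2"
    using cyc_faces_same(1)[OF same] cyc_cut unfolding euler_def by simp
  have "{d \<in> D. \<alpha> d = d} = {}"
  proof -
    have "{d \<in> D. cut d \<noteq> d} = D - {s, s'}"
    proof -
      have "cut d \<noteq> d" if "d \<in> D1" "d \<noteq> s" for d using that s\<beta>(1) F(1) unfolding cut by auto
      moreover have "cut d \<noteq> d" if "d \<in> D2" "d \<noteq> s'" for d using that s\<beta>(2) F(2) unfolding cut by auto
      ultimately show ?thesis using D cut_simps(1,2) by auto
    qed
    hence "D - {s, s'} \<subseteq> {d \<in> D. \<alpha> d \<noteq> d}" using nonfix_cut by auto
    thus ?thesis using \<alpha>_s' edge_cut.s(2)[OF e'(1)] s by auto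
  qed
  moreover have "\<alpha> permutes D"
    unfolding \<alpha>_eq using assms(2,3) \<beta>D by (intro permutes_compose permutes_swap_id)
  ultimately show "(\<sigma>, \<alpha>) \<in> legged D {}"
    using \<sigma>D invol conn eul unfolding legged_def by simp
  show "\<alpha> s = s'" by (rule edge_cut.s(2)[OF e'(1)])
qed

text \<open>D1 is recovered as the component of s after cutting: the intersection of two candidates
  is closed, hence equal to both. Every edge with one face on both sides arises, because in a planar
  map it is a bridge.\<close>

lemma split_glue_bij:
  assumes fin: "finite D" and s: "s \<in> D" "s' \<in> D" "s \<noteq> s'"
  shows "bij_betw (\<lambda>(D1, (\<sigma>1, \<alpha>1), (\<sigma>2, \<alpha>2)). (\<sigma>1 \<circ> \<sigma>2, \<alpha>1 \<circ> \<alpha>2 \<circ> transpose s s'))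
    (split_pairs D s s')
    {(\<sigma>, \<alpha>). (\<sigma>, \<alpha>) \<in> legged D {} \<and> \<alpha> s = s' \<and> s' \<in> orbit (\<sigma> \<circ> \<alpha>) s}"
    (is "bij_betw ?f ?A ?B")
  unfolding bij_betw_def
proof
  show "inj_on ?f ?A"
  proof (rule inj_onI)
    fix p q assume pq: "p \<in> ?A" "q \<in> ?A" "?f p = ?f q"
    obtain D1 \<sigma>1 \<alpha>1 \<sigma>2 \<alpha>2 where p: "p = (D1, (\<sigma>1, \<alpha>1), (\<sigma>2, \<alpha>2))" by (metis surj_pair)
    obtain E1 \<tau>1 \<beta>1 \<tau>2 \<beta>2 where q: "q = (E1, (\<tau>1, \<beta>1), (\<tau>2, \<beta>2))" by (metis surj_pair)
    have D: "D1 \<subseteq> D" "s \<in> D1" "E1 \<subseteq> D" "s \<in> E1" "D1 \<inter> (D - D1) = {}" "E1 \<inter> (D - E1) = {}"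
      using pq by (auto simp: p q split_pairs_def)
    have P: "\<sigma>1 permutes D1" "\<alpha>1 permutes D1" "\<sigma>2 permutes D - D1" "\<alpha>2 permutes D - D1" "conn D1 \<sigma>1 \<alpha>1"
      "\<tau>1 permutes E1" "\<beta>1 permutes E1" "\<tau>2 permutes D - E1" "\<beta>2 permutes D - E1" "conn E1 \<tau>1 \<beta>1"
      using pq by (auto simp: p q split_pairs_def legged_def)
    have eq: "\<sigma>1 \<circ> \<sigma>2 = \<tau>1 \<circ> \<tau>2" "\<alpha>1 \<circ> \<alpha>2 = \<beta>1 \<circ> \<beta>2"
    proof -
      have "\<alpha>1 \<circ> \<alpha>2 \<circ> transpose s s' = \<beta>1 \<circ> \<beta>2 \<circ> transpose s s'"
        using pq(3) unfolding p q by simp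
      from arg_cong[OF this, of "\<lambda>f. f \<circ> transpose s s'"] show "\<alpha>1 \<circ> \<alpha>2 = \<beta>1 \<circ> \<beta>2"
        unfolding comp_transpose_twice .
      show "\<sigma>1 \<circ> \<sigma>2 = \<tau>1 \<circ> \<tau>2" using pq(3) unfolding p q by simp
    qed
    note c1 = comp_permutes_disjoint[OF P(1,3) D(5)] comp_permutes_disjoint[OF P(2,4) D(5)]
    note c2 = comp_permutes_disjoint[OF P(6,8) D(6)] comp_permutes_disjoint[OF P(7,9) D(6)]
    have cD: "conn D1 (\<sigma>1 \<circ> \<sigma>2) (\<alpha>1 \<circ> \<alpha>2)"
      using P(5) conn_cong[of D1 "\<sigma>1 \<circ> \<sigma>2" \<sigma>1 "\<alpha>1 \<circ> \<alpha>2" \<alpha>1] c1(1) c1(6) by simp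
    have cE: "conn E1 (\<sigma>1 \<circ> \<sigma>2) (\<alpha>1 \<circ> \<alpha>2)" unfolding eq
      using P(10) conn_cong[of E1 "\<tau>1 \<circ> \<tau>2" \<tau>1 "\<beta>1 \<circ> \<beta>2" \<beta>1] c2(1) c2(6) by simp
    have clI: "(\<sigma>1 \<circ> \<sigma>2) ` (D1 \<inter> E1) \<subseteq> D1 \<inter> E1" "(\<alpha>1 \<circ> \<alpha>2) ` (D1 \<inter> E1) \<subseteq> D1 \<inter> E1"
    proof -
      show "(\<sigma>1 \<circ> \<sigma>2) ` (D1 \<inter> E1) \<subseteq> D1 \<inter> E1" using c1(3) c2(3)[folded eq] by blast
      show "(\<alpha>1 \<circ> \<alpha>2) ` (D1 \<inter> E1) \<subseteq> D1 \<inter> E1" using c1(8) c2(8)[folded eq] by blast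
    qed
    have "D1 \<inter> E1 = D1" using D by (intro conn_closed[OF cD _ _ clI]) auto
    moreover have "D1 \<inter> E1 = E1" using D by (intro conn_closed[OF cE _ _ clI]) auto
    ultimately have DE: "D1 = E1" by simp
    show "p = q" unfolding p q
      using perm_restrict_comp_disjoint[OF P(1,3) D(5)] perm_restrict_comp_disjoint[OF P(2,4) D(5)]
        perm_restrict_comp_disjoint[OF P(6,8) D(6)] perm_restrict_comp_disjoint[OF P(7,9) D(6)]
        eq DE by simp
  qed
  show "?f ` ?A = ?B"
  proof
    show "?f ` ?A \<subseteq> ?B"
    proof
      fix z assume "z \<in> ?f ` ?A"
      then obtain D1 \<sigma>1 \<alpha>1 \<sigma>2 \<alpha>2 where p: "(D1, (\<sigma>1, \<alpha>1), (\<sigma>2, \<alpha>2)) \<in> ?A"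
        and z: "z = (\<sigma>1 \<circ> \<sigma>2, \<alpha>1 \<circ> \<alpha>2 \<circ> transpose s s')" by auto
      show "z \<in> ?B" using split_glue(1-3)[OF fin s p] z by simp
    qed
    show "?B \<subseteq> ?f ` ?A"
    proof
      fix z assume "z \<in> ?B"
      then obtain \<sigma> \<alpha> where z: "z = (\<sigma>, \<alpha>)" and L: "(\<sigma>, \<alpha>) \<in> legged D {}"
        and same: "\<alpha> s \<in> orbit (\<sigma> \<circ> \<alpha>) s" and s': "s' = \<alpha> s" by auto
      interpret edge_cut D \<sigma> \<alpha> s "\<alpha> s" using fin L s s' by (intro edge_cut_legged) auto
      have L': "conn D \<sigma> \<alpha>" "euler D \<sigma> \<alpha> = card D + 2" "{d \<in> D. \<alpha> d = d} = {}"
        "\<sigma> permutes D" "\<alpha> permutes D"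
        using L by (auto simp: legged_def)
      have e: "euler D \<sigma> cut = card D + 4"
        using cyc_faces_same(1)[OF same] cyc_cut L'(2) unfolding euler_def by simp
      \<comment> \<open>Here planarity enters: the cut has added both a cycle of \<alpha> and a
        face, too many for a connected map.\<close>
      have "\<not> conn D \<sigma> cut"
      proof
        assume "conn D \<sigma> cut"
        hence "euler D \<sigma> cut \<le> card D + 2"
          using fin s perm perm_cut closed cut_closed cut_invol by (intro genus_nonneg) auto
        thus False using e by simp
      qed
      from conn_split[OF L'(1) this] obtain D1 D2 where D: "D = D1 \<union> D2" "D1 \<inter> D2 = {}" "s \<in> D1" "\<alpha> s \<in> D2"
        and cl: "\<sigma> ` D1 \<subseteq> D1" "\<sigma> ` D2 \<subseteq> D2" "cut ` D1 \<subseteq> D1" "cut ` D2 \<subseteq> D2"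
        and c: "conn D1 \<sigma> cut" "conn D2 \<sigma> cut" .
      have fin12: "finite D1" "finite D2" using fin D by auto
      have le: "euler D' \<sigma> cut \<le> card D' + 2"
        if "finite D'" "D' \<noteq> {}" "\<sigma> ` D' \<subseteq> D'" "cut ` D' \<subseteq> D'" "conn D' \<sigma> cut" for D'
        using that perm perm_cut cut_invol by (intro genus_nonneg) auto
      have "euler D1 \<sigma> cut \<le> card D1 + 2"
        by (rule le) (use D cl c fin12 in blast)+
      moreover have "euler D2 \<sigma> cut \<le> card D2 + 2"
        by (rule le) (use D cl c fin12 in blast)+
      moreover have "euler D \<sigma> cut = euler D1 \<sigma> cut + euler D2 \<sigma> cut"
        using fin D perm perm_cut cl by (intro euler_disjoint_Un) auto
      moreover have "card D = card D1 + card D2" using fin12 D by (simp add: card_Un_disjoint)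
      \<comment> \<open>The upper bounds for the halves add up to the actual sum, so both are
        attained: both halves are planar.\<close>
      ultimately have e12: "euler D1 \<sigma> cut = card D1 + 2" "euler D2 \<sigma> cut = card D2 + 2"
        using e by linarith+
      have nf: "{d \<in> D. cut d = d} = {s, \<alpha> s}"
        using nonfix_cut cut_simps(1,2) s s'_D L'(3) by blast
      have fix12: "{d \<in> D1. cut d = d} = {s}" "{d \<in> D2. cut d = d} = {\<alpha> s}"
        using nf D by auto
      have leg: "(perm_restrict \<sigma> D', perm_restrict cut D') \<in> legged D' F"
        if "finite D'" "\<sigma> ` D' \<subseteq> D'" "cut ` D' \<subseteq> D'" "conn D' \<sigma> cut"
          "euler D' \<sigma> cut = card D' + 2" "{d \<in> D'. cut d = d} = F" for D' F
      proof -
        have "perm_restrict cut D' \<circ> perm_restrict cut D' = id"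
        proof
          fix y
          have "cut (cut y) = y" using cut_invol by (metis comp_apply id_apply)
          thus "(perm_restrict cut D' \<circ> perm_restrict cut D') y = id y"
            using that(3) by (auto simp: perm_restrict_def)
        qed
        moreover have "{d \<in> D'. perm_restrict cut D' d = d} = F"
          using that(6) by (auto simp: perm_restrict_def)
        moreover have "conn D' (perm_restrict \<sigma> D') (perm_restrict cut D')"
          using conn_cong[of D' \<sigma> "perm_restrict \<sigma> D'" cut "perm_restrict cut D'"] that(4)
          by (simp add: perm_restrict_def)
        moreover have "euler D' \<sigma> cut = euler D' (perm_restrict \<sigma> D') (perm_restrict cut D')"
          using that(2,3) by (intro euler_cong) (auto simp: perm_restrict_def)
        ultimately show ?thesis
          using that perm_restrict_permutes[OF that(1), of \<sigma>] perm_restrict_permutes[OF that(1), of cut]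
            bij_is_inj[OF bij_\<sigma>_cut(1)] bij_is_inj[OF bij_\<sigma>_cut(2)]
          by (simp add: legged_def)
      qed
      let ?X = "(D1, (perm_restrict \<sigma> D1, perm_restrict cut D1), (perm_restrict \<sigma> D2, perm_restrict cut D2))"
      have "D2 = D - D1" using D by blast
      hence pin: "?X
        \<in> split_pairs D s (\<alpha> s)"
        using leg[OF fin12(1) cl(1,3) c(1) e12(1) fix12(1)] leg[OF fin12(2) cl(2,4) c(2) e12(2) fix12(2)] D
        unfolding split_pairs_def by auto
      have comp: "perm_restrict f D1 \<circ> perm_restrict f D2 = f"
        if "f permutes D" "f ` D1 \<subseteq> D1" "f ` D2 \<subseteq> D2" for f
        using that D by (auto simp: perm_restrict_def fun_eq_iff permutes_not_in)
      have "cut permutes D"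
        unfolding cut_def using s s'_D L'(5) by (intro permutes_compose permutes_swap_id)
      hence eq: "(\<sigma>, \<alpha>) = ?f ?X"
        using comp[of \<sigma>] comp[of cut] cl L'(4) glue_cut s' by simp
      show "z \<in> ?f ` ?A" unfolding image_iff
      proof (rule bexI[where x = "?X"])
        show "?X \<in> ?A" unfolding s' by (rule pin)
        show "z = ?f ?X" unfolding z by (rule eq)
      qed
    qed
  qed
qed

section \<open>Weights\<close>

definition face_perm :: "('a \<Rightarrow> 'a) \<times> ('a \<Rightarrow> 'a) \<Rightarrow> 'a \<Rightarrow> 'a" where
  "face_perm p = fst p \<circ> snd p"

lemma face_perm_pair [simp]: "face_perm (\<sigma>, \<alpha>) = \<sigma> \<circ> \<alpha>"
  by (simp add: face_perm_def)

text \<open>The root face has no factor, its degree being recorded separately. The index set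
  consists of pairwise disjoint dart sets, so different faces of equal degree keep separate
  factors.\<close>

definition inner_weight :: "'a set \<Rightarrow> ('a \<Rightarrow> 'a) \<Rightarrow> 'a \<Rightarrow> zpoly" where
  "inner_weight D \<phi> s = (\<Prod>f\<in>orbit \<phi> ` (D - orbit \<phi> s). zvar (card f))"

definition legged_gf :: "'a set \<Rightarrow> 'a set \<Rightarrow> 'a \<Rightarrow> nat \<Rightarrow> zpoly" where
  "legged_gf D F s k = (\<Sum>p\<in>legged D F.
     if card (orbit (face_perm p) s) = k then inner_weight D (face_perm p) s else 0)"

lemma finite_legged: "finite D \<Longrightarrow> finite (legged D F)"
  by (rule finite_subset[of _ "{\<sigma>. \<sigma> permutes D} \<times> {\<sigma>. \<sigma> permutes D}"])
     (auto simp: legged_def finite_permutations)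

lemma legged_face_perm:
  assumes "p \<in> legged D F" "finite D"
  shows "face_perm p permutes D" "permutation (face_perm p)"
proof -
  show 1: "face_perm p permutes D"
    using assms by (cases p) (auto simp: legged_def intro: permutes_compose)
  show "permutation (face_perm p)" using permutes_permutation[OF assms(2) 1] .
qed

lemma card_orbit_permutes:
  assumes "finite D" "f permutes D" "x \<in> D"
  shows "orbit f x \<subseteq> D" "finite (orbit f x)" "card (orbit f x) > 0" "card (orbit f x) \<le> card D"
proof -
  show 1: "orbit f x \<subseteq> D" using assms(2,3) by (rule permutes_orbit_subset)
  show 2: "finite (orbit f x)" using 1 assms(1) by (rule finite_subset)
  have "orbit f x \<noteq> {}" using orbit.base[of f x] by blast
  thus "card (orbit f x) > 0" using 2 by (simp add: card_gt_0_iff)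
  show "card (orbit f x) \<le> card D" using 1 assms(1) by (simp add: card_mono)
qed

lemma legged_gf_eq_0:
  assumes "finite D" "s \<in> D" "k = 0 \<or> k > card D"
  shows "legged_gf D F s k = 0"
  unfolding legged_gf_def
proof (rule sum.neutral, rule ballI)
  fix p assume "p \<in> legged D F"
  note c = card_orbit_permutes(3,4)[OF assms(1) legged_face_perm(1)[OF this assms(1)] assms(2)]
  have "card (orbit (face_perm p) s) \<noteq> k" using c assms(3) by linarith
  thus "(if card (orbit (face_perm p) s) = k then inner_weight D (face_perm p) s else 0) = 0" by simp
qed

text \<open>The root leg may hang in any corner, that is, after any dart x, whose face becomes the
  root face. The leg itself lengthens that face cycle by one.\<close>

lemma legged_gf_root_leg:
  assumes fin: "finite D" and r: "r \<notin> D" and ne: "D \<noteq> {}"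
  shows "legged_gf (insert r D) {r} r (Suc k) = (\<Sum>x\<in>D. legged_gf D {} x k)"
proof -
  let ?h = "\<lambda>((\<sigma>, \<alpha>), x). (\<sigma> \<circ> transpose (\<alpha> x) r, \<alpha>)"
  let ?g = "\<lambda>p. if card (orbit (face_perm p) r) = Suc k then inner_weight (insert r D) (face_perm p) r else 0"
  let ?g' = "\<lambda>p x. if card (orbit (face_perm p) x) = k then inner_weight D (face_perm p) x else 0"
  have "legged_gf (insert r D) {r} r (Suc k) = (\<Sum>q\<in>legged D {} \<times> D. ?g (?h q))"
    unfolding legged_gf_def
    using legged_insert_bij[OF fin r, of "{}"] ne by (intro sum.reindex_bij_betw[symmetric]) auto
  also have "\<dots> = (\<Sum>q\<in>legged D {} \<times> D. case q of (p, x) \<Rightarrow> ?g' p x)"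
  proof (rule sum.cong[OF refl])
    fix q assume q: "q \<in> legged D {} \<times> D"
    obtain \<sigma> \<alpha> x where qe: "q = ((\<sigma>, \<alpha>), x)" by (metis surj_pair)
    have L: "(\<sigma>, \<alpha>) \<in> legged D {}" and x: "x \<in> D" using q qe by auto
    interpret leg_insert D \<sigma> \<alpha> r x
      by unfold_locales (use fin L x r in \<open>auto simp: legged_def\<close>)
    have rn: "r \<notin> orbit (\<sigma> \<circ> \<alpha>) x" by (rule r_notin_orbit[OF faces_permutes x])
    have "finite (orbit (\<sigma> \<circ> \<alpha>) x)" by (rule card_orbit_permutes(2)[OF fin faces_permutes x])
    hence card: "card (orbit (ins \<circ> \<alpha>) r) = Suc (card (orbit (\<sigma> \<circ> \<alpha>) x))"
      using rn by (simp add: root_orbit_ins)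
    have D: "insert r D - insert r (orbit (\<sigma> \<circ> \<alpha>) x) = D - orbit (\<sigma> \<circ> \<alpha>) x" using r by auto
    have "orbit (ins \<circ> \<alpha>) y = orbit (\<sigma> \<circ> \<alpha>) y" if "y \<in> D - orbit (\<sigma> \<circ> \<alpha>) x" for y
      unfolding faces_ins
    proof (rule orbit_transpose_other[OF permutations(3)])
      show "x \<notin> orbit (\<sigma> \<circ> \<alpha>) y"
        using that orbit_eq_of_mem[OF permutations(3), of x y] permutation_self_in_orbit[OF permutations(3), of y]
        by auto
      show "r \<notin> orbit (\<sigma> \<circ> \<alpha>) y" using that by (intro r_notin_orbit[OF faces_permutes]) auto
    qed
    hence "orbit (ins \<circ> \<alpha>) ` (D - orbit (\<sigma> \<circ> \<alpha>) x) = orbit (\<sigma> \<circ> \<alpha>) ` (D - orbit (\<sigma> \<circ> \<alpha>) x)"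
      by (rule image_cong[OF refl])
    hence "inner_weight (insert r D) (ins \<circ> \<alpha>) r = inner_weight D (\<sigma> \<circ> \<alpha>) x"
      unfolding inner_weight_def root_orbit_ins D by simp
    thus "?g (?h q) = (case q of (p, x) \<Rightarrow> ?g' p x)" unfolding qe prod.case face_perm_pair ins_def[symmetric] card by simp
  qed
  also have "\<dots> = (\<Sum>p\<in>legged D {}. \<Sum>x\<in>D. ?g' p x)" by (simp add: sum.cartesian_product)
  also have "\<dots> = (\<Sum>x\<in>D. \<Sum>p\<in>legged D {}. ?g' p x)" by (rule sum.swap)
  finally show ?thesis unfolding legged_gf_def .
qed

lemma legged_gf_atomic: "legged_gf {r} {r} r k = (if k = 1 then 1 else 0)"
proof -
  have "legged {r} {r} = {(id, id)}"
  proof -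
    have "orbit id x = {x}" for x :: 'a using orbit_eq_singleton_iff[of id x] by simp
    hence "(id, id) \<in> legged {r} {r}" by (auto simp: legged_def conn_def euler_def cyc_def)
    moreover have "p = (id, id)" if "p \<in> legged {r} {r}" for p
      using that by (cases p) (simp add: legged_def permutes_sing)
    ultimately show ?thesis by blast
  qed
  moreover have "orbit id r = {r}" using orbit_eq_singleton_iff[of id r] by simp
  ultimately show ?thesis by (simp add: legged_gf_def inner_weight_def)
qed

section \<open>Root edges with one face on both sides\<close>

definition same_face :: "'a set \<Rightarrow> 'a \<Rightarrow> 'a \<Rightarrow> (('a \<Rightarrow> 'a) \<times> ('a \<Rightarrow> 'a)) set" where
  "same_face D s s' = {(\<sigma>, \<alpha>). (\<sigma>, \<alpha>) \<in> legged D {} \<and> \<alpha> s = s' \<and> s' \<in> orbit (\<sigma> \<circ> \<alpha>) s}"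

definition diff_face :: "'a set \<Rightarrow> 'a \<Rightarrow> 'a \<Rightarrow> (('a \<Rightarrow> 'a) \<times> ('a \<Rightarrow> 'a)) set" where
  "diff_face D s s' = {(\<sigma>, \<alpha>). (\<sigma>, \<alpha>) \<in> legged D {} \<and> \<alpha> s = s' \<and> s' \<notin> orbit (\<sigma> \<circ> \<alpha>) s}"

text \<open>Gluing unites the two root faces, legs included: the legs become the two sides of the
  new edge, so the cycle lengths simply add. All other faces are kept.\<close>

lemma inner_weight_split:
  assumes fin: "finite D" and s: "s \<in> D" "s' \<in> D" "s \<noteq> s'"
    and p: "(D1, (\<sigma>1, \<alpha>1), (\<sigma>2, \<alpha>2)) \<in> split_pairs D s s'"
  defines "\<phi> \<equiv> (\<sigma>1 \<circ> \<sigma>2) \<circ> (\<alpha>1 \<circ> \<alpha>2 \<circ> transpose s s')"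
  shows "card (orbit \<phi> s) = card (orbit (\<sigma>1 \<circ> \<alpha>1) s) + card (orbit (\<sigma>2 \<circ> \<alpha>2) s')"
    and "inner_weight D \<phi> s = inner_weight D1 (\<sigma>1 \<circ> \<alpha>1) s * inner_weight (D - D1) (\<sigma>2 \<circ> \<alpha>2) s'"
proof -
  define D2 where "D2 = D - D1"
  define \<psi> where "\<psi> = (\<sigma>1 \<circ> \<sigma>2) \<circ> (\<alpha>1 \<circ> \<alpha>2)"
  note sg = split_glue[OF fin s p]
  have D: "D = D1 \<union> D2" "D1 \<inter> D2 = {}" "s \<in> D1" "s' \<in> D2" and
    L1: "(\<sigma>1, \<alpha>1) \<in> legged D1 {s}" and L2: "(\<sigma>2, \<alpha>2) \<in> legged D2 {s'}"
    using p s by (auto simp: split_pairs_def D2_def)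
  have fin12: "finite D1" "finite D2" using fin D by auto
  have P: "\<sigma>1 permutes D1" "\<alpha>1 permutes D1" "\<sigma>2 permutes D2" "\<alpha>2 permutes D2"
    using L1 L2 by (auto simp: legged_def)
  note c1 = comp_permutes_disjoint[OF P(1,3) D(2)] and c2 = comp_permutes_disjoint[OF P(2,4) D(2)]
  have \<psi>1: "\<psi> y = (\<sigma>1 \<circ> \<alpha>1) y" "\<psi> y \<in> D1" if "y \<in> D1" for y
    using c1(1,3)[of "(\<alpha>1 \<circ> \<alpha>2) y"] c2(1,3)[OF that] unfolding \<psi>_def by simp_all
  have \<psi>2: "\<psi> y = (\<sigma>2 \<circ> \<alpha>2) y" "\<psi> y \<in> D2" if "y \<in> D2" for y
    using c1(2,4)[of "(\<alpha>1 \<circ> \<alpha>2) y"] c2(2,4)[OF that] unfolding \<psi>_def by simp_all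
  have o1: "orbit \<psi> y = orbit (\<sigma>1 \<circ> \<alpha>1) y" if "y \<in> D1" for y
    using cyc_cong(2)[OF \<psi>1 that] .
  have o2: "orbit \<psi> y = orbit (\<sigma>2 \<circ> \<alpha>2) y" if "y \<in> D2" for y
    using cyc_cong(2)[OF \<psi>2 that] .
  have "\<psi> permutes D" unfolding \<psi>_def using c1(5) c2(5) D(1) by (auto intro: permutes_compose)
  hence perm: "permutation \<psi>" using permutes_permutation[OF fin] by simp
  have nin: "s' \<notin> orbit \<psi> s" using sg(6) unfolding \<psi>_def .
  have \<phi>: "\<phi> = \<psi> \<circ> transpose s s'" unfolding \<phi>_def \<psi>_def by (simp only: comp_assoc)
  have os: "orbit \<phi> s = orbit \<psi> s \<union> orbit \<psi> s'" unfolding \<phi> by (rule orbit_merge(1)[OF perm nin])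
  have im: "\<psi> ` D1 \<subseteq> D1" "\<psi> ` D2 \<subseteq> D2" using \<psi>1(2) \<psi>2(2) by blast+
  note sub = orbit_in_closed[OF im(1) D(3)] orbit_in_closed[OF im(2) D(4)]
  have fo: "finite (orbit \<psi> s)" "finite (orbit \<psi> s')" using sub fin12 finite_subset by auto
  have "card (orbit \<phi> s) = card (orbit \<psi> s) + card (orbit \<psi> s')"
    unfolding os using sub D(2) fo by (intro card_Un_disjoint) auto
  thus "card (orbit \<phi> s) = card (orbit (\<sigma>1 \<circ> \<alpha>1) s) + card (orbit (\<sigma>2 \<circ> \<alpha>2) s')"
    using o1[OF D(3)] o2[OF D(4)] by simp
  have out: "orbit \<phi> y = orbit \<psi> y" if "y \<in> D - orbit \<phi> s" for y
  proof -
    have "s \<notin> orbit \<psi> y" "s' \<notin> orbit \<psi> y"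
      using that os orbit_eq_of_mem[OF perm, of s y] orbit_eq_of_mem[OF perm, of s' y]
        permutation_self_in_orbit[OF perm, of y] by auto
    thus ?thesis unfolding \<phi> by (rule orbit_transpose_other[OF perm])
  qed
  have "D - orbit \<phi> s = (D1 - orbit \<psi> s) \<union> (D2 - orbit \<psi> s')"
    using os sub D by blast
  hence "orbit \<phi> ` (D - orbit \<phi> s) = orbit \<psi> ` (D1 - orbit \<psi> s) \<union> orbit \<psi> ` (D2 - orbit \<psi> s')"
    using out by (metis (no_types, lifting) image_Un image_cong)
  moreover have "orbit \<psi> ` (D1 - orbit \<psi> s) \<inter> orbit \<psi> ` (D2 - orbit \<psi> s') = {}"
  proof -
    have "orbit \<psi> a \<noteq> orbit \<psi> b" if "a \<in> D1" "b \<in> D2" for a b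
    proof -
      have "orbit \<psi> a \<subseteq> D1" by (rule orbit_in_closed[OF im(1) that(1)])
      thus ?thesis using permutation_self_in_orbit[OF perm, of b] that D(2) by auto
    qed
    thus ?thesis by auto
  qed
  ultimately have "inner_weight D \<phi> s = inner_weight D1 \<psi> s * inner_weight D2 \<psi> s'"
    unfolding inner_weight_def using fin12 by (simp add: prod.union_disjoint)
  also have "inner_weight D1 \<psi> s = inner_weight D1 (\<sigma>1 \<circ> \<alpha>1) s"
    unfolding inner_weight_def using o1 D(3) by (intro prod.cong image_cong) auto
  also have "inner_weight D2 \<psi> s' = inner_weight D2 (\<sigma>2 \<circ> \<alpha>2) s'"
    unfolding inner_weight_def using o2 D(4) by (intro prod.cong image_cong) auto
  finally show "inner_weight D \<phi> s = inner_weight D1 (\<sigma>1 \<circ> \<alpha>1) s * inner_weight (D - D1) (\<sigma>2 \<circ> \<alpha>2) s'"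
    unfolding D2_def .
qed

lemma sum_same_face:
  assumes fin: "finite D" and s: "s \<in> D" "s' \<in> D" "s \<noteq> s'"
  shows "(\<Sum>p\<in>same_face D s s'. if card (orbit (face_perm p) s) = k then inner_weight D (face_perm p) s else 0)
    = (\<Sum>D1 | D1 \<subseteq> D \<and> s \<in> D1 \<and> s' \<notin> D1. \<Sum>i\<le>k. legged_gf D1 {s} s i * legged_gf (D - D1) {s'} s' (k - i))"
    (is "(\<Sum>p\<in>_. ?g p) = _")
proof -
  let ?h = "\<lambda>(D1, (\<sigma>1, \<alpha>1), (\<sigma>2, \<alpha>2)). (\<sigma>1 \<circ> \<sigma>2, \<alpha>1 \<circ> \<alpha>2 \<circ> transpose s s')"
  let ?w = "\<lambda>D s i p. if card (orbit (face_perm p) s) = i then inner_weight D (face_perm p) s else 0"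
  let ?DD = "{D1. D1 \<subseteq> D \<and> s \<in> D1 \<and> s' \<notin> D1}"
  have finDD: "finite ?DD" using fin by (rule rev_finite_subset[OF finite_Pow_iff[THEN iffD2]]) auto
  have "(\<Sum>p\<in>same_face D s s'. ?g p) = (\<Sum>q\<in>split_pairs D s s'. ?g (?h q))"
    unfolding same_face_def by (rule sum.reindex_bij_betw[symmetric]) (rule split_glue_bij[OF fin s])
  also have "\<dots> = (\<Sum>q\<in>split_pairs D s s'. \<Sum>i\<le>k. ?w (fst q) s i (fst (snd q)) * ?w (D - fst q) s' (k - i) (snd (snd q)))"
  proof (rule sum.cong[OF refl])
    fix q assume q: "q \<in> split_pairs D s s'"
    obtain D1 \<sigma>1 \<alpha>1 \<sigma>2 \<alpha>2 where qe: "q = (D1, (\<sigma>1, \<alpha>1), (\<sigma>2, \<alpha>2))" by (metis surj_pair)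
    note iw = inner_weight_split[OF fin s q[unfolded qe]]
    define a b where "a = card (orbit (\<sigma>1 \<circ> \<alpha>1) s)" and "b = card (orbit (\<sigma>2 \<circ> \<alpha>2) s')"
    define A B where "A = inner_weight D1 (\<sigma>1 \<circ> \<alpha>1) s" and "B = inner_weight (D - D1) (\<sigma>2 \<circ> \<alpha>2) s'"
    have "?g (?h q) = (if a + b = k then A * B else 0)"
      unfolding qe prod.case face_perm_pair iw a_def b_def A_def B_def by simp
    \<comment> \<open>The single index i = a turns the condition on a + b into a convolution
      term.\<close>
    also have "\<dots> = (\<Sum>i\<le>k. if i = a then (if b = k - i then A * B else 0) else 0)"
      by auto
    also have "\<dots> = (\<Sum>i\<le>k. (if a = i then A else 0) * (if b = k - i then B else 0))"
      by (rule sum.cong) auto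
    finally show "?g (?h q) = (\<Sum>i\<le>k. ?w (fst q) s i (fst (snd q)) * ?w (D - fst q) s' (k - i) (snd (snd q)))"
      unfolding qe fst_conv snd_conv face_perm_pair a_def b_def A_def B_def .
  qed
  also have "\<dots> = (\<Sum>D1\<in>?DD. \<Sum>p\<in>legged D1 {s} \<times> legged (D - D1) {s'}.
      \<Sum>i\<le>k. ?w D1 s i (fst p) * ?w (D - D1) s' (k - i) (snd p))"
  proof -
    have fin2: "\<forall>D1\<in>?DD. finite (legged D1 {s} \<times> legged (D - D1) {s'})"
    proof
      fix D1 assume "D1 \<in> ?DD"
      hence "finite D1" using fin by (auto intro: finite_subset)
      thus "finite (legged D1 {s} \<times> legged (D - D1) {s'})" using fin by (intro finite_cartesian_product finite_legged) auto
    qed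
    show ?thesis unfolding split_pairs_def sum.Sigma[OF finDD fin2] by (simp only: case_prod_unfold)
  qed
  also have "\<dots> = (\<Sum>D1\<in>?DD. \<Sum>i\<le>k. legged_gf D1 {s} s i * legged_gf (D - D1) {s'} s' (k - i))"
  proof (rule sum.cong[OF refl])
    fix D1
    have "(\<Sum>p\<in>legged D1 {s} \<times> legged (D - D1) {s'}. \<Sum>i\<le>k. ?w D1 s i (fst p) * ?w (D - D1) s' (k - i) (snd p))
      = (\<Sum>i\<le>k. \<Sum>p\<in>legged D1 {s} \<times> legged (D - D1) {s'}. ?w D1 s i (fst p) * ?w (D - D1) s' (k - i) (snd p))"
      by (rule sum.swap)
    also have "\<dots> = (\<Sum>i\<le>k. legged_gf D1 {s} s i * legged_gf (D - D1) {s'} s' (k - i))"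
      unfolding legged_gf_def sum_product sum.cartesian_product
      by (intro sum.cong refl) (auto simp: case_prod_beta)
    finally show "(\<Sum>p\<in>legged D1 {s} \<times> legged (D - D1) {s'}. \<Sum>i\<le>k. ?w D1 s i (fst p) * ?w (D - D1) s' (k - i) (snd p))
      = (\<Sum>i\<le>k. legged_gf D1 {s} s i * legged_gf (D - D1) {s'} s' (k - i))" .
  qed
  finally show ?thesis .
qed

section \<open>Root edges between two faces\<close>

text \<open>This numbers the corners of the root face from s onwards; the number j of the chosen
  corner later determines the degree of the face that is split off.\<close>

lemma funpow_orbit_bij:
  assumes "permutation f"
  shows "bij_betw (\<lambda>j. (f ^^ j) s) {..<card (orbit f s)} (orbit f s)"
proof -
  have s: "s \<in> orbit f s" using assms by (rule permutation_self_in_orbit)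
  let ?n = "funpow_dist1 f s s"
  have o: "orbit f s = (\<lambda>n. (f ^^ n) s) ` {0..<?n}"
    by (rule orbit_conv_funpow_dist1[OF s])
  have i: "inj_on (\<lambda>n. (f ^^ n) s) {0..<?n}"
    by (rule inj_on_funpow_dist1[OF s])
  have "card (orbit f s) = ?n" unfolding o using i by (simp add: card_image)
  thus ?thesis using o i by (simp add: bij_betw_def atLeast0LessThan)
qed

text \<open>When s' is inserted after x = f^j s and s is then exchanged with s', the cycle through
  s' becomes s', f s, ..., f^j s. For j = 0 it is s' alone, a face of degree one.\<close>

lemma new_face_orbit:
  assumes perm: "permutation f" and fix': "f s' = s'" and ne: "s \<noteq> s'"
    and j: "j < card (orbit f s)"
  defines "x \<equiv> (f ^^ j) s"
  defines "g \<equiv> f \<circ> transpose x s' \<circ> transpose s s'"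
  shows "card (orbit g s') = Suc j"
proof -
  note bij = funpow_orbit_bij[OF perm, of s]
  have inj: "(f ^^ a) s = (f ^^ b) s \<longleftrightarrow> a = b" if "a \<le> j" "b \<le> j" for a b
    using bij that j unfolding bij_betw_def inj_on_def by auto
  have s'_nin: "s' \<notin> orbit f s"
  proof
    assume "s' \<in> orbit f s"
    hence "orbit f s' = orbit f s" using perm orbit_eq_of_mem by metis
    moreover have "orbit f s' = {s'}" using fix' orbit_eq_singleton_iff[of f s'] by simp
    ultimately have "s \<in> {s'}" using permutation_self_in_orbit[OF perm, of s] by metis
    thus False using ne by simp
  qed
  have fj: "(f ^^ a) s \<noteq> s'" for a
  proof -
    have "(f ^^ a) s \<in> orbit f s"
      using permutation_self_in_orbit[OF perm, of s] by (induction a) (auto intro: orbit.step)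
    thus ?thesis using s'_nin by metis
  qed
  define A where "A = insert s' ((\<lambda>l. (f ^^ l) s) ` {1..j})"
  have gs': "g s' = (if j = 0 then s' else f s)"
  proof (cases "j = 0")
    case True thus ?thesis using fix' by (simp add: g_def x_def)
  next
    case False
    hence "x \<noteq> s" using inj[of j 0] by (simp add: x_def)
    thus ?thesis using False ne by (simp add: g_def transpose_def)
  qed
  have gl: "g ((f ^^ l) s) = (if l = j then s' else (f ^^ Suc l) s)" if "1 \<le> l" "l \<le> j" for l
  proof -
    have "(f ^^ l) s \<noteq> s" using inj[of l 0] that by simp
    moreover have "(f ^^ l) s = x \<longleftrightarrow> l = j" using inj[of l j] that by (simp add: x_def)
    ultimately show ?thesis using fj[of l] fj[of j] fix' by (auto simp: g_def transpose_def x_def)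
  qed
  have perm_g: "permutation g" unfolding g_def using perm by (intro permutation_transpose_comp)
  have "orbit g s' \<subseteq> A"
  proof (rule orbit_subsetI)
    show "g s' \<in> A"
    proof (cases "j = 0")
      case False
      hence "f s = (f ^^ 1) s" "1 \<in> {1..j}" by simp_all
      hence "f s \<in> A" unfolding A_def by blast
      thus ?thesis using gs' False by simp
    qed (simp add: gs' A_def)
    fix y assume "y \<in> A"
    then consider "y = s'" | l where "1 \<le> l" "l \<le> j" "y = (f ^^ l) s" unfolding A_def by auto
    thus "g y \<in> A"
    proof cases
      case 1 thus ?thesis using \<open>g s' \<in> A\<close> by simp
    next
      case 2
      show ?thesis
      proof (cases "l = j")
        case True thus ?thesis using gl[OF 2(1,2)] 2(3) by (simp add: A_def)
      next
        case False
        hence "Suc l \<in> {1..j}" using 2 by simp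
        hence "(f ^^ Suc l) s \<in> A" unfolding A_def by blast
        thus ?thesis using gl[OF 2(1,2)] 2(3) False by simp
      qed
    qed
  qed
  moreover have "A \<subseteq> orbit g s'"
  proof -
    have "(f ^^ l) s \<in> orbit g s'" if "1 \<le> l" "l \<le> j" for l
      using that
    proof (induction l)
      case (Suc l)
      show ?case
      proof (cases "l = 0")
        case True
        have "g s' = f s" using gs' Suc.prems by simp
        thus ?thesis using orbit.base[of g s'] True by simp
      next
        case False
        hence "g ((f ^^ l) s) = (f ^^ Suc l) s" using gl[of l] Suc.prems by simp
        moreover have "(f ^^ l) s \<in> orbit g s'" using Suc False by simp
        ultimately show ?thesis using orbit.step by metis
      qed
    qed simp
    thus ?thesis using permutation_self_in_orbit[OF perm_g, of s'] by (auto simp: A_def)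
  qed
  ultimately have "orbit g s' = A" by blast
  moreover have "inj_on (\<lambda>l. (f ^^ l) s) {1..j}" using inj by (auto intro!: inj_onI)
  moreover have "s' \<notin> (\<lambda>l. (f ^^ l) s) ` {1..j}" using fj by force
  ultimately show ?thesis by (simp add: A_def card_image)
qed

text \<open>Cutting leaves two legs on one face. Removing s' gives a planted map with leg s, and s'
  lies on the face of s exactly when it was inserted after a dart x of that face; hence the
  dependent sum over the root face instead of all corners.\<close>

lemma diff_face_bij:
  assumes fin: "finite D" and s: "s \<in> D" "s' \<in> D" "s \<noteq> s'"
  shows "bij_betw (\<lambda>((\<sigma>, \<alpha>), x). (\<sigma> \<circ> transpose (\<alpha> x) s', \<alpha> \<circ> transpose s s'))
    (SIGMA p:legged (D - {s'}) {s}. orbit (face_perm p) s) (diff_face D s s')"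
proof -
  define D' where "D' = D - {s'}"
  have D': "finite D'" "s' \<notin> D'" "D' \<noteq> {}" "insert s' D' = D" "s \<in> D'" using fin s by (auto simp: D'_def)
  let ?h = "\<lambda>((\<sigma>, \<alpha>), x). (\<sigma> \<circ> transpose (\<alpha> x) s', \<alpha>)"
  let ?S = "SIGMA p:legged D' {s}. orbit (face_perm p) s"
  let ?T = "{(\<sigma>, \<alpha>). (\<sigma>, \<alpha>) \<in> legged D {s, s'} \<and> s' \<in> orbit (\<sigma> \<circ> \<alpha>) s}"
  have b0: "bij_betw ?h (legged D' {s} \<times> D') (legged D {s, s'})"
    using legged_insert_bij[OF D'(1,2), of "{s}"] D'(3,4) s(3) by (simp add: insert_commute)
  have iff: "s' \<in> orbit (face_perm (?h ((\<sigma>, \<alpha>), x))) s \<longleftrightarrow> x \<in> orbit (\<sigma> \<circ> \<alpha>) s"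
    if L: "(\<sigma>, \<alpha>) \<in> legged D' {s}" and x: "x \<in> D'" for \<sigma> \<alpha> x
  proof -
    interpret leg_insert D' \<sigma> \<alpha> s' x
      by unfold_locales (use D' L x in \<open>auto simp: legged_def\<close>)
    have rn: "s' \<notin> orbit (\<sigma> \<circ> \<alpha>) s" by (rule r_notin_orbit[OF faces_permutes D'(5)])
    have fp: "face_perm (?h ((\<sigma>, \<alpha>), x)) = \<sigma> \<circ> \<alpha> \<circ> transpose x s'"
      by (simp add: ins_def[symmetric] faces_ins)
    show ?thesis
    proof (cases "x \<in> orbit (\<sigma> \<circ> \<alpha>) s")
      case True
      have P: "permutation (\<sigma> \<circ> \<alpha> \<circ> transpose x s')"
        by (rule permutation_transpose_comp[OF permutations(3)])
      have o: "orbit (\<sigma> \<circ> \<alpha>) x = orbit (\<sigma> \<circ> \<alpha>) s" by (rule orbit_eq_of_mem[OF permutations(3) True])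
      have "s \<in> orbit (\<sigma> \<circ> \<alpha> \<circ> transpose x s') s'"
        using root_orbit_ins(2) permutation_self_in_orbit[OF permutations(3), of s]
        unfolding faces_ins o by simp
      hence "s' \<in> orbit (\<sigma> \<circ> \<alpha> \<circ> transpose x s') s"
        using orbit_eq_of_mem[OF P] permutation_self_in_orbit[OF P, of s'] by metis
      thus ?thesis using True fp by simp
    next
      case False
      have "orbit (\<sigma> \<circ> \<alpha> \<circ> transpose x s') s = orbit (\<sigma> \<circ> \<alpha>) s"
        by (rule orbit_transpose_other[OF permutations(3) False rn])
      thus ?thesis using False fp rn by simp
    qed
  qed
  have sub: "?S \<subseteq> legged D' {s} \<times> D'"
    using card_orbit_permutes(1)[OF D'(1) legged_face_perm(1)[OF _ D'(1)] D'(5)] by auto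
  have "?h ` ?S = ?T"
  proof
    show "?h ` ?S \<subseteq> ?T"
    proof
      fix z assume "z \<in> ?h ` ?S"
      then obtain q where q: "q \<in> ?S" and z: "z = ?h q" by blast
      obtain \<sigma> \<alpha> x where qe: "q = ((\<sigma>, \<alpha>), x)" by (metis surj_pair)
      have L: "(\<sigma>, \<alpha>) \<in> legged D' {s}" "x \<in> D'" "x \<in> orbit (\<sigma> \<circ> \<alpha>) s" using q subsetD[OF sub q] qe by auto
      have "z \<in> legged D {s, s'}" using bij_betw_apply[OF b0, of q] q sub z by blast
      moreover have "s' \<in> orbit (face_perm z) s" using iff[OF L(1,2)] L(3) unfolding z qe by blast
      ultimately show "z \<in> ?T" by (cases z) simp
    qed
    show "?T \<subseteq> ?h ` ?S"
    proof
      fix z assume z: "z \<in> ?T"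
      hence z1: "z \<in> legged D {s, s'}" and z2: "s' \<in> orbit (face_perm z) s" by (auto)
      from z1 obtain q where q: "q \<in> legged D' {s} \<times> D'" and zq: "z = ?h q"
        using bij_betw_imp_surj_on[OF b0] by (metis (no_types, lifting) imageE)
      obtain \<sigma> \<alpha> x where qe: "q = ((\<sigma>, \<alpha>), x)" by (metis surj_pair)
      have "x \<in> orbit (\<sigma> \<circ> \<alpha>) s" using iff[of \<sigma> \<alpha> x] q z2 unfolding zq qe by blast
      hence "q \<in> ?S" using q qe by simp
      thus "z \<in> ?h ` ?S" using zq by (rule rev_image_eqI)
    qed
  qed
  hence b1: "bij_betw ?h ?S ?T"
    using inj_on_subset[OF bij_betw_imp_inj_on[OF b0] sub] by (simp add: bij_betw_def)
  have b2: "bij_betw ((\<lambda>(\<sigma>, \<alpha>). (\<sigma>, \<alpha> \<circ> transpose s s')) \<circ> ?h) ?S (diff_face D s s')"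
    using bij_betw_trans[OF b1 glue_bij[OF fin s]] unfolding diff_face_def .
  show ?thesis unfolding D'_def[symmetric]
    by (rule bij_betw_cong[THEN iffD1, OF _ b2]) auto
qed

text \<open>Inserting s' lengthens the root face from n to n + 1, and gluing divides this into j + 1
  on the side of s' and n - j on the side of s. The face of s' is not the root face, so it
  contributes its weight.\<close>

lemma inner_weight_diff_face:
  assumes fin: "finite D" and s: "s \<in> D" "s' \<in> D" "s \<noteq> s'"
    and L: "(\<sigma>, \<alpha>) \<in> legged (D - {s'}) {s}" and j: "j < card (orbit (\<sigma> \<circ> \<alpha>) s)"
  defines "x \<equiv> ((\<sigma> \<circ> \<alpha>) ^^ j) s"
  defines "\<phi> \<equiv> \<sigma> \<circ> transpose (\<alpha> x) s' \<circ> (\<alpha> \<circ> transpose s s')"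
  shows "card (orbit \<phi> s) + j = card (orbit (\<sigma> \<circ> \<alpha>) s)"
    and "inner_weight D \<phi> s = zvar (Suc j) * inner_weight (D - {s'}) (\<sigma> \<circ> \<alpha>) s"
proof -
  define D' where "D' = D - {s'}"
  have D': "finite D'" "s' \<notin> D'" "D = insert s' D'" "s \<in> D'" using fin s by (auto simp: D'_def)
  have Lp: "\<sigma> permutes D'" "\<alpha> permutes D'" "\<alpha> \<circ> \<alpha> = id" using L by (auto simp: legged_def D'_def)
  let ?f = "\<sigma> \<circ> \<alpha>"
  have fp: "?f permutes D'" using Lp by (intro permutes_compose)
  have pf: "permutation ?f" by (rule permutes_permutation[OF D'(1) fp])
  have x_in: "x \<in> orbit ?f s"
    using bij_betw_apply[OF funpow_orbit_bij[OF pf, of s], of j] j by (simp add: x_def)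
  have sub: "orbit ?f s \<subseteq> D'" "finite (orbit ?f s)" using card_orbit_permutes[OF D'(1) fp D'(4)] by auto
  have xD: "x \<in> D'" using x_in sub by auto
  interpret leg_insert D' \<sigma> \<alpha> s' x
    by unfold_locales (use D' Lp xD in auto)
  define \<psi> where "\<psi> = ?f \<circ> transpose x s'"
  have \<psi>: "\<sigma> \<circ> transpose (\<alpha> x) s' \<circ> \<alpha> = \<psi>" using faces_ins unfolding ins_def \<psi>_def .
  have \<phi>\<psi>: "\<phi> = \<psi> \<circ> transpose s s'" unfolding \<phi>_def \<psi>[symmetric] by (simp only: comp_assoc)
  have p\<psi>: "permutation \<psi>" unfolding \<psi>_def by (rule permutation_transpose_comp[OF pf])
  have p\<phi>: "permutation \<phi>" unfolding \<phi>\<psi> by (rule permutation_transpose_comp[OF p\<psi>])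
  have ofx: "orbit ?f x = orbit ?f s" by (rule orbit_eq_of_mem[OF pf x_in])
  have o1: "orbit \<psi> s' = insert s' (orbit ?f s)"
    using root_orbit_ins(2) unfolding faces_ins \<psi>_def ofx .
  have "s \<in> orbit \<psi> s'" using o1 permutation_self_in_orbit[OF pf, of s] by simp
  hence o2: "orbit \<psi> s = insert s' (orbit ?f s)" using orbit_eq_of_mem[OF p\<psi>] o1 by metis
  have nin: "s' \<notin> orbit \<phi> s" unfolding \<phi>\<psi> using o2 by (intro orbit_split[OF p\<psi> _ s(3)]) simp
  have \<psi>\<phi>: "\<phi> \<circ> transpose s s' = \<psi>" unfolding \<phi>\<psi> by (rule comp_transpose_twice)
  have un: "orbit \<psi> s = orbit \<phi> s \<union> orbit \<phi> s'"
    using orbit_merge(1)[OF p\<phi> nin] unfolding \<psi>\<phi> .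
  have dis: "orbit \<phi> s \<inter> orbit \<phi> s' = {}" using orbit_disjoint[OF p\<phi> nin] by blast
  have cj: "card (orbit \<phi> s') = Suc j"
    unfolding \<phi>\<psi> \<psi>_def x_def
    by (rule new_face_orbit[OF pf _ s(3) j]) (use fix_r in simp)
  have s'n: "s' \<notin> orbit ?f s" using sub D'(2) by auto
  have fU: "finite (orbit \<psi> s)" using o2 sub by simp
  have fin_os: "finite (orbit \<phi> s)" "finite (orbit \<phi> s')" using fU un by simp_all
  have "card (orbit \<psi> s) = card (orbit \<phi> s) + card (orbit \<phi> s')"
    unfolding un by (rule card_Un_disjoint[OF fin_os dis])
  moreover have "card (orbit \<psi> s) = Suc (card (orbit ?f s))" unfolding o2 using s'n sub by simp
  ultimately show "card (orbit \<phi> s) + j = card (orbit ?f s)" using cj by simp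
  define Os where "Os = orbit \<phi> ` (D - orbit \<psi> s)"
  have "orbit \<phi> ` (D - orbit \<phi> s) = insert (orbit \<phi> s') Os"
  proof -
    have e: "D - orbit \<phi> s = (D - orbit \<psi> s) \<union> (D \<inter> orbit \<phi> s')" using un dis by blast
    have "orbit \<phi> ` (D \<inter> orbit \<phi> s') \<subseteq> {orbit \<phi> s'}"
      using orbit_eq_of_mem[OF p\<phi>, of _ s'] by blast
    moreover have "s' \<in> D \<inter> orbit \<phi> s'" using s(2) permutation_self_in_orbit[OF p\<phi>, of s'] by blast
    ultimately have "orbit \<phi> ` (D \<inter> orbit \<phi> s') = {orbit \<phi> s'}" by blast
    thus ?thesis unfolding e image_Un Os_def by simp
  qed
  moreover have "orbit \<phi> s' \<notin> Os"
  proof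
    assume "orbit \<phi> s' \<in> Os"
    then obtain y where y: "y \<in> D - orbit \<psi> s" "orbit \<phi> s' = orbit \<phi> y" unfolding Os_def by blast
    have "y \<in> orbit \<phi> s'" unfolding y(2) by (rule permutation_self_in_orbit[OF p\<phi>])
    thus False using y(1) un by blast
  qed
  moreover have "finite Os" using assms(1) by (simp add: Os_def)
  ultimately have "inner_weight D \<phi> s = zvar (Suc j) * (\<Prod>f\<in>Os. zvar (card f))"
    unfolding inner_weight_def using cj by simp
  also have "Os = orbit ?f ` (D' - orbit ?f s)"
  proof -
    have e: "D - orbit \<psi> s = D' - orbit ?f s" unfolding o2 D'(3) using D'(2) by blast
    have "orbit \<phi> y = orbit ?f y" if y: "y \<in> D' - orbit ?f s" for y
    proof -
      have sy: "s \<notin> orbit ?f y" "x \<notin> orbit ?f y"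
        using y orbit_eq_of_mem[OF pf, of s y] orbit_eq_of_mem[OF pf, of x y] ofx
          permutation_self_in_orbit[OF pf, of y] by auto
      have s'y: "s' \<notin> orbit ?f y" using y by (intro r_notin_orbit[OF fp]) auto
      have "orbit \<psi> y = orbit ?f y" unfolding \<psi>_def by (rule orbit_transpose_other[OF pf sy(2) s'y])
      moreover have "orbit \<phi> y = orbit \<psi> y" unfolding \<phi>\<psi>
        by (rule orbit_transpose_other[OF p\<psi>]) (use sy s'y calculation in simp_all)
      ultimately show ?thesis by simp
    qed
    thus ?thesis unfolding Os_def e by (rule image_cong[OF refl])
  qed
  finally show "inner_weight D \<phi> s = zvar (Suc j) * inner_weight (D - {s'}) ?f s"
    unfolding inner_weight_def D'_def .
qed

lemma sum_diff_face:
  assumes fin: "finite D" and s: "s \<in> D" "s' \<in> D" "s \<noteq> s'" and k: "k \<ge> 1" and M: "card D \<le> M"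
  shows "(\<Sum>p\<in>diff_face D s s'. if card (orbit (face_perm p) s) = k then inner_weight D (face_perm p) s else 0)
    = (\<Sum>j<M. zvar (Suc j) * legged_gf (D - {s'}) {s} s (k + j))"
    (is "(\<Sum>p\<in>_. ?g p) = _")
proof -
  let ?h = "\<lambda>((\<sigma>, \<alpha>), x). (\<sigma> \<circ> transpose (\<alpha> x) s', \<alpha> \<circ> transpose s s')"
  let ?L = "legged (D - {s'}) {s}"
  let ?w = "\<lambda>p. inner_weight (D - {s'}) (face_perm p) s"
  let ?n = "\<lambda>p. card (orbit (face_perm p) s)"
  have finD': "finite (D - {s'})" and sD': "s \<in> D - {s'}" using fin s by auto
  have perm: "permutation (face_perm p)" if "p \<in> ?L" for p
    by (rule legged_face_perm(2)[OF that finD'])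
  have finO: "finite (orbit (face_perm p) s)" "?n p \<le> M" if "p \<in> ?L" for p
  proof -
    note c = card_orbit_permutes[OF finD' legged_face_perm(1)[OF that finD'] sD']
    show "finite (orbit (face_perm p) s)" by (rule c(2))
    have "card (D - {s'}) \<le> card D" using fin by (simp add: card_mono)
    thus "?n p \<le> M" using c(4) M by linarith
  qed
  have "(\<Sum>p\<in>diff_face D s s'. ?g p) = (\<Sum>q\<in>(SIGMA p:?L. orbit (face_perm p) s). ?g (?h q))"
    by (rule sum.reindex_bij_betw[symmetric]) (rule diff_face_bij[OF fin s])
  also have "\<dots> = (\<Sum>(p, x)\<in>(SIGMA p:?L. orbit (face_perm p) s). ?g (?h (p, x)))"
    by (simp only: case_prod_unfold prod.collapse)
  also have "\<dots> = (\<Sum>p\<in>?L. \<Sum>x\<in>orbit (face_perm p) s. ?g (?h (p, x)))"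
    using finite_legged[OF finD'] finO(1) by (intro sum.Sigma[symmetric]) auto
  also have "\<dots> = (\<Sum>p\<in>?L. \<Sum>j<M. if ?n p = k + j then zvar (Suc j) * ?w p else 0)"
  proof (rule sum.cong[OF refl])
    fix p assume p: "p \<in> ?L"
    obtain \<sigma> \<alpha> where pe: "p = (\<sigma>, \<alpha>)" by (cases p)
    have "(\<Sum>x\<in>orbit (face_perm p) s. ?g (?h (p, x))) = (\<Sum>j<?n p. ?g (?h (p, (face_perm p ^^ j) s)))"
      by (rule sum.reindex_bij_betw[symmetric]) (rule funpow_orbit_bij[OF perm[OF p]])
    also have "\<dots> = (\<Sum>j<?n p. if ?n p = k + j then zvar (Suc j) * ?w p else 0)"
    proof (rule sum.cong[OF refl])
      fix j assume "j \<in> {..<?n p}"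
      hence j: "j < card (orbit (\<sigma> \<circ> \<alpha>) s)" by (simp add: pe)
      note iw = inner_weight_diff_face[OF fin s p[unfolded pe] j]
      have "card (orbit (\<sigma> \<circ> transpose (\<alpha> (((\<sigma> \<circ> \<alpha>) ^^ j) s)) s' \<circ> (\<alpha> \<circ> transpose s s')) s) = k
        \<longleftrightarrow> card (orbit (\<sigma> \<circ> \<alpha>) s) = k + j" using iw(1) by linarith
      thus "?g (?h (p, (face_perm p ^^ j) s)) = (if ?n p = k + j then zvar (Suc j) * ?w p else 0)"
        unfolding pe prod.case face_perm_pair iw(2) by simp
    qed
    \<comment> \<open>As k is at least 1, \<open>?n p = k + j\<close> forces
      \<open>j < ?n p\<close>, so the range can be made independent of p.\<close>
    also have "\<dots> = (\<Sum>j<M. if ?n p = k + j then zvar (Suc j) * ?w p else 0)"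
      by (rule sum.mono_neutral_left) (use finO(2)[OF p] k in auto)
    finally show "(\<Sum>x\<in>orbit (face_perm p) s. ?g (?h (p, x))) =
      (\<Sum>j<M. if ?n p = k + j then zvar (Suc j) * ?w p else 0)" .
  qed
  also have "\<dots> = (\<Sum>j<M. \<Sum>p\<in>?L. if ?n p = k + j then zvar (Suc j) * ?w p else 0)"
    by (rule sum.swap)
  also have "\<dots> = (\<Sum>j<M. zvar (Suc j) * legged_gf (D - {s'}) {s} s (k + j))"
    unfolding legged_gf_def sum_distrib_left by (intro sum.cong refl) simp
  finally show ?thesis .
qed

text \<open>The maps are sorted by the partner s' of the root dart and by whether both sides of the
  root edge lie on one face; this decides which of the two cutting bijections applies.\<close>

lemma legged_gf_root_edge:
  assumes fin: "finite D" and s: "s \<in> D" and k: "k \<ge> 1"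
  shows "legged_gf D {} s k = (\<Sum>s'\<in>D - {s}.
     (\<Sum>D1 | D1 \<subseteq> D \<and> s \<in> D1 \<and> s' \<notin> D1. \<Sum>i\<le>k. legged_gf D1 {s} s i * legged_gf (D - D1) {s'} s' (k - i))
     + (\<Sum>j<card D. zvar (Suc j) * legged_gf (D - {s'}) {s} s (k + j)))"
proof -
  let ?g = "\<lambda>p. if card (orbit (face_perm p) s) = k then inner_weight D (face_perm p) s else 0"
  have "legged_gf D {} s k = (\<Sum>s'\<in>D - {s}. \<Sum>p | p \<in> legged D {} \<and> snd p s = s'. ?g p)"
    unfolding legged_gf_def
  proof (rule sum.group[symmetric])
    show "(\<lambda>p. snd p s) ` legged D {} \<subseteq> D - {s}"
    proof
      fix z assume "z \<in> (\<lambda>p. snd p s) ` legged D {}"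
      then obtain p where p: "p \<in> legged D {}" "z = snd p s" by blast
      hence "snd p permutes D" "{d \<in> D. snd p d = d} = {}" by (auto simp: legged_def)
      thus "z \<in> D - {s}" using s p(2) permutes_in_image[of "snd p" D s] by auto
    qed
  qed (use fin finite_legged in auto)
  also have "\<dots> = (\<Sum>s'\<in>D - {s}. (\<Sum>p\<in>same_face D s s'. ?g p) + (\<Sum>p\<in>diff_face D s s'. ?g p))"
  proof (rule sum.cong[OF refl])
    fix s'
    have "{p. p \<in> legged D {} \<and> snd p s = s'} = same_face D s s' \<union> diff_face D s s'"
      by (auto simp: same_face_def diff_face_def)
    moreover have "same_face D s s' \<inter> diff_face D s s' = {}"
      by (auto simp: same_face_def diff_face_def)
    moreover have "same_face D s s' \<subseteq> legged D {}" "diff_face D s s' \<subseteq> legged D {}"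
      by (auto simp: same_face_def diff_face_def)
    ultimately show "(\<Sum>p | p \<in> legged D {} \<and> snd p s = s'. ?g p) =
      (\<Sum>p\<in>same_face D s s'. ?g p) + (\<Sum>p\<in>diff_face D s s'. ?g p)"
      using finite_subset[OF _ finite_legged[OF fin]] by (simp add: sum.union_disjoint)
  qed
  also have "\<dots> = (\<Sum>s'\<in>D - {s}.
     (\<Sum>D1 | D1 \<subseteq> D \<and> s \<in> D1 \<and> s' \<notin> D1. \<Sum>i\<le>k. legged_gf D1 {s} s i * legged_gf (D - D1) {s'} s' (k - i))
     + (\<Sum>j<card D. zvar (Suc j) * legged_gf (D - {s'}) {s} s (k + j)))"
    using sum_same_face[OF fin s] sum_diff_face[OF fin s] k by (intro sum.cong refl arg_cong2[where f = "(+)"]) auto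
  finally show ?thesis .
qed

section \<open>Tutte's recursion\<close>

definition relabel :: "('a \<Rightarrow> 'a) \<Rightarrow> ('a \<Rightarrow> 'a) \<Rightarrow> 'a \<Rightarrow> 'a" where
  "relabel \<pi> f = \<pi> \<circ> f \<circ> inv \<pi>"

lemma relabel_comp: "bij \<pi> \<Longrightarrow> relabel \<pi> (f \<circ> g) = relabel \<pi> f \<circ> relabel \<pi> g"
  by (simp add: relabel_def fun_eq_iff bij_is_inj)

lemma relabel_apply: "bij \<pi> \<Longrightarrow> relabel \<pi> f (\<pi> x) = \<pi> (f x)"
  by (simp add: relabel_def bij_is_inj)

lemma relabel_inv: "bij \<pi> \<Longrightarrow> relabel (inv \<pi>) (relabel \<pi> f) = f"
  by (simp add: relabel_def fun_eq_iff bij_is_inj inv_inv_eq)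

lemma orbit_relabel: "bij \<pi> \<Longrightarrow> orbit (relabel \<pi> f) (\<pi> x) = \<pi> ` orbit f x"
  by (rule orbit_conj) (simp add: relabel_apply fun_eq_iff)

lemma relabel_permutes:
  assumes "bij \<pi>" "f permutes D"
  shows "relabel \<pi> f permutes \<pi> ` D"
proof (rule bij_imp_permutes)
  show "bij_betw (relabel \<pi> f) (\<pi> ` D) (\<pi> ` D)"
  proof -
    have inv: "bij_betw (inv \<pi>) (\<pi> ` D) D"
      using assms(1) by (auto simp: bij_betw_def image_comp bij_is_inj bij_is_surj inj_on_def surj_f_inv_f)
    have f: "bij_betw f D D" using assms(2) by (rule permutes_imp_bij)
    have \<pi>: "bij_betw \<pi> D (\<pi> ` D)" using assms(1) by (auto simp: bij_betw_def intro: inj_on_subset)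
    show ?thesis unfolding relabel_def comp_assoc
      using bij_betw_trans[OF bij_betw_trans[OF inv f] \<pi>] by (simp add: comp_assoc)
  qed
  fix x assume x: "x \<notin> \<pi> ` D"
  have "\<pi> (inv \<pi> x) = x" using assms(1) by (simp add: bij_is_surj surj_f_inv_f)
  hence "inv \<pi> x \<notin> D" using x by (metis imageI)
  thus "relabel \<pi> f x = x" using \<open>\<pi> (inv \<pi> x) = x\<close> assms(2) by (simp add: relabel_def permutes_not_in)
qed

lemma cyc_relabel: "bij \<pi> \<Longrightarrow> cyc (\<pi> ` D) (relabel \<pi> f) = cyc D f"
proof -
  assume b: "bij \<pi>"
  have "orbit (relabel \<pi> f) ` \<pi> ` D = (`) \<pi> ` (orbit f ` D)"
    by (simp add: image_image orbit_relabel[OF b])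
  moreover have "inj_on ((`) \<pi>) A" for A
    using b by (auto intro!: inj_onI simp: inj_image_eq_iff bij_is_inj)
  ultimately show ?thesis unfolding cyc_def by (simp add: card_image)
qed

lemma conn_relabel:
  assumes b: "bij \<pi>" and c: "conn D \<sigma> \<alpha>"
  shows "conn (\<pi> ` D) (relabel \<pi> \<sigma>) (relabel \<pi> \<alpha>)"
  unfolding conn_def
proof (intro allI impI)
  fix A assume A: "A \<subseteq> \<pi> ` D" "A \<noteq> {}" "relabel \<pi> \<sigma> ` A \<subseteq> A" "relabel \<pi> \<alpha> ` A \<subseteq> A"
  define B where "B = {y \<in> D. \<pi> y \<in> A}"
  have AB: "A = \<pi> ` B" using A(1) by (auto simp: B_def)
  have inj: "\<pi> x = \<pi> y \<longleftrightarrow> x = y" for x y using b by (simp add: bij_is_inj inj_eq)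
  have cl: "f ` B \<subseteq> B" if "relabel \<pi> f ` A \<subseteq> A" for f
  proof
    fix z assume "z \<in> f ` B"
    then obtain y where y: "y \<in> B" "z = f y" by blast
    have "relabel \<pi> f (\<pi> y) \<in> A" using that y(1) AB by blast
    hence "\<pi> z \<in> \<pi> ` B" using y(2) AB by (simp add: relabel_apply[OF b])
    thus "z \<in> B" using inj by auto
  qed
  have "B \<subseteq> D" by (auto simp: B_def)
  moreover have "B \<noteq> {}" using A(2) AB by simp
  ultimately have "B = D" using cl[OF A(3)] cl[OF A(4)] by (rule conn_closed[OF c])
  thus "A = \<pi> ` D" using AB by simp
qed

definition relabel_pair where
  "relabel_pair \<pi> p = (relabel \<pi> (fst p), relabel \<pi> (snd p))"

lemma relabel_id: "bij \<pi> \<Longrightarrow> relabel \<pi> id = id"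
  by (simp add: relabel_def fun_eq_iff bij_is_surj surj_f_inv_f)

lemma relabel_legged:
  assumes b: "bij \<pi>" and p: "p \<in> legged D F"
  shows "relabel_pair \<pi> p \<in> legged (\<pi> ` D) (\<pi> ` F)"
proof -
  obtain \<sigma> \<alpha> where pe: "p = (\<sigma>, \<alpha>)" by (cases p)
  have inj: "\<pi> x = \<pi> y \<longleftrightarrow> x = y" for x y using b by (simp add: bij_is_inj inj_eq)
  have "{d \<in> \<pi> ` D. relabel \<pi> \<alpha> d = d} = \<pi> ` {d \<in> D. \<alpha> d = d}"
    using inj by (auto simp: relabel_apply[OF b])
  moreover have "euler (\<pi> ` D) (relabel \<pi> \<sigma>) (relabel \<pi> \<alpha>) = euler D \<sigma> \<alpha>"
    unfolding euler_def relabel_comp[OF b, symmetric] cyc_relabel[OF b] ..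
  moreover have "card (\<pi> ` D) = card D" using b by (intro card_image) (auto simp: bij_def intro: inj_on_subset)
  moreover have "relabel \<pi> \<alpha> \<circ> relabel \<pi> \<alpha> = id" if "\<alpha> \<circ> \<alpha> = id"
    unfolding relabel_comp[OF b, symmetric] that by (rule relabel_id[OF b])
  ultimately show ?thesis
    using p relabel_permutes[OF b, of \<sigma> D] relabel_permutes[OF b, of \<alpha> D] conn_relabel[OF b, of D \<sigma> \<alpha>]
    by (simp add: pe relabel_pair_def legged_def)
qed

lemma relabel_legged_bij:
  assumes b: "bij \<pi>"
  shows "bij_betw (relabel_pair \<pi>) (legged D F) (legged (\<pi> ` D) (\<pi> ` F))"
proof (rule bij_betw_byWitness[where f' = "relabel_pair (inv \<pi>)"])
  have bi: "bij (inv \<pi>)" using b by (rule bij_imp_bij_inv)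
  have inv2: "relabel \<pi> (relabel (inv \<pi>) f) = f" for f
    using relabel_inv[OF bi, of f] b by (simp add: inv_inv_eq)
  show "\<forall>p\<in>legged D F. relabel_pair (inv \<pi>) (relabel_pair \<pi> p) = p"
    by (simp add: relabel_pair_def relabel_inv[OF b])
  show "\<forall>p\<in>legged (\<pi> ` D) (\<pi> ` F). relabel_pair \<pi> (relabel_pair (inv \<pi>) p) = p"
    by (simp add: relabel_pair_def inv2)
  show "relabel_pair \<pi> ` legged D F \<subseteq> legged (\<pi> ` D) (\<pi> ` F)"
    using relabel_legged[OF b] by blast
  have "inv \<pi> ` \<pi> ` A = A" for A using b by (simp add: image_comp bij_is_inj)
  thus "relabel_pair (inv \<pi>) ` legged (\<pi> ` D) (\<pi> ` F) \<subseteq> legged D F"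
    using relabel_legged[OF bi, of _ "\<pi> ` D" "\<pi> ` F"] by auto
qed

lemma legged_gf_relabel:
  fixes \<pi> :: "'a \<Rightarrow> 'a"
  assumes b: "bij \<pi>"
  shows "legged_gf (\<pi> ` D) (\<pi> ` F) (\<pi> s) k = legged_gf D F s k"
proof -
  let ?g = "\<lambda>D s p. if card (orbit (face_perm p) s) = k then inner_weight D (face_perm p) s else 0"
  have inj: "inj \<pi>" using b by (rule bij_is_inj)
  have injP: "inj_on ((`) \<pi>) A" for A using inj by (auto intro!: inj_onI simp: inj_image_eq_iff)
  have card: "card (\<pi> ` A) = card A" for A using inj by (intro card_image) (auto intro: inj_on_subset)
  have fp: "face_perm (relabel_pair \<pi> p) = relabel \<pi> (face_perm p)" for p
    by (simp add: face_perm_def relabel_pair_def relabel_comp[OF b])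
  have iw: "inner_weight (\<pi> ` D) (relabel \<pi> f) (\<pi> s) = inner_weight D f s" for f
  proof -
    have "\<pi> ` D - orbit (relabel \<pi> f) (\<pi> s) = \<pi> ` (D - orbit f s)"
      unfolding orbit_relabel[OF b] using inj by (simp add: image_set_diff)
    hence "orbit (relabel \<pi> f) ` (\<pi> ` D - orbit (relabel \<pi> f) (\<pi> s)) = (`) \<pi> ` (orbit f ` (D - orbit f s))"
      by (simp add: image_image orbit_relabel[OF b])
    thus ?thesis unfolding inner_weight_def by (simp add: prod.reindex[OF injP] card)
  qed
  have "legged_gf (\<pi> ` D) (\<pi> ` F) (\<pi> s) k = (\<Sum>p\<in>legged D F. ?g (\<pi> ` D) (\<pi> s) (relabel_pair \<pi> p))"
    unfolding legged_gf_def by (rule sum.reindex_bij_betw[symmetric]) (rule relabel_legged_bij[OF b])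
  also have "\<dots> = legged_gf D F s k"
    unfolding legged_gf_def fp iw by (simp add: orbit_relabel[OF b] card)
  finally show ?thesis .
qed

text \<open>\<open>relabel\<close> conjugates by a bijection of the whole type, so a bijection from
  D to D' is completed by one from D' - D to D - D' and by the identity elsewhere.\<close>

lemma ex_bij_extending:
  assumes "finite D" "finite D'" "card D = card D'" "s \<in> D" "s' \<in> D'"
  obtains \<pi> :: "'a \<Rightarrow> 'a" where "bij \<pi>" "\<pi> ` D = D'" "\<pi> s = s'"
proof -
  have "card (D - {s}) = card (D' - {s'})" using assms by simp
  then obtain h where h: "bij_betw h (D - {s}) (D' - {s'})"
    using assms finite_same_card_bij by (metis finite_Diff)
  have "bij_betw (\<lambda>x. if x \<in> D - {s} then h x else s') ((D - {s}) \<union> {s}) ((D' - {s'}) \<union> {s'})"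
    using h by (intro bij_betw_disjoint_Un[where g = "\<lambda>_. s'"]) auto
  moreover have "(D - {s}) \<union> {s} = D" "(D' - {s'}) \<union> {s'} = D'" using assms(4,5) by auto
  moreover define h1 where "h1 = (\<lambda>x. if x \<in> D - {s} then h x else s')"
  ultimately have h1: "bij_betw h1 D D'" "h1 s = s'" by simp_all
  have "card ((D \<inter> D') \<union> (D - D')) = card (D \<inter> D') + card (D - D')"
    by (rule card_Un_disjoint) (use assms in auto)
  moreover have "card ((D \<inter> D') \<union> (D' - D)) = card (D \<inter> D') + card (D' - D)"
    by (rule card_Un_disjoint) (use assms in auto)
  moreover have "(D \<inter> D') \<union> (D - D') = D" "(D \<inter> D') \<union> (D' - D) = D'" by auto
  ultimately have "card (D' - D) = card (D - D')" using assms(3) by simp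
  then obtain h2 where h2: "bij_betw h2 (D' - D) (D - D')"
    using assms finite_same_card_bij by (metis finite_Diff)
  define \<pi> where "\<pi> x = (if x \<in> D \<union> D' then (if x \<in> D then h1 x else h2 x) else x)" for x
  have e: "D \<union> (D' - D) = D \<union> D'" "D' \<union> (D - D') = D \<union> D'" by auto
  have "bij_betw (\<lambda>x. if x \<in> D then h1 x else h2 x) (D \<union> (D' - D)) (D' \<union> (D - D'))"
    using h1(1) h2 by (intro bij_betw_disjoint_Un) auto
  hence "bij_betw \<pi> (D \<union> D') (D \<union> D')" unfolding e
    by (rule bij_betw_cong[THEN iffD1, rotated]) (simp add: \<pi>_def)
  hence "\<pi> permutes (D \<union> D')" by (rule bij_imp_permutes) (simp add: \<pi>_def)
  hence "bij \<pi>" by (rule permutes_bij)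
  moreover have "\<pi> ` D = D'" using h1(1) by (auto simp: \<pi>_def bij_betw_def)
  moreover have "\<pi> s = s'" using h1(2) assms(4) by (simp add: \<pi>_def)
  ultimately show thesis by (rule that)
qed

text \<open>The leg counts in the length of its face cycle but not in the degree \<open>k\<close> of the root face.\<close>

definition planted_gf :: "nat \<Rightarrow> nat \<Rightarrow> zpoly" where
  "planted_gf m k = legged_gf {..m} {m} m (Suc k)"

definition rooted_gf :: "nat \<Rightarrow> nat \<Rightarrow> zpoly" where
  "rooted_gf m k = legged_gf {..<m} {} 0 k"

lemma planted_gf_eq:
  fixes D :: "nat set"
  assumes "finite D" "s \<in> D" "card D = Suc m"
  shows "legged_gf D {s} s (Suc k) = planted_gf m k"
proof -
  obtain \<pi> :: "nat \<Rightarrow> nat" where \<pi>: "bij \<pi>" "\<pi> ` {..m} = D" "\<pi> m = s"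
    by (rule ex_bij_extending[of "{..m}" D m s]) (use assms in auto)
  show ?thesis using legged_gf_relabel[OF \<pi>(1), of "{..m}" "{m}" m "Suc k"] \<pi>
    by (simp add: planted_gf_def)
qed

lemma rooted_gf_eq:
  fixes D :: "nat set"
  assumes "finite D" "s \<in> D" "card D = m"
  shows "legged_gf D {} s k = rooted_gf m k"
proof -
  have "m > 0" using assms by (auto simp: card_gt_0_iff)
  obtain \<pi> :: "nat \<Rightarrow> nat" where \<pi>: "bij \<pi>" "\<pi> ` {..<m} = D" "\<pi> 0 = s"
    by (rule ex_bij_extending[of "{..<m}" D 0 s]) (use assms \<open>m > 0\<close> in auto)
  show ?thesis using legged_gf_relabel[OF \<pi>(1), of "{..<m}" "{}" 0 k] \<pi>
    by (simp add: rooted_gf_def)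
qed

lemma planted_gf_0: "planted_gf 0 k = (if k = 0 then 1 else 0)"
  using legged_gf_atomic[of "0::nat" "Suc k"] by (simp add: planted_gf_def)

lemma planted_gf_rooted:
  assumes "m > 0"
  shows "planted_gf m k = of_nat m * rooted_gf m k"
proof -
  have "planted_gf m k = legged_gf (insert m {..<m}) {m} m (Suc k)"
    using lessThan_Suc[of m] by (simp add: planted_gf_def lessThan_Suc_atMost)
  also have "\<dots> = (\<Sum>x<m. legged_gf {..<m} {} x k)"
    using assms by (intro legged_gf_root_leg) auto
  also have "\<dots> = (\<Sum>x<m. rooted_gf m k)"
    by (intro sum.cong refl rooted_gf_eq) auto
  finally show ?thesis by simp
qed

section \<open>Tutte's recursion for labelled darts\<close>

lemma sum_Pow_card:
  fixes f :: "nat \<Rightarrow> 'b::comm_semiring_1"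
  assumes "finite A"
  shows "(\<Sum>E\<in>Pow A. f (card E)) = (\<Sum>j\<le>card A. of_nat (card A choose j) * f j)"
proof -
  have "(\<Sum>E\<in>Pow A. f (card E)) = (\<Sum>j\<le>card A. \<Sum>E | E \<in> Pow A \<and> card E = j. f (card E))"
    by (rule sum.group[symmetric]) (use assms card_mono in auto)
  also have "\<dots> = (\<Sum>j\<le>card A. of_nat (card A choose j) * f j)"
  proof (rule sum.cong[OF refl])
    fix j
    have "card {E. E \<in> Pow A \<and> card E = j} = card A choose j" using n_subsets[OF assms, of j] by simp
    thus "(\<Sum>E | E \<in> Pow A \<and> card E = j. f (card E)) = of_nat (card A choose j) * f j" by simp
  qed
  finally show ?thesis .
qed

text \<open>Each root face cycle contains its leg and so has length at least 1; counted without the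
  legs, the two degrees add up to k - 2.\<close>

lemma planted_convolution:
  fixes D1 D2 :: "nat set"
  assumes "finite D1" "finite D2" "s \<in> D1" "s' \<in> D2" "card D1 = Suc m1" "card D2 = Suc m2"
  shows "(\<Sum>i\<le>k. legged_gf D1 {s} s i * legged_gf D2 {s'} s' (k - i))
    = (if k < 2 then 0 else \<Sum>i\<le>k-2. planted_gf m1 i * planted_gf m2 (k - 2 - i))"
proof -
  have z: "legged_gf D1 {s} s 0 = 0" "legged_gf D2 {s'} s' 0 = 0"
    using assms by (simp_all add: legged_gf_eq_0)
  show ?thesis
  proof (cases "k < 2")
    case True
    hence "k = 0 \<or> k = 1" by auto
    thus ?thesis using True z by auto
  next
    case False
    then obtain l where k: "k = Suc (Suc l)" by (metis add_2_eq_Suc le_Suc_ex not_less)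
    have "(\<Sum>i\<le>k. legged_gf D1 {s} s i * legged_gf D2 {s'} s' (k - i))
      = (\<Sum>i\<le>l. legged_gf D1 {s} s (Suc i) * legged_gf D2 {s'} s' (Suc (l - i)))"
      unfolding k by (subst sum.atMost_Suc, subst sum.atMost_Suc_shift) (simp add: z Suc_diff_le)
    also have "\<dots> = (\<Sum>i\<le>l. planted_gf m1 i * planted_gf m2 (l - i))"
      using assms by (simp add: planted_gf_eq)
    finally show ?thesis by (simp add: k)
  qed
qed

text \<open>There are m + 1 choices for the partner s' of the root dart 0. In the disconnecting case
  the m remaining darts are distributed: a subset X stays with 0 and the rest goes with s', whence
  the binomial coefficient. The index k + j - 1 leaves out the leg.\<close>

lemma rooted_gf_step:
  assumes k: "k \<ge> 1"
  shows "rooted_gf (Suc (Suc m)) k = of_nat (Suc m) *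
    ((\<Sum>j\<le>m. of_nat (m choose j) * (if k < 2 then 0 else \<Sum>i\<le>k-2. planted_gf j i * planted_gf (m - j) (k - 2 - i)))
     + (\<Sum>j<Suc (Suc m). zvar (Suc j) * planted_gf m (k + j - 1)))"
    (is "_ = _ * (?A + ?B)")
proof -
  define D where "D = {..<Suc (Suc m)}"
  let ?c = "\<lambda>j. if k < 2 then 0 else \<Sum>i\<le>k-2. planted_gf j i * planted_gf (m - j) (k - 2 - i)"
  let ?t = "\<lambda>s' D1. \<Sum>i\<le>k. legged_gf D1 {0} 0 i * legged_gf (D - D1) {s'} s' (k - i)"
  have D: "finite D" "0 \<in> D" "card D = Suc (Suc m)" by (auto simp: D_def)
  have "rooted_gf (Suc (Suc m)) k = legged_gf D {} 0 k" by (simp add: rooted_gf_def D_def)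
  also have "\<dots> = (\<Sum>s'\<in>D - {0}.
     (\<Sum>D1 | D1 \<subseteq> D \<and> 0 \<in> D1 \<and> s' \<notin> D1. ?t s' D1)
     + (\<Sum>j<card D. zvar (Suc j) * legged_gf (D - {s'}) {0} 0 (k + j)))"
    by (rule legged_gf_root_edge[OF D(1,2) k])
  also have "\<dots> = (\<Sum>s'\<in>D - {0}. ?A + ?B)"
  proof (rule sum.cong[OF refl], rule arg_cong2[where f = "(+)"])
    fix s' assume s': "s' \<in> D - {0}"
    define E where "E = D - {0, s'}"
    have E: "finite E" "card E = m" "0 \<notin> E" "s' \<notin> E" "D = insert 0 (insert s' E)"
      using s' D by (auto simp: E_def card_Diff_subset)
    have "(\<Sum>D1 | D1 \<subseteq> D \<and> 0 \<in> D1 \<and> s' \<notin> D1. ?t s' D1)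
      = (\<Sum>X\<in>Pow E. ?t s' (insert 0 X))"
    proof (rule sum.reindex_bij_witness[of _ "insert 0" "\<lambda>D1. D1 - {0}"])
      fix D1 assume "D1 \<in> {D1. D1 \<subseteq> D \<and> 0 \<in> D1 \<and> s' \<notin> D1}"
      thus "insert 0 (D1 - {0}) = D1" "D1 - {0} \<in> Pow E" by (auto simp: E_def)
      thus "(?t s' (insert 0 (D1 - {0})))
        = (?t s' D1)" by simp
    next
      fix X assume "X \<in> Pow E"
      thus "insert 0 X - {0} = X" "insert 0 X \<in> {D1. D1 \<subseteq> D \<and> 0 \<in> D1 \<and> s' \<notin> D1}"
        using E s' by auto
    qed
    also have "\<dots> = (\<Sum>X\<in>Pow E. ?c (card X))"
    proof (rule sum.cong[OF refl])
      fix X assume X: "X \<in> Pow E"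
      have fX: "finite X" using X E(1) finite_subset by auto
      have "D - insert 0 X = insert s' (E - X)" using E X s' by auto
      moreover have "card (insert s' (E - X)) = Suc (m - card X)"
        using E X fX by (simp add: card_Diff_subset)
      moreover have "0 \<notin> X" using E X by auto
      hence "card (insert 0 X) = Suc (card X)" using fX by simp
      ultimately show "(?t s' (insert 0 X)) = ?c (card X)"
        using fX E(1) by (simp only:) (rule planted_convolution, auto)
    qed
    also have "\<dots> = ?A" by (rule sum_Pow_card[OF E(1), of ?c, unfolded E(2)])
    finally show "(\<Sum>D1 | D1 \<subseteq> D \<and> 0 \<in> D1 \<and> s' \<notin> D1. ?t s' D1) = ?A" .
    show "(\<Sum>j<card D. zvar (Suc j) * legged_gf (D - {s'}) {0} 0 (k + j)) = ?B"
    proof (unfold D(3), rule sum.cong[OF refl])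
      fix j
      have "k + j = Suc (k + j - 1)" using k by simp
      moreover have "legged_gf (D - {s'}) {0} 0 (Suc (k + j - 1)) = planted_gf m (k + j - 1)"
        using D s' by (intro planted_gf_eq) auto
      ultimately show "zvar (Suc j) * legged_gf (D - {s'}) {0} 0 (k + j) = zvar (Suc j) * planted_gf m (k + j - 1)"
        by simp
    qed
  qed
  also have "\<dots> = of_nat (Suc m) * (?A + ?B)" using D by simp
  finally show ?thesis .
qed

lemma rooted_gf_0: "m > 0 \<Longrightarrow> rooted_gf m 0 = 0"
  unfolding rooted_gf_def by (rule legged_gf_eq_0) auto

lemma rooted_gf_1: "rooted_gf (Suc 0) k = 0"
proof -
  have "legged {..<Suc 0} {} = {}"
    by (auto simp: legged_def permutes_in_image[where S = "{..<Suc 0}"] lessThan_Suc permutes_sing)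
  thus ?thesis by (simp add: rooted_gf_def legged_gf_def)
qed

text \<open>The recursion lowers the number of darts by two, and when an odd number is distributed,
  one part is odd; the induction starts with a single dart, which has no partner.\<close>

lemma planted_gf_odd: "odd m \<Longrightarrow> planted_gf m k = 0"
proof (induction m arbitrary: k rule: less_induct)
  case (less m)
  have m: "m > 0" using less.prems by (cases m) auto
  have "rooted_gf m k = 0"
  proof (cases "k = 0")
    case True thus ?thesis using m rooted_gf_0 by simp
  next
    case False
    show ?thesis
    proof (cases "m = 1")
      case True thus ?thesis using rooted_gf_1 by simp
    next
      case False
      then obtain n where n: "m = Suc (Suc n)" using m by (metis One_nat_def Suc_pred not0_implies_Suc not_gr0)
      have "odd n" using less.prems n by simp
      hence z1: "planted_gf n i = 0" for i using less.IH n by simp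
      have z2: "planted_gf j i * planted_gf (n - j) i' = 0" if "j \<le> n" for j i i'
      proof (cases "odd j")
        case True thus ?thesis using less.IH[of j] that n by simp
      next
        case False
        hence "odd (n - j)" using \<open>odd n\<close> that by simp
        thus ?thesis using less.IH[of "n - j"] that n by simp
      qed
      have "(\<Sum>i\<le>k-2. planted_gf j i * planted_gf (n - j) (k - 2 - i)) = 0" if "j \<le> n" for j
        by (intro sum.neutral ballI z2[OF that])
      hence "(\<Sum>j\<le>n. of_nat (n choose j) * (if k < 2 then 0 else \<Sum>i\<le>k-2. planted_gf j i * planted_gf (n - j) (k - 2 - i))) = 0"
        by (intro sum.neutral) auto
      moreover have "(\<Sum>j<Suc (Suc n). zvar (Suc j) * planted_gf n (k + j - 1)) = 0" by (simp add: z1)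
      moreover have "k \<ge> 1" using \<open>k \<noteq> 0\<close> by simp
      ultimately show ?thesis unfolding n by (simp only: rooted_gf_step) simp
    qed
  qed
  thus ?case using planted_gf_rooted[OF m] by simp
qed

lemma planted_gf_eq_0: "k > m \<Longrightarrow> planted_gf m k = 0"
  unfolding planted_gf_def by (rule legged_gf_eq_0) auto

text \<open>The coefficient of \<open>t\<^sup>n\<close> in \<open>W\<^sub>k\<close>.\<close>

definition tutte :: "nat \<Rightarrow> nat \<Rightarrow> zpoly" where
  "tutte n k = zconst (1 / fact (2 * n)) * planted_gf (2 * n) k"

lemma zconst_of_nat: "zconst (of_nat n) = of_nat n"
  by (induction n) (simp_all add: zconst_simps)

lemma tutte_0: "tutte 0 k = (if k = 0 then 1 else 0)"
  by (simp add: tutte_def planted_gf_0 zconst_simps)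

lemma tutte_Suc_0: "tutte (Suc n) 0 = 0"
  using planted_gf_rooted[of "2 * Suc n" 0] rooted_gf_0[of "2 * Suc n"] by (simp add: tutte_def)

lemma tutte_eq_0: "k > 2 * n \<Longrightarrow> tutte n k = 0"
  by (simp add: tutte_def planted_gf_eq_0)

lemma sum_even_only:
  fixes f :: "nat \<Rightarrow> 'b::comm_monoid_add"
  assumes "\<And>j. odd j \<Longrightarrow> f j = 0"
  shows "(\<Sum>j\<le>2 * n. f j) = (\<Sum>a\<le>n. f (2 * a))"
proof -
  have "(\<Sum>j\<le>2 * n. f j) = (\<Sum>j\<in>(\<lambda>a. 2 * a) ` {..n}. f j)"
  proof (rule sum.mono_neutral_right)
    show "\<forall>i\<in>{..2 * n} - (\<lambda>a. 2 * a) ` {..n}. f i = 0"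
    proof
      fix i assume i: "i \<in> {..2 * n} - (\<lambda>a. 2 * a) ` {..n}"
      have "odd i"
      proof
        assume "even i"
        then obtain b where "i = 2 * b" by (rule evenE)
        thus False using i by auto
      qed
      thus "f i = 0" by (rule assms)
    qed
  qed auto
  also have "\<dots> = (\<Sum>a\<le>n. f (2 * a))" by (subst sum.reindex) (auto simp: inj_on_def)
  finally show ?thesis .
qed

text \<open>Dividing by (2n)! turns the binomial convolution into a product of series. The factor 2n
  + 2 counts the corners for the root leg and 2n + 1 the partners of the root dart; together they
  reduce 1/(2n+2)! to 1/(2n)!. Since root degrees are bounded by 2n, every admissible M gives the
  same sum.\<close>

lemma tutte_rec:
  assumes k: "k \<ge> 1" and M: "M \<ge> 2 * n + 2"
  shows "tutte (Suc n) k = (if k < 2 then 0 else \<Sum>a\<le>n. \<Sum>i\<le>k-2. tutte a i * tutte (n - a) (k - 2 - i))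
    + (\<Sum>j<M. zvar (Suc j) * tutte n (k + j - 1))"
proof -
  let ?N = "2 * n"
  let ?c = "\<lambda>j. if k < 2 then 0 else \<Sum>i\<le>k-2. planted_gf j i * planted_gf (?N - j) (k - 2 - i)"
  let ?z = "zconst (1 / fact ?N)"
  let ?B = "\<lambda>M. \<Sum>j<M. zvar (Suc j) * planted_gf ?N (k + j - 1)"
  have "2 * Suc n = Suc (Suc ?N)" by simp
  hence "planted_gf (2 * Suc n) k = of_nat (Suc (Suc ?N)) * (of_nat (Suc ?N) *
    ((\<Sum>j\<le>?N. of_nat (?N choose j) * ?c j) + ?B (Suc (Suc ?N))))"
    using planted_gf_rooted[of "2 * Suc n" k] rooted_gf_step[OF k, of ?N] by simp
  moreover have "zconst (1 / fact (2 * Suc n)) * of_nat (Suc (Suc ?N)) * of_nat (Suc ?N) = ?z"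
  proof -
    have "(1 / fact (2 * Suc n) :: rat) * of_nat (Suc (Suc ?N)) * of_nat (Suc ?N) = 1 / fact ?N"
    proof -
      have "(fact (2 * Suc n) :: rat) = of_nat (Suc (Suc ?N)) * (of_nat (Suc ?N) * fact ?N)"
        by (simp add: algebra_simps)
      thus ?thesis by (simp del: of_nat_Suc fact_Suc)
    qed
    thus ?thesis unfolding zconst_of_nat[symmetric] zconst_simps(4)[symmetric] by simp
  qed
  ultimately have "tutte (Suc n) k = ?z * ((\<Sum>j\<le>?N. of_nat (?N choose j) * ?c j) + ?B (Suc (Suc ?N)))"
    unfolding tutte_def by (metis (no_types, lifting) mult.assoc)
  also have "\<dots> = (\<Sum>j\<le>?N. ?z * of_nat (?N choose j) * ?c j) + ?z * ?B (Suc (Suc ?N))"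
    by (simp only: distrib_left sum_distrib_left mult.assoc)
  also have "(\<Sum>j\<le>?N. ?z * of_nat (?N choose j) * ?c j) = (\<Sum>a\<le>n. ?z * of_nat (?N choose (2 * a)) * ?c (2 * a))"
    by (rule sum_even_only) (simp add: planted_gf_odd)
  also have "\<dots> = (\<Sum>a\<le>n. if k < 2 then 0 else \<Sum>i\<le>k-2. tutte a i * tutte (n - a) (k - 2 - i))"
  proof (rule sum.cong[OF refl])
    fix a assume a: "a \<in> {..n}"
    have "(1 / fact ?N :: rat) * of_nat (?N choose (2 * a)) = 1 / fact (2 * a) * (1 / fact (2 * (n - a)))"
      using a by (simp add: binomial_fact diff_mult_distrib2)
    hence "?z * of_nat (?N choose (2 * a)) = zconst (1 / fact (2 * a)) * zconst (1 / fact (2 * (n - a)))"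
      unfolding zconst_of_nat[symmetric] zconst_simps(4)[symmetric] by simp
    moreover have "?N - 2 * a = 2 * (n - a)" by simp
    ultimately show "?z * of_nat (?N choose (2 * a)) * ?c (2 * a) =
      (if k < 2 then 0 else \<Sum>i\<le>k-2. tutte a i * tutte (n - a) (k - 2 - i))"
      by (simp add: tutte_def sum_distrib_left mult_ac)
  qed
  also have "?B (Suc (Suc ?N)) = ?B M"
    by (rule sum.mono_neutral_left) (use M k in \<open>auto simp: planted_gf_eq_0\<close>)
  also have "?z * ?B M = (\<Sum>j<M. zvar (Suc j) * tutte n (k + j - 1))"
    by (simp add: tutte_def sum_distrib_left mult_ac)
  finally show ?thesis by simp
qed

section \<open>Isomorphism classes of rooted maps\<close>

lemma cyc_fixfree_involution:
  assumes "finite D" "\<And>d. d \<in> D \<Longrightarrow> \<alpha> d \<in> D" "\<And>d. d \<in> D \<Longrightarrow> \<alpha> d \<noteq> d" "\<And>d. d \<in> D \<Longrightarrow> \<alpha> (\<alpha> d) = d"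
  shows "2 * cyc D \<alpha> = card D"
proof -
  have orb: "orbit \<alpha> d = {d, \<alpha> d}" if d: "d \<in> D" for d
  proof
    show "orbit \<alpha> d \<subseteq> {d, \<alpha> d}" by (rule orbit_subsetI) (use assms(4)[OF d] in auto)
    have "\<alpha> d \<in> orbit \<alpha> d" by (rule orbit.base)
    moreover from orbit.step[OF this] have "d \<in> orbit \<alpha> d" using assms(4)[OF d] by simp
    ultimately show "{d, \<alpha> d} \<subseteq> orbit \<alpha> d" by simp
  qed
  have un: "\<Union>(orbit \<alpha> ` D) = D" using orb assms(2) by auto
  have "2 * card (orbit \<alpha> ` D) = card (\<Union>(orbit \<alpha> ` D))"
  proof (rule card_partition)
    show "finite (orbit \<alpha> ` D)" "finite (\<Union>(orbit \<alpha> ` D))" using assms(1) un by auto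
    fix c assume "c \<in> orbit \<alpha> ` D"
    then obtain d where d: "d \<in> D" "c = {d, \<alpha> d}" using orb by auto
    thus "card c = 2" using assms(3)[OF d(1)] by simp
  next
    fix c1 c2 assume c: "c1 \<in> orbit \<alpha> ` D" "c2 \<in> orbit \<alpha> ` D" "c1 \<noteq> c2"
    then obtain d1 d2 where d: "d1 \<in> D" "c1 = {d1, \<alpha> d1}" "d2 \<in> D" "c2 = {d2, \<alpha> d2}" using orb by auto
    have e: "\<alpha> (\<alpha> d1) = d1" "\<alpha> (\<alpha> d2) = d2" using assms(4) d by auto
    show "c1 \<inter> c2 = {}"
    proof (rule ccontr)
      assume "c1 \<inter> c2 \<noteq> {}"
      then consider "d1 = d2" | "d1 = \<alpha> d2" | "\<alpha> d1 = d2" | "\<alpha> d1 = \<alpha> d2" unfolding d by blast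
      hence "{d1, \<alpha> d1} = {d2, \<alpha> d2}"
      proof cases
        case 4
        hence "d1 = d2" using e by metis
        thus ?thesis by simp
      qed (use e in auto)
      thus False using c(3) d by simp
    qed
  qed
  thus ?thesis unfolding cyc_def un by simp
qed

text \<open>Without legs \<open>card D\<close> is twice the number of edges, so vertices plus edges
  plus faces equal to \<open>card D + 2\<close> is Euler's relation.\<close>

lemma planar_map_iff_legged:
  assumes "finite D"
  shows "planar_map D \<sigma> \<alpha> \<longleftrightarrow> (\<sigma>, \<alpha>) \<in> legged D {}"
proof (cases "\<sigma> permutes D \<and> \<alpha> permutes D \<and> (\<forall>d\<in>D. \<alpha> d \<noteq> d \<and> \<alpha> (\<alpha> d) = d)")
  case True
  have im: "\<sigma> ` D \<subseteq> D" "\<alpha> ` D \<subseteq> D" using True by (simp_all add: permutes_image)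
  have inv: "\<alpha> \<circ> \<alpha> = id"
  proof
    fix x show "(\<alpha> \<circ> \<alpha>) x = id x" using True by (cases "x \<in> D") (auto simp: permutes_not_in)
  qed
  have c: "2 * cyc D \<alpha> = card D"
    using True im assms by (intro cyc_fixfree_involution) auto
  have "card (map_vertices D \<sigma>) + card (map_faces D \<sigma> \<alpha>) = card (map_edges D \<alpha>) + 2 \<longleftrightarrow>
      euler D \<sigma> \<alpha> = card D + 2"
    using c unfolding map_vertices_def map_faces_def map_edges_def euler_def cyc_def by linarith
  moreover have "{d \<in> D. \<alpha> d = d} = {}" using True by auto
  ultimately show ?thesis
    using True inv assms map_connected_iff_conn[OF im] by (simp add: planar_map_def legged_def)
next
  case False
  moreover have "\<forall>d\<in>D. \<alpha> d \<noteq> d \<and> \<alpha> (\<alpha> d) = d" if "(\<sigma>, \<alpha>) \<in> legged D {}"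
  proof
    fix d assume "d \<in> D"
    have "\<alpha> \<circ> \<alpha> = id" "{d \<in> D. \<alpha> d = d} = {}" using that by (auto simp: legged_def)
    thus "\<alpha> d \<noteq> d \<and> \<alpha> (\<alpha> d) = d" using \<open>d \<in> D\<close> by (metis (mono_tags, lifting) comp_apply empty_iff id_apply mem_Collect_eq)
  qed
  ultimately show ?thesis by (auto simp: planar_map_def legged_def)
qed

lemma labelled_rooted_maps_eq:
  "labelled_rooted_maps n = (\<lambda>(p, r). (fst p, snd p, r)) ` (legged {..<2 * n} {} \<times> {..<2 * n})"
  by (force simp: labelled_rooted_maps_def planar_map_iff_legged image_iff)

text \<open>In the full weight the root face, of degree j + 1, contributes the factor missing from
  \<open>inner_weight\<close>. The sum over all root darts is the one produced by hanging a root leg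
  in an arbitrary corner.\<close>

lemma sum_labelled_rooted_maps:
  "(\<Sum>m\<in>labelled_rooted_maps n. face_weight n m) = (\<Sum>j<2 * n. zvar (Suc j) * planted_gf (2 * n) (Suc j))"
proof (cases "n = 0")
  case True
  hence "labelled_rooted_maps n = {}" by (auto simp: labelled_rooted_maps_def)
  thus ?thesis using True by simp
next
  case False
  let ?D = "{..<2 * n}"
  let ?u = "\<lambda>p r j. zvar (Suc j) *
     (if card (orbit (face_perm p) r) = Suc j then inner_weight ?D (face_perm p) r else 0)"
  let ?w = "\<lambda>p r. \<Sum>j<2 * n. ?u p r j"
  have "(\<Sum>m\<in>labelled_rooted_maps n. face_weight n m) =
    (\<Sum>q\<in>legged ?D {} \<times> ?D. face_weight n (fst (fst q), snd (fst q), snd q))"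
    unfolding labelled_rooted_maps_eq
    by (subst sum.reindex) (auto simp: inj_on_def case_prod_unfold prod_eq_iff)
  also have "\<dots> = (\<Sum>q\<in>legged ?D {} \<times> ?D. ?w (fst q) (snd q))"
  proof (rule sum.cong[OF refl])
    fix q assume q: "q \<in> legged ?D {} \<times> ?D"
    obtain \<sigma> \<alpha> r where qe: "q = ((\<sigma>, \<alpha>), r)" by (metis surj_pair)
    have L: "(\<sigma>, \<alpha>) \<in> legged ?D {}" and r: "r \<in> ?D" using q qe by auto
    let ?f = "\<sigma> \<circ> \<alpha>"
    have fin: "finite ?D" by simp
    note P = legged_face_perm[OF L fin, unfolded face_perm_pair]
    note c = card_orbit_permutes[OF fin P(1) r]
    obtain j where j: "card (orbit ?f r) = Suc j" using c(3) by (metis gr0_conv_Suc)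
    have j2: "j < 2 * n" using c(4) j by simp
    have un: "orbit ?f ` ?D = insert (orbit ?f r) (orbit ?f ` (?D - orbit ?f r))"
    proof
      show "orbit ?f ` ?D \<subseteq> insert (orbit ?f r) (orbit ?f ` (?D - orbit ?f r))"
      proof
        fix z assume "z \<in> orbit ?f ` ?D"
        then obtain y where y: "y \<in> ?D" "z = orbit ?f y" by blast
        show "z \<in> insert (orbit ?f r) (orbit ?f ` (?D - orbit ?f r))"
        proof (cases "y \<in> orbit ?f r")
          case True
          hence "z = orbit ?f r" using orbit_eq_of_mem[OF P(2)] y(2) by simp
          thus ?thesis by blast
        next
          case False thus ?thesis using y by blast
        qed
      qed
      show "insert (orbit ?f r) (orbit ?f ` (?D - orbit ?f r)) \<subseteq> orbit ?f ` ?D" using r by blast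
    qed
    have nin: "orbit ?f r \<notin> orbit ?f ` (?D - orbit ?f r)"
    proof
      assume "orbit ?f r \<in> orbit ?f ` (?D - orbit ?f r)"
      then obtain y where y: "y \<notin> orbit ?f r" "orbit ?f r = orbit ?f y" by blast
      show False using y(1) unfolding y(2) using permutation_self_in_orbit[OF P(2)] by blast
    qed
    have "face_weight n (\<sigma>, \<alpha>, r) = zvar (Suc j) * inner_weight ?D ?f r"
      unfolding face_weight_def map_faces_def prod.case un inner_weight_def
      using nin j by (subst prod.insert) simp_all
    also have "\<dots> = ?w (\<sigma>, \<alpha>) r"
    proof -
      have "?w (\<sigma>, \<alpha>) r = (\<Sum>i<2 * n. if i = j then zvar (Suc j) * inner_weight ?D ?f r else 0)"
        by (rule sum.cong) (use j in auto)
      also have "\<dots> = zvar (Suc j) * inner_weight ?D ?f r" using j2 by simp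
      finally show ?thesis by simp
    qed
    finally show "face_weight n (fst (fst q), snd (fst q), snd q) = ?w (fst q) (snd q)"
      unfolding qe fst_conv snd_conv .
  qed
  also have "\<dots> = (\<Sum>p\<in>legged ?D {}. \<Sum>r\<in>?D. ?w p r)"
    by (rule trans[OF _ sum.cartesian_product[symmetric]]) (simp only: case_prod_unfold)
  also have "\<dots> = (\<Sum>p\<in>legged ?D {}. \<Sum>j<2 * n. \<Sum>r\<in>?D. ?u p r j)"
    by (rule sum.cong[OF refl], rule sum.swap)
  also have "\<dots> = (\<Sum>j<2 * n. \<Sum>p\<in>legged ?D {}. \<Sum>r\<in>?D. ?u p r j)"
    by (rule sum.swap)
  also have "\<dots> = (\<Sum>j<2 * n. zvar (Suc j) * planted_gf (2 * n) (Suc j))"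
  proof (rule sum.cong[OF refl])
    fix j
    have "(\<Sum>p\<in>legged ?D {}. \<Sum>r\<in>?D. ?u p r j)
      = zvar (Suc j) * (\<Sum>r\<in>?D. legged_gf ?D {} r (Suc j))"
      unfolding legged_gf_def sum_distrib_left by (rule sum.swap)
    also have "(\<Sum>r\<in>?D. legged_gf ?D {} r (Suc j)) = (\<Sum>r\<in>?D. rooted_gf (2 * n) (Suc j))"
      by (intro sum.cong refl rooted_gf_eq) auto
    also have "\<dots> = planted_gf (2 * n) (Suc j)"
      using planted_gf_rooted[of "2 * n" "Suc j"] False by simp
    finally show "(\<Sum>p\<in>legged ?D {}. \<Sum>r\<in>?D. ?u p r j)
      = zvar (Suc j) * planted_gf (2 * n) (Suc j)" .
  qed
  finally show ?thesis .
qed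

text \<open>Rigidity: two relabellings with the same result agree at the root, and the set where
  they agree is closed under \<sigma> and \<alpha>, hence everything. So the permutations of the
  labels correspond one to one to the elements of the class.\<close>

lemma iso_class_card:
  assumes m: "m \<in> labelled_rooted_maps n"
  shows "card (rooted_map_iso n `` {m}) = fact (2 * n)"
proof -
  let ?D = "{..<2 * n}"
  obtain \<sigma> \<alpha> r where me: "m = (\<sigma>, \<alpha>, r)" by (metis surj_pair)
  have L: "(\<sigma>, \<alpha>) \<in> legged ?D {}" and r: "r \<in> ?D"
    using m by (auto simp: me labelled_rooted_maps_def planar_map_iff_legged)
  let ?h = "\<lambda>\<pi>. (relabel \<pi> \<sigma>, relabel \<pi> \<alpha>, \<pi> r)"
  have "rooted_map_iso n `` {m} = ?h ` {\<pi>. \<pi> permutes ?D}"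
  proof
    show "rooted_map_iso n `` {m} \<subseteq> ?h ` {\<pi>. \<pi> permutes ?D}"
    proof
      fix m' assume "m' \<in> rooted_map_iso n `` {m}"
      then obtain \<sigma>' \<alpha>' \<pi> where m': "m' = (\<sigma>', \<alpha>', \<pi> r)" and \<pi>: "\<pi> permutes ?D"
        and c: "\<pi> \<circ> \<sigma> = \<sigma>' \<circ> \<pi>" "\<pi> \<circ> \<alpha> = \<alpha>' \<circ> \<pi>"
        by (auto simp: rooted_map_iso_def me)
      have "\<pi> \<circ> inv \<pi> = id" using \<pi> by (rule permutes_inv_o)
      hence "relabel \<pi> \<sigma> = \<sigma>'" "relabel \<pi> \<alpha> = \<alpha>'"
        unfolding relabel_def c by (simp_all add: comp_assoc)
      thus "m' \<in> ?h ` {\<pi>. \<pi> permutes ?D}" using m' \<pi> by blast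
    qed
    show "?h ` {\<pi>. \<pi> permutes ?D} \<subseteq> rooted_map_iso n `` {m}"
    proof
      fix m' assume "m' \<in> ?h ` {\<pi>. \<pi> permutes ?D}"
      then obtain \<pi> where \<pi>: "\<pi> permutes ?D" and m': "m' = ?h \<pi>" by blast
      have b: "bij \<pi>" using \<pi> by (rule permutes_bij)
      have "(relabel \<pi> \<sigma>, relabel \<pi> \<alpha>) \<in> legged ?D {}"
        using relabel_legged[OF b L] permutes_image[OF \<pi>] by (simp add: relabel_pair_def)
      moreover have "\<pi> r \<in> ?D" using r permutes_in_image[OF \<pi>] by simp
      ultimately have "m' \<in> labelled_rooted_maps n"
        by (simp add: m' labelled_rooted_maps_def planar_map_iff_legged)
      moreover have "\<pi> \<circ> f = relabel \<pi> f \<circ> \<pi>" for f using relabel_apply[OF b] by (simp add: fun_eq_iff)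
      ultimately have "(m, m') \<in> rooted_map_iso n"
        using m \<pi> unfolding rooted_map_iso_def me m' by blast
      thus "m' \<in> rooted_map_iso n `` {m}" by simp
    qed
  qed
  moreover have "inj_on ?h {\<pi>. \<pi> permutes ?D}"
  proof (rule inj_onI)
    fix \<pi> \<rho> assume p: "\<pi> \<in> {\<pi>. \<pi> permutes ?D}" "\<rho> \<in> {\<pi>. \<pi> permutes ?D}" and eq: "?h \<pi> = ?h \<rho>"
    have P: "\<pi> permutes ?D" "\<rho> permutes ?D" using p by auto
    have b: "bij \<pi>" "bij \<rho>" using P by (auto intro: permutes_bij)
    have c: "conn ?D \<sigma> \<alpha>" using L by (simp add: legged_def)
    have im: "\<sigma> permutes ?D" "\<alpha> permutes ?D" using L by (auto simp: legged_def)
    have "f x \<in> {y \<in> ?D. \<pi> y = \<rho> y}" if "relabel \<pi> f = relabel \<rho> f" "f permutes ?D" "x \<in> {y \<in> ?D. \<pi> y = \<rho> y}" for f x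
      using that relabel_apply[OF b(1), of f x] relabel_apply[OF b(2), of f x] permutes_in_image[OF that(2)] by auto
    hence "{y \<in> ?D. \<pi> y = \<rho> y} = ?D"
      using eq r im by (intro connD[OF c, of _ r]) auto
    hence "\<pi> y = \<rho> y" for y using P by (cases "y \<in> ?D") (auto simp: permutes_not_in)
    thus "\<pi> = \<rho>" by blast
  qed
  ultimately have "card (rooted_map_iso n `` {m}) = card {\<pi>. \<pi> permutes ?D}" by (simp add: card_image)
  thus ?thesis using card_permutations[of ?D "2 * n"] by simp
qed

text \<open>By \<open>face_weight_iso\<close> the weight is constant on a class, and by rigidity all
  classes have the same size.\<close>

lemma sum_labelled_eq_sum_classes:
  "(\<Sum>m\<in>labelled_rooted_maps n. face_weight n m) =
    of_nat (fact (2 * n)) * (\<Sum>M\<in>rooted_planar_maps n. the_elem (face_weight n ` M))"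
proof -
  let ?L = "labelled_rooted_maps n" and ?R = "rooted_map_iso n"
  note eqv = rooted_map_iso_equiv[of n]
  have finL: "finite ?L" unfolding labelled_rooted_maps_eq by (intro finite_imageI) (simp add: finite_legged)
  have un: "\<Union>(?L // ?R) = ?L" using Union_quotient[OF eqv] .
  have "(\<Sum>m\<in>?L. face_weight n m) = (\<Sum>m\<in>\<Union>(?L // ?R). face_weight n m)" unfolding un ..
  also have "\<dots> = (\<Sum>M\<in>?L // ?R. \<Sum>m\<in>M. face_weight n m)"
  proof (rule sum.Union_disjoint[unfolded comp_def])
    show "\<forall>M\<in>?L // ?R. finite M"
      using finL un by (metis Sup_upper finite_subset)
    show "\<forall>A\<in>?L // ?R. \<forall>B\<in>?L // ?R. A \<noteq> B \<longrightarrow> A \<inter> B = {}"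
      using quotient_disj[OF eqv] by blast
  qed
  also have "\<dots> = (\<Sum>M\<in>?L // ?R. of_nat (fact (2 * n)) * the_elem (face_weight n ` M))"
  proof (rule sum.cong[OF refl])
    fix M assume "M \<in> ?L // ?R"
    then obtain m where m: "m \<in> ?L" and M: "M = ?R `` {m}" by (auto elim: quotientE)
    have w: "face_weight n m' = face_weight n m" if "m' \<in> M" for m'
      using that face_weight_iso[of m m' n] by (simp add: M)
    have "m \<in> M" using eqv m unfolding M by (rule equiv_class_self)
    hence "face_weight n ` M = {face_weight n m}" using w by (metis (no_types, lifting) image_cong image_constant)
    moreover have "(\<Sum>m'\<in>M. face_weight n m') = of_nat (card M) * face_weight n m" using w by simp
    ultimately show "(\<Sum>m'\<in>M. face_weight n m') = of_nat (fact (2 * n)) * the_elem (face_weight n ` M)"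
      unfolding iso_class_card[OF m, folded M] by simp
  qed
  finally show ?thesis unfolding rooted_planar_maps_def sum_distrib_left .
qed

text \<open>For k = 2 the convolution reduces to W_0^2 and gives only the atomic map. In the other
  sum each \<open>tutte n (Suc j)\<close> receives the weight of its root face, which yields all
  maps with n edges.\<close>

lemma map_gf_tutte: "map_gf $ n = tutte (Suc n) 2"
proof -
  have c: "(\<Sum>M\<in>rooted_planar_maps n. the_elem (face_weight n ` M)) = (\<Sum>j<2 * n. zvar (Suc j) * tutte n (Suc j))"
  proof -
    have z: "zconst (1 / fact (2 * n)) * of_nat (fact (2 * n)) = 1"
      unfolding zconst_of_nat[symmetric] zconst_simps(4)[symmetric] by (simp add: zconst_simps)
    have "(\<Sum>M\<in>rooted_planar_maps n. the_elem (face_weight n ` M)) =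
      zconst (1 / fact (2 * n)) * (of_nat (fact (2 * n)) * (\<Sum>M\<in>rooted_planar_maps n. the_elem (face_weight n ` M)))"
      unfolding mult.assoc[symmetric] z by simp
    also have "\<dots> = zconst (1 / fact (2 * n)) * (\<Sum>j<2 * n. zvar (Suc j) * planted_gf (2 * n) (Suc j))"
      unfolding sum_labelled_eq_sum_classes[symmetric] sum_labelled_rooted_maps ..
    also have "\<dots> = (\<Sum>j<2 * n. zvar (Suc j) * tutte n (Suc j))"
      by (simp add: tutte_def sum_distrib_left mult_ac)
    finally show ?thesis .
  qed
  have "(\<Sum>a\<le>n. \<Sum>i\<le>2-2. tutte a i * tutte (n - a) (2 - 2 - i)) = (\<Sum>a\<le>n. tutte a 0 * tutte (n - a) 0)"
    by simp
  also have "\<dots> = (if n = 0 then 1 else 0)"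
  proof (cases "n = 0")
    case False
    have "tutte a 0 * tutte (n - a) 0 = 0" if "a \<le> n" for a
    proof (cases a)
      case 0
      obtain l where "n - a = Suc l" using False 0 by (cases n) auto
      thus ?thesis by (simp add: tutte_Suc_0)
    qed (simp add: tutte_Suc_0)
    hence "(\<Sum>a\<le>n. tutte a 0 * tutte (n - a) 0) = 0" by (intro sum.neutral) blast
    thus ?thesis using False by simp
  qed (simp add: tutte_0)
  finally have a: "(\<Sum>a\<le>n. \<Sum>i\<le>2-2. tutte a i * tutte (n - a) (2 - 2 - i)) = (if n = 0 then 1 else 0)" .
  have "(\<Sum>j<2*n+2. zvar (Suc j) * tutte n (2 + j - 1)) = (\<Sum>j<2*n. zvar (Suc j) * tutte n (Suc j))"
    by (rule sum.mono_neutral_cong_right) (auto simp: tutte_eq_0)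
  hence "tutte (Suc n) 2 = (if n = 0 then 1 else 0) + (\<Sum>j<2*n. zvar (Suc j) * tutte n (Suc j))"
    using tutte_rec[of 2 n "2*n+2"] a by simp
  thus ?thesis unfolding map_gf_def using c by simp
qed

section \<open>Series in \<open>t\<close> over Laurent series in \<open>x = 1/u\<close>\<close>

text \<open>
  Elements of \<^typ>\<open>'a fls fps\<close> are power series in \<open>t\<close> whose coefficients are Laurent series in \<open>x\<close>, so
  that both \<open>\<Sum> z\<^sub>i x\<^sup>i\<^sup>-\<^sup>1\<close> and \<open>R\<^sup>-\<^sup>1\<^sup>/\<^sup>2\<close> with \<open>u = 1/x\<close> exist there.
\<close>

definition xcoeff :: "int \<Rightarrow> 'a::comm_ring_1 fls fps \<Rightarrow> 'a fps" where
  "xcoeff m F = Abs_fps (\<lambda>n. fls_nth (F $ n) m)"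

definition lift_t :: "'a::comm_ring_1 fps \<Rightarrow> 'a fls fps" where
  "lift_t a = Abs_fps (\<lambda>n. fls_const (a $ n))"

definition x_var :: "'a::comm_ring_1 fls fps" where "x_var = fps_const fls_X"
definition x_inv :: "'a::comm_ring_1 fls fps" where "x_inv = fps_const fls_X_inv"

lemma xcoeff_nth [simp]: "xcoeff m F $ n = fls_nth (F $ n) m"
  by (simp add: xcoeff_def)

lemma xcoeff_eqI: "(\<And>m. xcoeff m F = xcoeff m G) \<Longrightarrow> F = G"
proof (rule fps_ext, rule fls_eqI)
  fix n m assume "\<And>m. xcoeff m F = xcoeff m G"
  hence "xcoeff m F $ n = xcoeff m G $ n" by simp
  thus "fls_nth (F $ n) m = fls_nth (G $ n) m" by simp
qed

lemma xcoeff_arith [simp]: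
  "xcoeff m (F + G) = xcoeff m F + xcoeff m G" "xcoeff m (F - G) = xcoeff m F - xcoeff m G"
  "xcoeff m (- F) = - xcoeff m F" "xcoeff m 0 = 0" "xcoeff m 1 = (if m = 0 then 1 else 0)"
  by (auto intro!: fps_ext)

lemma fls_sum_nth: "fls_nth (\<Sum>i\<in>A. f i) m = (\<Sum>i\<in>A. fls_nth (f i) m)"
  by (induction A rule: infinite_finite_induct) auto

lemma xcoeff_lift_mult [simp]: "xcoeff m (lift_t a * F) = a * xcoeff m F"
  by (rule fps_ext) (simp add: fps_mult_nth lift_t_def fls_sum_nth)

lemma xcoeff_x_var_mult [simp]: "xcoeff m (x_var * F) = xcoeff (m - 1) F"
  by (rule fps_ext) (simp add: x_var_def fls_X_times_conv_shift)

lemma xcoeff_x_inv_mult [simp]: "xcoeff m (x_inv * F) = xcoeff (m + 1) F"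
  by (rule fps_ext) (simp add: x_inv_def fls_X_inv_times_conv_shift)

lemma xcoeff_lift [simp]: "xcoeff m (lift_t a) = (if m = 0 then a else 0)"
  by (rule fps_ext) (simp add: lift_t_def)

lemma xcoeff_x_var [simp]: "xcoeff m x_var = (if m = 1 then 1 else 0)"
  using xcoeff_x_var_mult[of m 1] by simp

lemma xcoeff_x_inv [simp]: "xcoeff m x_inv = (if m = - 1 then 1 else 0)"
  using xcoeff_x_inv_mult[of m 1] by (simp add: eq_neg_iff_add_eq_0)

lemma x_var_x_inv: "x_var * x_inv = 1"
  by (rule xcoeff_eqI) auto

lemma lift_t_arith: "lift_t (a + b) = lift_t a + lift_t b" "lift_t (a - b) = lift_t a - lift_t b"
  "lift_t (- a) = - lift_t a" "lift_t (a * b) = lift_t a * lift_t b" "lift_t 1 = 1" "lift_t 0 = 0"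
  by (auto intro!: xcoeff_eqI)

lemma lift_t_X: "lift_t fps_X = fps_X"
  by (rule fps_ext) (simp add: lift_t_def fps_X_def)

lemma xcoeff_deriv: "xcoeff m (fps_deriv F) = fps_deriv (xcoeff m F)"
  by (rule fps_ext) (simp add: fls_of_nat flip: of_nat_Suc)

section \<open>Series without negative powers of x, and series in 1/x\<close>

definition x_regular :: "'a::comm_ring_1 fls fps \<Rightarrow> bool" where
  "x_regular F \<longleftrightarrow> (\<forall>m<0. xcoeff m F = 0)"

lemma x_regular_iff: "x_regular F \<longleftrightarrow> (\<forall>n. \<forall>m<0. fls_nth (F $ n) m = 0)"
  unfolding x_regular_def by (auto simp: fps_eq_iff)

lemma x_regular_arith: "x_regular F \<Longrightarrow> x_regular G \<Longrightarrow> x_regular (F + G)"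
  "x_regular F \<Longrightarrow> x_regular G \<Longrightarrow> x_regular (F - G)" "x_regular (lift_t a)" "x_regular x_var"
  by (auto simp: x_regular_def)

lemma x_regular_mult:
  assumes "x_regular F" "x_regular G"
  shows "x_regular (F * G)"
  unfolding x_regular_iff
proof (intro allI impI)
  fix n and m :: int assume m: "m < 0"
  have "fls_nth (f * g) m = 0" if "\<forall>m<0. fls_nth f m = 0" "\<forall>m<0. fls_nth g m = 0" for f g :: "'a fls"
    unfolding fls_times_nth(2)
  proof (rule sum.neutral, rule ballI)
    fix i show "fls_nth f i * fls_nth g (m - i) = 0" using that m by (cases "i < 0") auto
  qed
  thus "fls_nth ((F * G) $ n) m = 0"
    using assms m unfolding x_regular_iff fps_mult_nth fls_sum_nth by (intro sum.neutral) auto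
qed

lemma x_regular_deriv: "x_regular F \<Longrightarrow> x_regular (fps_deriv F)"
  by (auto simp: x_regular_def xcoeff_deriv)

text \<open>\<open>F\<close> is the series \<open>f\<close> in \<open>u\<close> (outer variable) and \<open>t\<close> after the substitution \<open>u = 1/x\<close>.\<close>

definition x_tail :: "'a::comm_ring_1 fls fps \<Rightarrow> 'a fps fps \<Rightarrow> bool" where
  "x_tail F f \<longleftrightarrow> (\<forall>k. xcoeff (- int k) F = f $ k) \<and> (\<forall>m>0. xcoeff m F = 0)"

lemma x_tail_unique: "x_tail F f \<Longrightarrow> x_tail G f \<Longrightarrow> F = G"
proof (rule xcoeff_eqI)
  fix m assume F: "x_tail F f" and G: "x_tail G f"
  show "xcoeff m F = xcoeff m G"
  proof (cases "m > 0")
    case False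
    hence "m = - int (nat (- m))" by simp
    thus ?thesis using F G unfolding x_tail_def by metis
  qed (use F G in \<open>simp add: x_tail_def\<close>)
qed

lemma fls_nth_mult_nonpos:
  fixes f g :: "'a::comm_ring_1 fls"
  assumes f: "\<And>m. m > 0 \<Longrightarrow> fls_nth f m = 0" and g: "\<And>m. m > 0 \<Longrightarrow> fls_nth g m = 0"
  shows "fls_nth (f * g) (- int k) = (\<Sum>i\<le>k. fls_nth f (- int i) * fls_nth g (- int (k - i)))"
    and "m > 0 \<Longrightarrow> fls_nth (f * g) m = 0"
proof -
  let ?h = "\<lambda>m i. fls_nth f i * fls_nth g (m - i)"
  let ?I = "{fls_subdegree f.. - int k - fls_subdegree g}"
  have "fls_nth (f * g) (- int k) = (\<Sum>i\<in>?I. ?h (- int k) i)" by (rule fls_times_nth(2))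
  also have "\<dots> = (\<Sum>i\<in>?I \<inter> {- int k..0}. ?h (- int k) i)"
    by (rule sum.mono_neutral_right) (auto simp: f g not_le)
  also have "\<dots> = (\<Sum>i\<in>{- int k..0}. ?h (- int k) i)"
  proof (rule sum.mono_neutral_left)
    show "\<forall>i\<in>{- int k..0} - ?I \<inter> {- int k..0}. ?h (- int k) i = 0"
    proof
      fix i assume i: "i \<in> {- int k..0} - ?I \<inter> {- int k..0}"
      hence "i < fls_subdegree f \<or> - int k - i < fls_subdegree g" by auto
      thus "?h (- int k) i = 0" by auto
    qed
  qed auto
  also have "\<dots> = (\<Sum>i\<le>k. fls_nth f (- int i) * fls_nth g (- int (k - i)))"
    by (rule sum.reindex_bij_witness[of _ "\<lambda>i. - int i" "\<lambda>i. nat (- i)"]) (auto simp: of_nat_diff)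
  finally show "fls_nth (f * g) (- int k) = (\<Sum>i\<le>k. fls_nth f (- int i) * fls_nth g (- int (k - i)))" .
  assume m: "m > 0"
  show "fls_nth (f * g) m = 0" unfolding fls_times_nth(2)
  proof (rule sum.neutral, rule ballI)
    fix i show "?h m i = 0" using f[of i] g[of "m - i"] m by (cases "i > 0") auto
  qed
qed

text \<open>The substitution u = 1/x respects products, which transfers identities such as R^(-1/2)
  R^(-1/2) R = 1 from series in u.\<close>

lemma x_tail_mult:
  assumes F: "x_tail F f" and G: "x_tail G g"
  shows "x_tail (F * G) (f * g)"
proof -
  have F0: "m > 0 \<Longrightarrow> fls_nth (F $ a) m = 0" and G0: "m > 0 \<Longrightarrow> fls_nth (G $ a) m = 0" for m a
    using F G unfolding x_tail_def by (metis xcoeff_nth fps_zero_nth)+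
  have Fk: "fls_nth (F $ a) (- int k) = f $ k $ a"
    and Gk: "fls_nth (G $ a) (- int k) = g $ k $ a" for a k
    using F G unfolding x_tail_def by (metis xcoeff_nth)+
  show ?thesis unfolding x_tail_def
  proof (intro conjI allI impI)
    fix k
    show "xcoeff (- int k) (F * G) = (f * g) $ k"
    proof (rule fps_ext)
      fix n
      have "xcoeff (- int k) (F * G) $ n = (\<Sum>a=0..n. \<Sum>i\<le>k. f $ i $ a * g $ (k - i) $ (n - a))"
        by (simp only: xcoeff_nth fps_mult_nth fls_sum_nth fls_nth_mult_nonpos(1)[OF F0 G0] Fk Gk)
      also have "\<dots> = (\<Sum>i\<le>k. \<Sum>a=0..n. f $ i $ a * g $ (k - i) $ (n - a))"
        by (rule sum.swap)
      also have "\<dots> = (f * g) $ k $ n"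
        by (simp add: fps_mult_nth fps_sum_nth atMost_atLeast0)
      finally show "xcoeff (- int k) (F * G) $ n = (f * g) $ k $ n" .
    qed
  next
    fix m :: int assume m: "m > 0"
    show "xcoeff m (F * G) = 0"
      by (rule fps_ext) (simp add: fps_mult_nth fls_sum_nth fls_nth_mult_nonpos(2)[OF F0 G0 m])
  qed
qed

lemma x_tail_1: "x_tail 1 1"
  by (auto simp: x_tail_def)

lemma x_tail_lift_mult: "x_tail F f \<Longrightarrow> x_tail (lift_t a * F) (fps_const a * f)"
  by (simp add: x_tail_def)

text \<open>A Laurent series in x is bounded below, so each power of t may come with only finitely
  many powers of u.\<close>

lemma x_tail_exists:
  assumes "\<And>k n. k > N n \<Longrightarrow> f $ k $ n = 0"
  shows "\<exists>F. x_tail F f"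
proof -
  define F where "F = Abs_fps (\<lambda>n. Abs_fls (\<lambda>m. if m \<le> 0 then f $ nat (- m) $ n else 0))"
  have F: "fls_nth (F $ n) m = (if m \<le> 0 then f $ nat (- m) $ n else 0)" for n m
    unfolding F_def fps_nth_Abs_fps
  proof (rule nth_Abs_fls_lower_bound[of "- int (N n)"], intro allI impI)
    fix m :: int assume "m < - int (N n)"
    thus "(if m \<le> 0 then f $ nat (- m) $ n else 0) = 0" using assms[of n "nat (- m)"] by auto
  qed
  have "x_tail F f" unfolding x_tail_def by (auto intro!: fps_ext simp: F)
  thus ?thesis ..
qed

text \<open>This is \<open>u \<beta>\<close> in the notation of the theorem.\<close>

definition z_series :: "zpoly fls fps" where
  "z_series = fps_const (fps_to_fls (Abs_fps (\<lambda>j. zvar (Suc j))))"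

lemma x_regular_z_series: "x_regular z_series"
  by (auto simp: x_regular_iff z_series_def)

text \<open>The series of the z_i is unbounded in x, but at t^n the other factor has no powers of x
  below -(k + M); this makes the coefficient a finite sum.\<close>

lemma z_series_mult_nth:
  assumes F: "\<And>m. m < - int (k + M) \<Longrightarrow> fls_nth (F $ n) m = 0" and M: "M \<le> M'"
  shows "xcoeff (- int k) (z_series * F) $ n = (\<Sum>j<Suc M'. zvar (Suc j) * fls_nth (F $ n) (- int (k + j)))"
proof -
  let ?z = "fps_to_fls (Abs_fps (\<lambda>j. zvar (Suc j)))" and ?f = "F $ n"
  let ?h = "\<lambda>i. fls_nth ?z i * fls_nth ?f (- int k - i)"
  let ?I = "{fls_subdegree ?z.. - int k - fls_subdegree ?f}"
  have "xcoeff (- int k) (z_series * F) $ n = (\<Sum>i\<in>?I. ?h i)"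
    by (simp add: z_series_def fls_times_nth(2))
  also have "\<dots> = (\<Sum>i\<in>?I \<inter> {0..int M'}. ?h i)"
  proof (rule sum.mono_neutral_right)
    show "\<forall>i\<in>?I - ?I \<inter> {0..int M'}. ?h i = 0"
    proof
      fix i assume "i \<in> ?I - ?I \<inter> {0..int M'}"
      hence "i < 0 \<or> - int k - i < - int (k + M)" using M by auto
      thus "?h i = 0" using F by auto
    qed
  qed auto
  also have "\<dots> = (\<Sum>i\<in>{0..int M'}. ?h i)"
  proof (rule sum.mono_neutral_left)
    show "\<forall>i\<in>{0..int M'} - ?I \<inter> {0..int M'}. ?h i = 0"
    proof
      fix i assume i: "i \<in> {0..int M'} - ?I \<inter> {0..int M'}"
      hence "i < fls_subdegree ?z \<or> - int k - i < fls_subdegree ?f" by auto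
      hence "fls_nth ?z i = 0 \<or> fls_nth ?f (- int k - i) = 0"
        using fls_eq0_below_subdegree by blast
      thus "?h i = 0" by (metis mult_zero_left mult_zero_right)
    qed
  qed auto
  also have "\<dots> = (\<Sum>j<Suc M'. zvar (Suc j) * fls_nth ?f (- int (k + j)))"
    by (rule sum.reindex_bij_witness[of _ int nat]) auto
  finally show ?thesis .
qed

lemma zsum_nth:
  assumes "\<And>n m. m > N n \<Longrightarrow> a m $ n = 0"
  shows "zsum a $ n = (\<Sum>k<N n. zvar (Suc k) * a (Suc k) $ n)"
proof -
  let ?f = "\<lambda>k. fps_const (zvar (Suc k)) * a (Suc k)"
  define L where "L = Abs_fps (\<lambda>n. (\<Sum>k<N n. ?f k) $ n)"
  have "?f sums L" unfolding sums_def
  proof (rule tendsto_fpsI)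
    fix n
    have "(\<Sum>k<K. ?f k) $ n = L $ n" if "K \<ge> N n" for K
    proof -
      have "(\<Sum>k<K. ?f k $ n) = (\<Sum>k<N n. ?f k $ n)"
        using that by (intro sum.mono_neutral_right) (auto simp: assms)
      thus ?thesis by (simp add: L_def fps_sum_nth)
    qed
    thus "\<forall>\<^sub>F K in sequentially. (\<Sum>k<K. ?f k) $ n = L $ n"
      by (auto simp: eventually_sequentially)
  qed
  hence "zsum a = L" unfolding zsum_def by (rule sums_unique[symmetric])
  thus ?thesis by (simp add: L_def fps_sum_nth)
qed

section \<open>The solution of Tutte's recursion\<close>

definition half :: "zpoly fps" where "half = fps_const (zconst (1 / 2))"

lemma half_plus_half: "half + half = 1"
proof -
  have "zconst (1/2) + zconst (1/2) = 1" unfolding zconst_simps(3)[symmetric] by (simp add: zconst_simps)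
  thus ?thesis unfolding half_def fps_const_add by simp
qed

lemma half_mult_two: "half * (2 * x) = x"
proof -
  have "half * (2 * x) = (half + half) * x" by (simp add: algebra_simps)
  thus ?thesis by (simp add: half_plus_half)
qed

text \<open>The coefficients form only a ring, so a factor 2 is cancelled by multiplying with
  \<open>half\<close>.\<close>

lemma two_cancel: "2 * x = 2 * y \<Longrightarrow> x = (y :: zpoly fps)"
  by (metis half_mult_two)

section \<open>Low-order coefficients of the square roots\<close>

lemma fps_mult_nth_small:
  fixes f g :: "'a::comm_ring_1 fps"
  shows "(f * g) $ 2 = f $ 0 * g $ 2 + f $ 1 * g $ 1 + f $ 2 * g $ 0"
    "(f * g) $ 3 = f $ 0 * g $ 3 + f $ 1 * g $ 2 + f $ 2 * g $ 1 + f $ 3 * g $ 0"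
    "(f * g) $ 4 = f $ 0 * g $ 4 + f $ 1 * g $ 3 + f $ 2 * g $ 2 + f $ 3 * g $ 1 + f $ 4 * g $ 0"
  by (simp_all add: fps_mult_nth eval_nat_numeral)

lemma R_series_nth:
  "R_series R1 R2 $ k = (if k = 0 then 1 else if k = 1 then - 4 * R1 else if k = 2 then - 4 * R2 else 0)"
proof -
  have "R_series R1 R2 = 1 - fps_X * fps_const (4 * R1) - fps_X ^ 2 * fps_const (4 * R2)"
    by (simp add: R_series_def numeral_fps_const mult_ac flip: fps_const_mult)
  moreover have "(fps_X ^ 2 * fps_const (4 * R2)) $ k = (if k = 2 then 4 * R2 else 0)"
    by (simp add: fps_X_power_mult_nth)
  moreover have "(fps_X * fps_const (4 * R1)) $ k = (if k = 1 then 4 * R1 else 0)" by simp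
  ultimately show ?thesis by simp
qed

text \<open>Comparing coefficients of rt^2 = R determines them one by one. Order 4 suffices:
  \<open>rt $ 3\<close> and \<open>rt $ 4\<close> give the first formula, and W_2 involves R^(-1/2)
  up to order 4.\<close>

lemma sqrt_R_series_nth:
  assumes sq: "rt * rt = R_series R1 R2" and rt0: "rt $ 0 = 1"
  shows "rt $ 1 = - 2 * R1" "rt $ 2 = - 2 * R2 - 2 * R1\<^sup>2"
    "rt $ 3 = - 4 * R1 * R2 - 4 * R1 ^ 3"
    "rt $ 4 = - 2 * R2\<^sup>2 - 12 * R1\<^sup>2 * R2 - 10 * R1 ^ 4"
proof -
  have e: "(rt * rt) $ k = R_series R1 R2 $ k" for k by (simp add: sq)
  show 1: "rt $ 1 = - 2 * R1"
  proof (rule two_cancel)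
    show "2 * rt $ 1 = 2 * (- 2 * R1)"
      using e[of 1] rt0 by (simp add: fps_mult_nth_1 R_series_nth)
  qed
  show 2: "rt $ 2 = - 2 * R2 - 2 * R1\<^sup>2"
  proof (rule two_cancel)
    have "2 * rt $ 2 + rt $ 1 * rt $ 1 = - 4 * R2"
      using e[of 2] rt0 by (simp add: fps_mult_nth_small R_series_nth)
    thus "2 * rt $ 2 = 2 * (- 2 * R2 - 2 * R1\<^sup>2)" unfolding 1 by algebra
  qed
  show 3: "rt $ 3 = - 4 * R1 * R2 - 4 * R1 ^ 3"
  proof (rule two_cancel)
    have "2 * rt $ 3 + 2 * rt $ 1 * rt $ 2 = 0"
      using e[of 3] rt0 by (simp add: fps_mult_nth_small R_series_nth algebra_simps)
    thus "2 * rt $ 3 = 2 * (- 4 * R1 * R2 - 4 * R1 ^ 3)" unfolding 1 2 by algebra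
  qed
  show "rt $ 4 = - 2 * R2\<^sup>2 - 12 * R1\<^sup>2 * R2 - 10 * R1 ^ 4"
  proof (rule two_cancel)
    have "2 * rt $ 4 + 2 * rt $ 1 * rt $ 3 + rt $ 2 * rt $ 2 = 0"
      using e[of 4] rt0 by (simp add: fps_mult_nth_small R_series_nth algebra_simps)
    thus "2 * rt $ 4 = 2 * (- 2 * R2\<^sup>2 - 12 * R1\<^sup>2 * R2 - 10 * R1 ^ 4)" unfolding 1 2 3 by algebra
  qed
qed

lemma inv_sqrt_R_series_nth:
  assumes sq: "rt * rt = R_series R1 R2" and rt0: "rt $ 0 = 1" and inv: "S * rt = 1"
  shows "S $ 0 = 1" "S $ 1 = 2 * R1" "S $ 2 = 2 * R2 + 6 * R1\<^sup>2"
    "S $ 3 = 12 * R1 * R2 + 20 * R1 ^ 3"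
    "S $ 4 = 6 * R2\<^sup>2 + 60 * R1\<^sup>2 * R2 + 70 * R1 ^ 4"
proof -
  note rt = sqrt_R_series_nth[OF sq rt0]
  have e: "(S * rt) $ k = 1 $ k" for k by (simp add: inv)
  show 0: "S $ 0 = 1" using e[of 0] rt0 by simp
  have "rt $ 1 + S $ 1 = 0" using e[of 1] rt0 0 by (simp add: fps_mult_nth_1)
  thus 1: "S $ 1 = 2 * R1" unfolding rt by algebra
  have "rt $ 2 + S $ 1 * rt $ 1 + S $ 2 = 0"
    using e[of 2] rt0 0 by (simp add: fps_mult_nth_small)
  thus 2: "S $ 2 = 2 * R2 + 6 * R1\<^sup>2" unfolding rt 1 by algebra
  have "rt $ 3 + S $ 1 * rt $ 2 + S $ 2 * rt $ 1 + S $ 3 = 0"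
    using e[of 3] rt0 0 by (simp add: fps_mult_nth_small)
  thus 3: "S $ 3 = 12 * R1 * R2 + 20 * R1 ^ 3" unfolding rt 1 2 by algebra
  have "rt $ 4 + S $ 1 * rt $ 3 + S $ 2 * rt $ 2 + S $ 3 * rt $ 1 + S $ 4 = 0"
    using e[of 4] rt0 0 by (simp add: fps_mult_nth_small)
  thus "S $ 4 = 6 * R2\<^sup>2 + 60 * R1\<^sup>2 * R2 + 70 * R1 ^ 4" unfolding rt 1 2 3 by algebra
qed

lemma x_regular_part:
  fixes F :: "'a::comm_ring_1 fls fps"
  obtains M where "x_regular M" "\<And>m. m \<ge> 0 \<Longrightarrow> xcoeff m M = xcoeff m F"
proof -
  define M where "M = Abs_fps (\<lambda>n. Abs_fls (\<lambda>m. if m \<ge> 0 then fls_nth (F $ n) m else 0))"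
  have M: "fls_nth (M $ n) m = (if m \<ge> 0 then fls_nth (F $ n) m else 0)" for n m
    unfolding M_def fps_nth_Abs_fps by (rule nth_Abs_fls_lower_bound[of 0]) auto
  show thesis
    by (rule that[of M]) (auto simp: x_regular_iff M intro!: fps_ext)
qed

lemma zsum_cong: "(\<And>i. i \<ge> 1 \<Longrightarrow> a i = b i) \<Longrightarrow> zsum a = zsum b"
  unfolding zsum_def by simp

lemma R_system_nth_0:
  assumes "R_system R1 R2"
  shows "R1 $ 0 = 0" "R2 $ 0 = 0"
proof -
  have e: "R1 = half_t * zsum (\<lambda>i. inv_sqrt_fps (R_series R1 R2) $ (i - 1))"
     "R2 = fps_X - 3 * R1 ^ 2 + half_t * zsum (\<lambda>i. inv_sqrt_fps (R_series R1 R2) $ i)"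
    using assms unfolding R_system_def Let_def by blast+
  show 1: "R1 $ 0 = 0" by (subst e(1)) (simp add: half_t_def)
  show "R2 $ 0 = 0"
    by (subst e(2)) (simp add: half_t_def 1 power2_eq_square)
qed

lemma half_t_eq: "half_t = half * fps_X"
  by (simp add: half_t_def half_def)

text \<open>y collects the coefficients of x Y, so \<open>y $ k\<close> will be t W_k and
  \<open>y $ 2\<close> will be F = t^2 G. The last claim is the first formula in these terms,
  because t F' - F = t^2 (t G)'.\<close>

lemma one_cut_solution:
  assumes sys: "R_system R1 R2"
  obtains Y :: "zpoly fls fps" and y :: "zpoly fps fps" where
    "x_tail (x_var * Y) y" "y $ 0 = fps_X" "x_regular (Y * Y - (x_var - fps_X * z_series) * Y)"
    "y $ 2 = (R2 + R1\<^sup>2) * (3 * R2 + 15 * R1\<^sup>2 - 2 * fps_X)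
       + fps_X * (R1 * beta_coeff 1 R1 R2 - half * beta_coeff 2 R1 R2)"
    "fps_X * fps_deriv (y $ 2) - y $ 2 = (R2 + R1\<^sup>2) * (R2 + 9 * R1\<^sup>2)"
proof -
  define S where "S = inv_sqrt_fps (R_series R1 R2)"
  define Rs where "Rs = R_series R1 R2"
  define rt where "rt = S * Rs"
  note z = R_system_nth_0[OF sys]
  have "R_series R1 R2 $ 0 = 1" by (simp add: R_series_nth)
  from inv_sqrt_fps_square[OF this] have SS: "S * S * Rs = 1" and S0: "S $ 0 = 1"
    by (simp_all add: S_def Rs_def power2_eq_square)
  have rt2: "rt * rt = R_series R1 R2"
  proof -
    have "rt * rt = (S * S * Rs) * Rs" by (simp add: rt_def mult_ac)
    thus ?thesis unfolding SS by (simp add: Rs_def)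
  qed
  have Srt: "S * rt = 1" using SS by (simp add: rt_def mult_ac)
  have rt0: "rt $ 0 = 1" by (simp add: rt_def S0 Rs_def R_series_nth)
  note rtn = sqrt_R_series_nth[OF rt2 rt0] and Sn = inv_sqrt_R_series_nth[OF rt2 rt0 Srt]
  have Sz: "S $ m $ n = 0" if "m > 2 * n" for m n
    unfolding S_def by (rule inv_sqrt_R_series_nth_eq_0[OF z that])
  \<comment> \<open>At u = 1/x, \<open>TT\<close>, \<open>RB\<close> and \<open>RT\<close> stand for
    R^(-1/2), R and R^(1/2).\<close>
  obtain TT where TT: "x_tail TT S" using x_tail_exists[of "\<lambda>n. 2 * n" S] Sz by blast
  obtain RB where RB: "x_tail RB Rs" using x_tail_exists[of "\<lambda>n. 2" Rs] by (auto simp: Rs_def R_series_nth)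
  have TTRB: "TT * TT * RB = 1"
  proof (rule x_tail_unique[OF _ x_tail_1])
    have "x_tail (TT * TT * RB) (S * S * Rs)" by (intro x_tail_mult TT RB)
    thus "x_tail (TT * TT * RB) 1" unfolding SS .
  qed
  define RT where "RT = TT * RB"
  have RT: "x_tail RT rt" unfolding RT_def rt_def by (rule x_tail_mult[OF TT RB])
  define Q where "Q = x_var * RT"
  \<comment> \<open>This is the quadratic x^2 - 4 R_1 x - 4 R_2.\<close>
  define \<Delta> where "\<Delta> = x_var * (x_var * RB)"
  have QQ: "Q * Q = \<Delta>"
  proof -
    have "Q * Q = x_var * (x_var * ((TT * TT * RB) * RB))" by (simp add: Q_def RT_def mult_ac)
    thus ?thesis by (simp add: TTRB \<Delta>_def)
  qed
  have \<Delta>: "x_regular \<Delta>" unfolding x_regular_def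
  proof (intro allI impI)
    fix m :: int assume m: "m < 0"
    define l where "l = nat (2 - m)"
    have l: "l > 2" "m - 2 = - int l" using m by (simp_all add: l_def)
    have "xcoeff m \<Delta> = xcoeff (m - 2) RB" by (simp add: \<Delta>_def)
    also have "\<dots> = Rs $ l" unfolding l(2) using RB unfolding x_tail_def by blast
    also have "\<dots> = 0" using l(1) by (simp add: Rs_def R_series_nth)
    finally show "xcoeff m \<Delta> = 0" .
  qed
  define V where "V = x_var - fps_X * z_series"
  have nonV: "x_regular V" unfolding V_def lift_t_X[symmetric]
    by (intro x_regular_arith x_regular_mult x_regular_z_series)
  \<comment> \<open>This is V / Q, since 1 / Q is x^-1 R^(-1/2).\<close>
  define P where "P = V * TT * x_inv"
  have PQ: "P * Q = V"
  proof -
    have "P * Q = V * (x_var * x_inv) * (TT * TT * RB)" by (simp add: P_def Q_def RT_def mult_ac)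
    thus ?thesis by (simp add: TTRB x_var_x_inv)
  qed
  obtain M where M: "x_regular M" "\<And>m. m \<ge> 0 \<Longrightarrow> xcoeff m M = xcoeff m P" using x_regular_part[of P] by blast
  define N where "N = P - M"
  have N: "xcoeff m N = (if m < 0 then xcoeff m P else 0)" for m
    using M unfolding N_def x_regular_def by simp
  \<comment> \<open>\<open>b k\<close> is the coefficient of u^(k-1) in \<beta> R^(-1/2): the
    indices 0 and 1 occur in the system, and 2 and 3 are \<open>beta_coeff 1\<close> and
    \<open>beta_coeff 2\<close>.\<close>
  define b where "b k = zsum (\<lambda>i. S $ (k + (i - 1)))" for k
  have zT: "xcoeff (- int k) (z_series * TT) = b k" for k
  proof (rule fps_ext)
    fix n
    have T: "fls_nth (TT $ n) m = (if m > 0 then 0 else S $ nat (- m) $ n)" for m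
    proof (cases "m > 0")
      case True
      hence "xcoeff m TT = 0" using TT unfolding x_tail_def by blast
      thus ?thesis using True by (metis xcoeff_nth fps_zero_nth)
    next
      case False
      hence "xcoeff m TT = S $ nat (- m)" using TT unfolding x_tail_def by (metis int_nat_eq minus_minus neg_le_0_iff_le not_le)
      thus ?thesis using False by (metis xcoeff_nth)
    qed
    have "xcoeff (- int k) (z_series * TT) $ n = (\<Sum>j<Suc (2 * n). zvar (Suc j) * fls_nth (TT $ n) (- int (k + j)))"
      by (rule z_series_mult_nth[where M = "2 * n"]) (auto simp: T Sz)
    also have "\<dots> = (\<Sum>j<Suc (2 * n). zvar (Suc j) * S $ (k + j) $ n)"
      by (simp add: T del: of_nat_add)
    also have "\<dots> = b k $ n" unfolding b_def
      by (subst zsum_nth[where N = "\<lambda>n. Suc (2 * n)"]) (auto simp: Sz)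
    finally show "xcoeff (- int k) (z_series * TT) $ n = b k $ n" .
  qed
  have Pk: "xcoeff (- int k - 1) P = S $ Suc k - fps_X * b k" for k
  proof -
    have "P = x_inv * (x_var * TT - lift_t fps_X * (z_series * TT))" by (simp add: P_def V_def lift_t_X algebra_simps)
    moreover have "xcoeff (- int k - 1) TT = S $ Suc k"
    proof -
      have "- int k - 1 = - int (Suc k)" by simp
      thus ?thesis using TT unfolding x_tail_def by metis
    qed
    ultimately show ?thesis using zT[of k] by simp
  qed
  have e1: "R1 = half_t * b 0" and e2: "R2 = fps_X - 3 * R1 ^ 2 + half_t * b 1"
  proof -
    have "zsum (\<lambda>i. S $ i) = b 1" unfolding b_def by (rule zsum_cong) simp
    moreover have "zsum (\<lambda>i. S $ (i - 1)) = b 0" by (simp add: b_def)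
    ultimately show "R1 = half_t * b 0" "R2 = fps_X - 3 * R1 ^ 2 + half_t * b 1"
      using sys unfolding R_system_def Let_def S_def[symmetric] by simp_all
  qed
  have tb: "2 * (half_t * x) = fps_X * x" for x
    using half_mult_two[of "fps_X * x"] by (simp add: half_t_eq algebra_simps)
  \<comment> \<open>\<open>n0\<close> and \<open>n1\<close> are the coefficients of x^-1 and x^-2 in
    V / Q. In the second, twice the 3 R_1^2 of the system cancels the 6 R_1^2 of
    \<open>S $ 2\<close>.\<close>
  have n0: "S $ Suc 0 - fps_X * b 0 = 0"
    using arg_cong[OF e1, of "\<lambda>x. 2 * x"] Sn(2) unfolding tb by simp
  have n1: "S $ Suc 1 - fps_X * b 1 = 2 * fps_X"
  proof -
    have "2 * (half_t * b 1) = 2 * (R2 - fps_X + 3 * R1\<^sup>2)" using e2 by (simp add: algebra_simps)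
    hence "fps_X * b 1 = 2 * (R2 - fps_X + 3 * R1\<^sup>2)" unfolding tb .
    thus ?thesis using Sn(3) by (simp add: numeral_2_eq_2[symmetric] algebra_simps)
  qed
  have b1: "b 2 = beta_coeff 1 R1 R2" and b2: "b 3 = beta_coeff 2 R1 R2"
    unfolding b_def beta_coeff_def S_def by (auto intro!: zsum_cong arg_cong[where f = "fps_nth _"])
  \<comment> \<open>This is x^2 N as a series in u: by \<open>n0\<close> there is no term x^-1 in N,
    and by \<open>n1\<close> the leading coefficient is 2 t.\<close>
  define \<nu> where "\<nu> = Abs_fps (\<lambda>k. S $ Suc (Suc k) - fps_X * b (Suc k))"
  have \<nu>: "x_tail (x_var * (x_var * N)) \<nu>" unfolding x_tail_def
  proof (intro conjI allI impI)
    fix k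
    have "xcoeff (- int k) (x_var * (x_var * N)) = xcoeff (- int (Suc k) - 1) N" by simp
    also have "\<dots> = \<nu> $ k" using Pk[of "Suc k"] unfolding N by (simp add: \<nu>_def)
    finally show "xcoeff (- int k) (x_var * (x_var * N)) = \<nu> $ k" .
  next
    fix m :: int assume m: "m > 0"
    have "xcoeff (- 1) N = 0" using Pk[of 0] n0 unfolding N by simp
    moreover have "xcoeff (m - 2) N = 0" if "m \<noteq> 1" using that m unfolding N by simp
    ultimately show "xcoeff m (x_var * (x_var * N)) = 0" by (cases "m = 1") simp_all
  qed
  define lh where "lh = lift_t half"
  have lh: "lh + lh = 1" unfolding lh_def lift_t_arith(1)[symmetric] half_plus_half by (simp add: lift_t_arith)
  define Y where "Y = lh * (N * Q)"
  define y where "y = fps_const half * (\<nu> * rt)"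
  have XY: "x_var * Y = lh * ((x_var * (x_var * N)) * RT)" by (simp add: Y_def Q_def mult_ac)
  have y: "x_tail (x_var * Y) y" unfolding XY y_def lh_def by (intro x_tail_lift_mult x_tail_mult \<nu> RT)
  have YY: "Y + Y = V - M * Q"
  proof -
    have "Y + Y = (lh + lh) * (N * Q)" by (simp add: Y_def algebra_simps)
    thus ?thesis unfolding lh N_def using PQ by (simp add: algebra_simps)
  qed
  have Yh: "Y = lh * (V - M * Q)"
  proof -
    have "lh * (Y + Y) = (lh + lh) * Y" by (simp only: distrib_left distrib_right)
    thus ?thesis unfolding YY lh by simp
  qed
  have nonlh: "x_regular lh" unfolding lh_def by (rule x_regular_arith(3))
  have quad: "Y * Y - V * Y = lh * lh * (M * M * \<Delta> - V * V)"
  proof -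
    have "V * Y = (lh + lh) * (V * Y)" by (simp add: lh)
    also have "\<dots> = (lh + lh) * (V * (lh * (V - M * Q)))" unfolding Yh[symmetric] ..
    also have "\<dots> = lh * lh * (2 * V * (V - M * Q))" by algebra
    finally have "V * Y = lh * lh * (2 * V * (V - M * Q))" .
    moreover have "Y * Y = lh * lh * ((V - M * Q) * (V - M * Q))" unfolding Yh by (simp only: mult_ac)
    ultimately have "Y * Y - V * Y = lh * lh * ((V - M * Q) * (V - M * Q) - 2 * V * (V - M * Q))"
      by algebra
    also have "(V - M * Q) * (V - M * Q) - 2 * V * (V - M * Q) = M * M * (Q * Q) - V * V"
      by algebra
    finally show ?thesis unfolding QQ .
  qed
  have nonq: "x_regular (Y * Y - V * Y)"
    unfolding quad by (intro x_regular_arith x_regular_mult nonlh M \<Delta> nonV)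
  have yn: "y $ k = half * (\<nu> * rt) $ k" for k by (simp add: y_def)
  have \<nu>n: "\<nu> $ 0 = 2 * fps_X" "\<nu> $ 1 = 12 * R1 * R2 + 20 * R1 ^ 3 - fps_X * beta_coeff 1 R1 R2"
    "\<nu> $ 2 = 6 * R2\<^sup>2 + 60 * R1\<^sup>2 * R2 + 70 * R1 ^ 4 - fps_X * beta_coeff 2 R1 R2"
    using n1 Sn(4,5) b1 b2 unfolding \<nu>_def by (simp_all add: eval_nat_numeral)
  have y0: "y $ 0 = fps_X" unfolding yn using half_mult_two[of fps_X] by (simp add: \<nu>n rt0)
  have y2: "y $ 2 = (R2 + R1\<^sup>2) * (3 * R2 + 15 * R1\<^sup>2 - 2 * fps_X)
       + fps_X * (R1 * beta_coeff 1 R1 R2 - half * beta_coeff 2 R1 R2)"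
  proof -
    let ?Z = "(R2 + R1\<^sup>2) * (3 * R2 + 15 * R1\<^sup>2 - 2 * fps_X) + fps_X * (R1 * beta_coeff 1 R1 R2)"
    have "(\<nu> * rt) $ 2 = 2 * ?Z - fps_X * beta_coeff 2 R1 R2"
      unfolding fps_mult_nth_small(1) \<nu>n rtn rt0
      by (simp add: algebra_simps power2_eq_square power3_eq_cube power4_eq_xxxx)
    hence "y $ 2 = half * (2 * ?Z) - half * (fps_X * beta_coeff 2 R1 R2)"
      unfolding yn by (simp only: right_diff_distrib)
    thus ?thesis unfolding half_mult_two by (simp only: right_diff_distrib add_diff_eq mult.left_commute)
  qed
  \<comment> \<open>The operator t d/dt - 1 removes the z_i from V, where they occur with exactly
    one factor t.\<close>
  define E where "E = fps_X * fps_deriv Y - Y"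
  define e where "e = Abs_fps (\<lambda>k. fps_X * fps_deriv (y $ k) - y $ k)"
  have DX: "fps_deriv (x_var :: zpoly fls fps) = 0" "fps_deriv z_series = 0" by (simp_all add: x_var_def z_series_def)
  have XE: "x_var * E = lift_t fps_X * fps_deriv (x_var * Y) - x_var * Y"
    using DX by (simp add: E_def lift_t_X algebra_simps)
  have e_rep: "x_tail (x_var * E) e"
    unfolding XE x_tail_def xcoeff_arith xcoeff_lift_mult xcoeff_deriv
    using y unfolding x_tail_def by (simp add: e_def del: xcoeff_x_var_mult)
  have "x_regular (Q * (x_var + (E + E)))"
  proof -
    have "x_var + (E + E) = (V - fps_X * fps_deriv V) + (fps_X * fps_deriv (Y + Y) - (Y + Y))"
    proof -
      have "fps_deriv V = - z_series" unfolding V_def fps_deriv_sub fps_deriv_mult DX by simp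
      hence "V - fps_X * fps_deriv V = x_var" by (simp add: V_def)
      thus ?thesis by (simp add: E_def algebra_simps)
    qed
    also have "\<dots> = M * Q - fps_X * fps_deriv (M * Q)"
      unfolding YY by (simp add: algebra_simps)
    finally have XE2: "x_var + (E + E) = M * Q - fps_X * fps_deriv (M * Q)" .
    \<comment> \<open>After multiplication by Q, the square root occurs only in Q^2 = \<Delta> and Q
      Q' = \<Delta>' / 2, which have no negative powers of x.\<close>
    have "Q * (x_var + (E + E)) = M * (Q * Q) - fps_X * (fps_deriv M * (Q * Q)) - fps_X * M * (Q * fps_deriv Q)"
      unfolding XE2 by (simp add: algebra_simps)
    moreover have "Q * fps_deriv Q = lh * fps_deriv \<Delta>"
    proof -
      have "fps_deriv \<Delta> = Q * fps_deriv Q + Q * fps_deriv Q" unfolding QQ[symmetric] by (simp add: mult.commute)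
      hence "lh * fps_deriv \<Delta> = (lh + lh) * (Q * fps_deriv Q)" by (simp add: algebra_simps)
      thus ?thesis by (simp add: lh)
    qed
    ultimately have "Q * (x_var + (E + E)) = M * \<Delta> - lift_t fps_X * (fps_deriv M * \<Delta>) - lift_t fps_X * M * (lh * fps_deriv \<Delta>)"
      by (simp add: QQ lift_t_X)
    thus ?thesis by (simp only:) (intro x_regular_arith x_regular_mult x_regular_deriv nonlh M \<Delta>)
  qed
  moreover have "Q * (x_var + (E + E)) = x_var * (x_var * RT) + (RT * (x_var * E) + RT * (x_var * E))"
    by (simp add: Q_def algebra_simps)
  ultimately have nn: "x_regular (x_var * (x_var * RT) + (RT * (x_var * E) + RT * (x_var * E)))" by simp
  have RTE: "x_tail (RT * (x_var * E)) (rt * e)" by (rule x_tail_mult[OF RT e_rep])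
  \<comment> \<open>The coefficient of x^-k in Q (x + 2 E). The shift l = k + 2 comes from Q x = x^2
    R^(1/2).\<close>
  have key: "rt $ l + 2 * (rt * e) $ k = 0" if "k \<ge> 1" "l = k + 2" for k l
  proof -
    have "xcoeff (- int k) (x_var * (x_var * RT) + (RT * (x_var * E) + RT * (x_var * E))) = 0"
      by (rule nn[unfolded x_regular_def, rule_format]) (use that in simp)
    moreover have "xcoeff (- int k) (x_var * (x_var * RT)) = rt $ l"
    proof -
      have "- int k - 1 - 1 = - int l" using that by simp
      thus ?thesis using RT unfolding x_tail_def xcoeff_x_var_mult by metis
    qed
    moreover have "xcoeff (- int k) (RT * (x_var * E)) = (rt * e) $ k" using RTE unfolding x_tail_def by blast
    ultimately show ?thesis by (simp only: xcoeff_arith mult_2)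
  qed
  \<comment> \<open>The leading coefficient t of x Y is annihilated by t d/dt - 1; hence k = 1 and k
    = 2 determine \<open>e $ 1\<close> and \<open>e $ 2\<close>.\<close>
  have e0: "e $ 0 = 0" by (simp add: e_def y0)
  have k1: "rt $ 3 + 2 * e $ 1 = 0"
    using key[of 1 3] by (simp add: fps_mult_nth_1 e0 rt0)
  have k2: "rt $ 4 + 2 * (e $ 2 + rt $ 1 * e $ 1) = 0"
    using key[of 2 4] by (simp add: fps_mult_nth_small e0 rt0)
  have "e $ 2 = (R2 + R1\<^sup>2) * (R2 + 9 * R1\<^sup>2)"
  proof (rule two_cancel)
    show "2 * e $ 2 = 2 * ((R2 + R1\<^sup>2) * (R2 + 9 * R1\<^sup>2))"
      using k1 k2 unfolding rtn by algebra
  qed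
  hence e2: "fps_X * fps_deriv (y $ 2) - y $ 2 = (R2 + R1\<^sup>2) * (R2 + 9 * R1\<^sup>2)"
    by (simp add: e_def)
  show thesis by (rule that[OF y y0 nonq[unfolded V_def] y2 e2])
qed

section \<open>Existence and uniqueness of \<open>R\<^sub>1\<close> and \<open>R\<^sub>2\<close>\<close>

definition agree :: "nat \<Rightarrow> 'a::zero fps \<Rightarrow> 'a fps \<Rightarrow> bool" where
  "agree n a b \<longleftrightarrow> (\<forall>i<n. a $ i = b $ i)"

lemma agree_refl: "agree n a a" by (simp add: agree_def)

lemma agree_mult:
  fixes a b :: "'a::comm_ring_1 fps"
  shows "agree n a a' \<Longrightarrow> agree n b b' \<Longrightarrow> agree n (a * b) (a' * b')"
  unfolding agree_def fps_mult_nth by (auto intro!: sum.cong)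

lemma agree_arith:
  fixes a b :: "'a::comm_ring_1 fps"
  shows "agree n a a' \<Longrightarrow> agree n b b' \<Longrightarrow> agree n (a + b) (a' + b')"
    "agree n a a' \<Longrightarrow> agree n b b' \<Longrightarrow> agree n (a - b) (a' - b')"
  by (simp_all add: agree_def)

lemma agree_sum:
  fixes f :: "'b \<Rightarrow> 'a::comm_ring_1 fps"
  shows "(\<And>i. i \<in> A \<Longrightarrow> agree n (f i) (g i)) \<Longrightarrow> agree n (sum f A) (sum g A)"
  unfolding agree_def by (simp add: fps_sum_nth)

lemma agree_half_t: "agree n a b \<Longrightarrow> agree (Suc n) (half_t * a) (half_t * b)"
  unfolding agree_def half_t_def by (auto simp: mult.assoc)

text \<open>The coefficient of t^n in a^2 involves that of a only next to the vanishing constant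
  term. This gains a power of t for the term 3 R_1^2 of the system, which has no factor t.\<close>

lemma agree_square:
  fixes a :: "'a::comm_ring_1 fps"
  assumes "agree n a b" "a $ 0 = 0" "b $ 0 = 0"
  shows "agree (Suc n) (a\<^sup>2) (b\<^sup>2)"
  unfolding agree_def power2_eq_square fps_mult_nth
proof (intro allI impI sum.cong refl)
  fix i j assume i: "i < Suc n" and j: "j \<in> {0..i}"
  consider "j = 0" | "j = i" | "j < n" "i - j < n" using i j by force
  thus "a $ j * a $ (i - j) = b $ j * b $ (i - j)"
    by cases (use assms in \<open>auto simp: agree_def\<close>)
qed

text \<open>Each coefficient in u is a polynomial in R_1 and R_2, so congruence modulo t^n is
  inherited.\<close>

lemma agree_inv_sqrt_R_series:
  assumes "agree n R1 R1'" "agree n R2 R2'"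
  shows "agree n (inv_sqrt_fps (R_series R1 R2) $ m) (inv_sqrt_fps (R_series R1' R2') $ m)"
proof -
  have 1: "agree n ((R_series R1 R2 - 1) $ k) ((R_series R1' R2' - 1) $ k)" for k
  proof -
    have "agree n (- 4 * R1) (- 4 * R1')" "agree n (- 4 * R2) (- 4 * R2')"
      using assms by (intro agree_mult agree_refl; simp)+
    thus ?thesis by (simp add: R_series_nth agree_refl)
  qed
  have "agree n (((R_series R1 R2 - 1) ^ i) $ k) (((R_series R1' R2' - 1) ^ i) $ k)" for i k
  proof (induction i arbitrary: k)
    case (Suc i)
    show ?case unfolding power_Suc fps_mult_nth by (intro agree_sum agree_mult 1 Suc)
  qed (simp add: agree_refl)
  thus ?thesis unfolding inv_sqrt_fps_def fps_compose_nth
    by (intro agree_sum agree_mult agree_refl)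
qed

definition R_step :: "zpoly fps \<times> zpoly fps \<Rightarrow> zpoly fps \<times> zpoly fps" where
  "R_step p = (let S = inv_sqrt_fps (R_series (fst p) (snd p)) in
     (half_t * zsum (\<lambda>i. S $ (i - 1)), fps_X - 3 * fst p ^ 2 + half_t * zsum (\<lambda>i. S $ i)))"

definition zero_const :: "zpoly fps \<times> zpoly fps \<Rightarrow> bool" where
  "zero_const p \<longleftrightarrow> fst p $ 0 = 0 \<and> snd p $ 0 = 0"

text \<open>The equations force zero constant terms; conversely, zero constant terms make the sums
  over i converge, as the system demands.\<close>

lemma R_system_iff: "R_system R1 R2 \<longleftrightarrow> zero_const (R1, R2) \<and> R_step (R1, R2) = (R1, R2)"
proof
  assume sys: "R_system R1 R2"
  show "zero_const (R1, R2) \<and> R_step (R1, R2) = (R1, R2)"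
    using R_system_nth_0[OF sys] sys unfolding R_system_def R_step_def zero_const_def Let_def by simp
next
  assume a: "zero_const (R1, R2) \<and> R_step (R1, R2) = (R1, R2)"
  hence "R1 $ 0 = 0" "R2 $ 0 = 0" by (simp_all add: zero_const_def)
  from zsummable_inv_sqrt[OF this] zsummable_inv_sqrt(2)[OF this, of 0]
  show "R_system R1 R2" using a unfolding R_system_def R_step_def Let_def by simp
qed

lemma zero_const_R_step: "zero_const p \<Longrightarrow> zero_const (R_step p)"
  by (simp add: zero_const_def R_step_def Let_def half_t_def power2_eq_square)

definition agree_pair where
  "agree_pair n p q \<longleftrightarrow> agree n (fst p) (fst q) \<and> agree n (snd p) (snd q)"

text \<open>The sums carry a factor t, and the square of R_1 gains a power of t by
  \<open>agree_square\<close>. So two fixed points agree to all orders, and iteration converges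
  t-adically.\<close>

lemma R_step_contracts:
  assumes p: "zero_const p" "zero_const q" and a: "agree_pair n p q"
  shows "agree_pair (Suc n) (R_step p) (R_step q)"
proof -
  let ?S = "\<lambda>p. inv_sqrt_fps (R_series (fst p) (snd p))"
  have z: "?S r $ m $ k = 0" if "zero_const r" "m > 2 * k" for r m k
    using that by (intro inv_sqrt_R_series_nth_eq_0) (auto simp: zero_const_def)
  have S: "agree n (?S p $ m) (?S q $ m)" for m
    using a by (intro agree_inv_sqrt_R_series) (auto simp: agree_pair_def)
  have zs: "agree n (zsum f) (zsum g)"
    if "\<And>i. agree n (f i) (g i)" "\<And>k m. m > 2 * k + 1 \<Longrightarrow> f m $ k = 0" "\<And>k m. m > 2 * k + 1 \<Longrightarrow> g m $ k = 0" for f g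
    unfolding agree_def
    using that(1) zsum_nth[where N = "\<lambda>k. 2 * k + 1" and a = f, OF that(2)] zsum_nth[where N = "\<lambda>k. 2 * k + 1" and a = g, OF that(3)]
    by (simp add: agree_def)
  have "agree n (zsum (\<lambda>i. ?S p $ (i - 1))) (zsum (\<lambda>i. ?S q $ (i - 1)))"
    by (rule zs) (use S z p in auto)
  moreover have "agree n (zsum (\<lambda>i. ?S p $ i)) (zsum (\<lambda>i. ?S q $ i))"
    by (rule zs) (use S z p in auto)
  moreover have "agree (Suc n) (3 * (fst p)\<^sup>2) (3 * (fst q)\<^sup>2)"
    using a p by (intro agree_mult agree_refl agree_square) (auto simp: agree_pair_def zero_const_def)
  ultimately show ?thesis
    unfolding agree_pair_def R_step_def Let_def fst_conv snd_conv
    by (intro conjI agree_half_t agree_arith agree_refl)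
qed

lemma agree_pair_all: "(\<And>n. agree_pair n p q) \<Longrightarrow> p = q"
  by (auto simp: agree_pair_def agree_def prod_eq_iff fps_eq_iff)

lemma R_system_unique:
  assumes "R_system R1 R2" "R_system R1' R2'"
  shows "(R1, R2) = (R1', R2')"
proof (rule agree_pair_all)
  fix n
  have p: "zero_const (R1, R2)" "R_step (R1, R2) = (R1, R2)" "zero_const (R1', R2')" "R_step (R1', R2') = (R1', R2')"
    using assms by (simp_all add: R_system_iff)
  show "agree_pair n (R1, R2) (R1', R2')"
  proof (induction n)
    case (Suc n)
    show ?case using R_step_contracts[OF p(1,3) Suc] p by simp
  qed (simp add: agree_pair_def agree_def)
qed

lemma R_system_exists: "\<exists>R1 R2. R_system R1 R2"
proof -
  define x where "x k = (R_step ^^ k) (0, 0)" for k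
  have x0: "zero_const (x k)" for k
    by (induction k) (auto simp: x_def zero_const_def[of "(0, 0)"] intro: zero_const_R_step)
  have step: "agree_pair k (x k) (x (Suc k))" for k
  proof (induction k)
    case (Suc k)
    show ?case using R_step_contracts[OF x0 x0 Suc] by (simp add: x_def)
  qed (simp add: agree_pair_def agree_def)
  have mono: "agree_pair k (x k) (x (k + j))" for k j
  proof (induction j)
    case (Suc j)
    have "agree_pair k (x (k + j)) (x (Suc (k + j)))" using step[of "k + j"] by (auto simp: agree_pair_def agree_def)
    with Suc show ?case by (auto simp: agree_pair_def agree_def)
  qed (simp add: agree_pair_def agree_def)
  \<comment> \<open>The coefficient of t^n no longer changes from the iterate n + 1 on.\<close>
  define L where "L = (Abs_fps (\<lambda>n. fst (x (Suc n)) $ n), Abs_fps (\<lambda>n. snd (x (Suc n)) $ n))"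
  have L: "agree_pair k (x k) L" for k
  proof -
    have "fst (x k) $ i = fst (x (Suc i)) $ i \<and> snd (x k) $ i = snd (x (Suc i)) $ i" if "i < k" for i
      using mono[of "Suc i" "k - Suc i"] that by (auto simp: agree_pair_def agree_def)
    thus ?thesis by (auto simp: L_def agree_pair_def agree_def)
  qed
  have L0: "zero_const L" using x0[of "Suc 0"] by (simp add: L_def zero_const_def)
  have "R_step L = L"
  proof (rule agree_pair_all)
    fix n
    have "agree_pair (Suc n) (x (Suc n)) (R_step L)"
      using R_step_contracts[OF x0 L0 L[of n]] by (simp add: x_def)
    with L[of "Suc n"] show "agree_pair n (R_step L) L" by (auto simp: agree_pair_def agree_def)
  qed
  with L0 have "R_system (fst L) (snd L)" by (simp add: R_system_iff)
  thus ?thesis by blast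
qed

section \<open>Conclusion\<close>

text \<open>For k at least 1, the vanishing coefficient of x^-k in the quadratic expression is
  Tutte's recursion for \<open>y $ k\<close>; \<open>y $ 0\<close> is given. On its right-hand side
  the coefficient of t^n only needs lower powers of t: the sum with the z_i has a factor t, and in
  the products both factors are divisible by t.\<close>

lemma tutte_recursion_unique:
  fixes Y :: "zpoly fls fps" and y :: "zpoly fps fps"
  assumes rep: "x_tail (x_var * Y) y" and y0: "y $ 0 = fps_X"
    and q: "x_regular (Y * Y - (x_var - fps_X * z_series) * Y)"
  shows "y $ k $ n = (case n of 0 \<Rightarrow> 0 | Suc n' \<Rightarrow> tutte n' k)"
proof -
  have Yk: "xcoeff (- int (Suc k)) Y = y $ k" for k
  proof -
    have "xcoeff (- int k) (x_var * Y) = y $ k" using rep unfolding x_tail_def by blast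
    moreover have "xcoeff (- int k) (x_var * Y) = xcoeff (- int k - 1) Y" by simp
    moreover have "- int k - 1 = - int (Suc k)" by simp
    ultimately show ?thesis by metis
  qed
  have YY: "xcoeff (- int k) (Y * Y) = (if k < 2 then 0 else (y * y) $ (k - 2))" if "k \<ge> 1" for k
  proof -
    have r: "x_tail ((x_var * Y) * (x_var * Y)) (y * y)" by (rule x_tail_mult[OF rep rep])
    have e: "xcoeff (m + 2) ((x_var * Y) * (x_var * Y)) = xcoeff m (Y * Y)" for m
    proof -
      have "(x_var * Y) * (x_var * Y) = x_var * (x_var * (Y * Y))" by (simp add: mult_ac)
      thus ?thesis by (simp only: xcoeff_x_var_mult) simp
    qed
    show ?thesis
    proof (cases "k < 2")
      case True
      hence "- int k + 2 > 0" using that by simp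
      thus ?thesis using r e[of "- int k"] True unfolding x_tail_def by metis
    next
      case False
      hence "- int k + 2 = - int (k - 2)" by simp
      thus ?thesis using r e[of "- int k"] False unfolding x_tail_def by metis
    qed
  qed
  have rec: "y $ k = (if k < 2 then 0 else (y * y) $ (k - 2)) + fps_X * xcoeff (- int k) (z_series * Y)"
    if k: "k \<ge> 1" for k
  proof -
    have 1: "xcoeff (- int k) (Y * Y) - xcoeff (- int k) ((x_var - fps_X * z_series) * Y) = 0"
      using q k unfolding x_regular_def xcoeff_arith(2)[symmetric] by simp
    have e: "(x_var - fps_X * z_series) * Y = x_var * Y - lift_t fps_X * (z_series * Y)"
      by (simp add: lift_t_X algebra_simps)
    have "xcoeff (- int k) (x_var * Y) = y $ k" using rep unfolding x_tail_def by blast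
    hence 2: "xcoeff (- int k) ((x_var - fps_X * z_series) * Y) = y $ k - fps_X * xcoeff (- int k) (z_series * Y)"
      unfolding e by (simp only: xcoeff_arith xcoeff_lift_mult)
    have "p - q = 0 \<Longrightarrow> q = r - w \<Longrightarrow> r = p + w" for p q r w :: "zpoly fps" by simp
    from this[OF 1 2] show ?thesis unfolding YY[OF k] .
  qed
  show ?thesis
  proof (induction n arbitrary: k rule: less_induct)
    case (less n)
    define c where "c k n = (case n of 0 \<Rightarrow> 0 | Suc n' \<Rightarrow> tutte n' k)" for k n
    have IH: "y $ k $ n' = c k n'" if "n' < n" for k n' using less[OF that] by (simp add: c_def)
    have zs: "xcoeff (- int k) (z_series * Y) $ n' = (\<Sum>j<2 * n' + 2. zvar (Suc j) * c (k + j - 1) n')"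
      if n': "n' < n" and k: "k \<ge> 1" for k n'
    proof -
      have Y1: "fls_nth (Y $ n') (- int (Suc l)) = c l n'" for l
        using Yk[of l] IH[OF n', of l] by (metis xcoeff_nth)
      have c0: "c l n' = 0" if "l > 2 * n'" for l using that by (cases n') (auto simp: c_def tutte_eq_0)
      have "xcoeff (- int k) (z_series * Y) $ n' =
        (\<Sum>j<Suc (2 * n' + 1). zvar (Suc j) * fls_nth (Y $ n') (- int (k + j)))"
      proof (rule z_series_mult_nth[where M = "2 * n' + 1"])
        fix m :: int assume m: "m < - int (k + (2 * n' + 1))"
        define l where "l = nat (- m) - 1"
        have l: "m = - int (Suc l)" "l > 2 * n'" using m k by (auto simp: l_def)
        show "fls_nth (Y $ n') m = 0" unfolding l(1) Y1 by (rule c0[OF l(2)])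
      qed simp
      also have "\<dots> = (\<Sum>j<Suc (2 * n' + 1). zvar (Suc j) * c (k + j - 1) n')"
      proof (rule sum.cong[OF refl])
        fix j
        have "k + j = Suc (k + j - 1)" using k by simp
        thus "zvar (Suc j) * fls_nth (Y $ n') (- int (k + j)) = zvar (Suc j) * c (k + j - 1) n'"
          using Y1[of "k + j - 1"] by simp
      qed
      finally show ?thesis by simp
    qed
    \<comment> \<open>At t^0 the convolution involves the same power of t on both sides, so the
      vanishing needs its own induction, on the index i.\<close>
    have zero: "y $ i $ 0 = 0" for i
    proof (induction i rule: less_induct)
      case (less i)
      show ?case
      proof (cases "i = 0")
        case True thus ?thesis by (simp add: y0)
      next
        case False
        have "(y * y) $ (i - 2) $ 0 = 0" if "i \<ge> 2"
          using less that by (simp add: fps_mult_nth fps_sum_nth)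
        thus ?thesis using rec[of i] False by simp
      qed
    qed
    show ?case
    proof (cases n)
      case 0
      thus ?thesis using zero by simp
    next
      case n: (Suc n1)
      show ?thesis
      proof (cases "k = 0")
        case True
        thus ?thesis using n by (cases n1) (auto simp: y0 tutte_0 tutte_Suc_0 fps_X_def)
      next
        case False
        hence k: "k \<ge> 1" by simp
        have "(y * y) $ (k - 2) $ Suc n1 = (\<Sum>i\<le>k-2. \<Sum>a=0..Suc n1. y $ i $ a * y $ (k - 2 - i) $ (Suc n1 - a))"
          by (simp only: fps_mult_nth fps_sum_nth atMost_atLeast0)
        also have "\<dots> = (\<Sum>i\<le>k-2. \<Sum>a<n1. tutte a i * tutte (n1 - 1 - a) (k - 2 - i))"
        proof (rule sum.cong[OF refl])
          fix i
          let ?f = "\<lambda>a. y $ i $ a * y $ (k - 2 - i) $ (Suc n1 - a)"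
          \<comment> \<open>By \<open>zero\<close> both extreme terms vanish. As y is t W, the
            products carry t^2, whence \<open>n1 - 1\<close> in what remains.\<close>
          have "(\<Sum>a=0..Suc n1. ?f a) = (\<Sum>a\<in>Suc ` {..<n1}. ?f a)"
          proof (rule sum.mono_neutral_right)
            show "\<forall>a\<in>{0..Suc n1} - Suc ` {..<n1}. ?f a = 0"
            proof
              fix a assume a: "a \<in> {0..Suc n1} - Suc ` {..<n1}"
              have "a = 0 \<or> a = Suc n1"
              proof (cases a)
                case (Suc b)
                hence "\<not> b < n1" "b \<le> n1" using a by auto
                thus ?thesis using Suc by simp
              qed simp
              thus "?f a = 0" using zero by auto
            qed
          qed auto
          also have "\<dots> = (\<Sum>a<n1. ?f (Suc a))" by (subst sum.reindex) auto
          also have "\<dots> = (\<Sum>a<n1. tutte a i * tutte (n1 - 1 - a) (k - 2 - i))"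
          proof (rule sum.cong[OF refl])
            fix a assume a: "a \<in> {..<n1}"
            hence "Suc n1 - Suc a = Suc (n1 - 1 - a)" "Suc a < n" "Suc (n1 - 1 - a) < n" using n by auto
            thus "?f (Suc a) = tutte a i * tutte (n1 - 1 - a) (k - 2 - i)"
              using IH[of "Suc a" i] IH[of "Suc (n1 - 1 - a)" "k - 2 - i"] by (simp add: c_def)
          qed
          finally show "(\<Sum>a=0..Suc n1. ?f a) = (\<Sum>a<n1. tutte a i * tutte (n1 - 1 - a) (k - 2 - i))" .
        qed
        finally have yy: "(y * y) $ (k - 2) $ Suc n1 =
           (\<Sum>a<n1. \<Sum>i\<le>k-2. tutte a i * tutte (n1 - 1 - a) (k - 2 - i))"
          by (subst sum.swap)
        have zz: "xcoeff (- int k) (z_series * Y) $ n1 = (\<Sum>j<2 * n1 + 2. zvar (Suc j) * c (k + j - 1) n1)"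
          by (rule zs) (use n k in auto)
        have "y $ k $ n = (if k < 2 then 0 else (y * y) $ (k - 2) $ Suc n1)
            + xcoeff (- int k) (z_series * Y) $ n1"
          unfolding n by (subst rec[OF k]) simp
        also have "\<dots> = tutte n1 k"
        proof (cases n1)
          case 0
          thus ?thesis unfolding yy zz using False by (simp add: c_def tutte_0)
        next
          case (Suc m)
          show ?thesis unfolding yy zz unfolding Suc using tutte_rec[OF k, of m "2 * Suc m + 2"]
            by (simp add: c_def Suc lessThan_Suc_atMost del: sum.lessThan_Suc sum.atMost_Suc)
        qed
        finally show ?thesis by (simp add: n)
      qed
    qed
  qed
qed

theorem theorem10p1:
  shows "(\<exists>!(R1, R2). R_system R1 R2) \<and>
    (\<forall>R1 R2. R_system R1 R2 \<longrightarrow>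
       fps_X ^ 2 * fps_deriv (fps_X * map_gf) = (R2 + R1 ^ 2) * (R2 + 9 * R1 ^ 2) \<and>
       fps_to_fls (fps_X * map_gf) =
         fls_X_inv * fps_to_fls ((R2 + R1 ^ 2) * (3 * R2 + 15 * R1 ^ 2 - 2 * fps_X)) +
         fps_to_fls (R1 * beta_coeff 1 R1 R2 - fps_const (zconst (1 / 2)) * beta_coeff 2 R1 R2))"
proof (intro conjI allI impI)
  obtain R1 R2 where R: "R_system R1 R2" using R_system_exists by blast
  show "\<exists>!(R1, R2). R_system R1 R2"
  proof (rule ex1I[of _ "(R1, R2)"])
    show "case (R1, R2) of (R1, R2) \<Rightarrow> R_system R1 R2" using R by simp
    fix p assume "case p of (R1, R2) \<Rightarrow> R_system R1 R2"
    thus "p = (R1, R2)" using R_system_unique[OF _ R] by (cases p) auto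
  qed
next
  fix R1 R2 assume sys: "R_system R1 R2"
  obtain Y y where rep: "x_tail (x_var * Y) y" and y0: "y $ 0 = fps_X"
    and q: "x_regular (Y * Y - (x_var - fps_X * z_series) * Y)"
    and y2: "y $ 2 = (R2 + R1\<^sup>2) * (3 * R2 + 15 * R1\<^sup>2 - 2 * fps_X)
       + fps_X * (R1 * beta_coeff 1 R1 R2 - half * beta_coeff 2 R1 R2)"
    and d: "fps_X * fps_deriv (y $ 2) - y $ 2 = (R2 + R1\<^sup>2) * (R2 + 9 * R1\<^sup>2)"
    by (rule one_cut_solution[OF sys])
  note coeff = tutte_recursion_unique[OF rep y0 q]
  \<comment> \<open>The coefficient of t^(n+2) is \<open>tutte (Suc n) 2\<close> on both sides; the
    two lower ones vanish.\<close>
  have G: "y $ 2 = fps_X * (fps_X * map_gf)"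
  proof (rule fps_ext)
    fix n
    show "y $ 2 $ n = (fps_X * (fps_X * map_gf)) $ n"
    proof (cases n)
      case (Suc n1)
      thus ?thesis by (cases n1) (auto simp: coeff tutte_0 map_gf_tutte)
    qed (simp add: coeff)
  qed
  show "fps_X ^ 2 * fps_deriv (fps_X * map_gf) = (R2 + R1\<^sup>2) * (R2 + 9 * R1\<^sup>2)"
    unfolding d[symmetric] G by (simp add: power2_eq_square algebra_simps)
  let ?A = "(R2 + R1\<^sup>2) * (3 * R2 + 15 * R1\<^sup>2 - 2 * fps_X)"
  let ?B = "R1 * beta_coeff 1 R1 R2 - half * beta_coeff 2 R1 R2"
  \<comment> \<open>This is t times the claim. The factor 1/t of the claim lives among Laurent
    series, so t is cancelled there.\<close>
  have "fps_X * (fps_X * map_gf) = ?A + fps_X * ?B" using y2 unfolding G .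
  hence "fps_to_fls (fps_X * (fps_X * map_gf)) = fps_to_fls (?A + fps_X * ?B)" by (rule arg_cong)
  hence e: "fls_X * fps_to_fls (fps_X * map_gf) = fps_to_fls ?A + fls_X * fps_to_fls ?B"
    by (simp only: fls_times_fps_to_fls fps_to_fls_plus fps_X_to_fls)
  have X: "fls_X_inv * (fls_X * f) = f" for f :: "zpoly fls"
    by (simp add: fls_X_inv_times_conv_shift fls_X_times_conv_shift)
  have "fps_to_fls (fps_X * map_gf) = fls_X_inv * (fls_X * fps_to_fls (fps_X * map_gf))" by (simp only: X)
  also have "\<dots> = fls_X_inv * fps_to_fls ?A + fps_to_fls ?B" unfolding e by (simp only: distrib_left X)
  finally show "fps_to_fls (fps_X * map_gf) = fls_X_inv * fps_to_fls ?A +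
      fps_to_fls (R1 * beta_coeff 1 R1 R2 - fps_const (zconst (1 / 2)) * beta_coeff 2 R1 R2)"
    unfolding half_def .
qed

end
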